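(* Let $T>0$. For any $f_0\in\mathcal P_2^{\mathrm{cm}}(\mathbb R)$ (so $\mathcal E(f_0)<\infty$) there exists a curve of maximal slope starting at $f_0$, i.e. a curve $f\in AC([0,T];(\mathcal P_2^{\mathrm{cm}}(\mathbb R),d_{\mathcal A}))$ with initial value $f_0$ such that $\mathcal G_T(f)=0$.
   Context: Notation. $\mathbb R^2_{\neq}:=\{(v,v_* )\in\mathbb R^2: v\neq v_*\}$; $\mathcal P(\mathbb R)$ is the set of Borel probability measures; $\mathcal P_2^{\mathrm{cm}}(\mathbb R)$ is the set of $f\in\mathcal P(\mathbb R)$ with $\int|v|^2df<\infty$ and $\int v\,df=0$; $\mathcal M(\mathbb R^2_{\neq})$ is the set of finite signed Radon measures on $\mathbb R^2_{\neq}$. Products $f\otimes f$ are restricted to $\mathbb R^2_{\neq}$. Fix $e\in[0,1)$ and set $\sigma_e(r)=\frac{1-e}{4}r$ for $r\ge0$. For $\varphi\in C^1(\mathbb R)$ let $\tilde\nabla\varphi(v,v_* )=\varphi'(v_* )-\varphi'(v)$. Nonlocal-local continuity equation. A pair $\{(f_t,U_t)\}_{t\in[0,T]}$ with $f_t\in\mathcal P(\mathbb R)$, $U_t\in\mathcal M(\mathbb R^2_{\neq})$, both weak-$*$ measurable in $t$, is a (weak) solution if $\int_0^T\iint_{\mathbb R^2_{\neq}}\sigma_e(|v-v_*|)\,d|U_t|\,dt<\infty$ and for every $\varphi\in C^1_c((0,T)\times\mathbb R)$ $$\int_0^T\int_{\mathbb R}\partial_t\varphi_t\,df_t\,dt+\int_0^T\iint_{\mathbb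 R^2_{\neq}}\sigma_e(|v-v_*|)\tilde\nabla\varphi_t\,dU_t\,dt=0.$$ Such $f$ is identified with its narrowly continuous representative. $\mathrm{CE}_T(\mu_0,\mu_T)$ denotes the solutions with $f_0=\mu_0$, $f_T=\mu_T$; $\mathrm{CE}_T$ the set of all solutions; $\mathrm{CE}:=\mathrm{CE}_1$. Action density. $\alpha(s,u)=u^2/s$ if $s>0$, $\alpha(s,u)=0$ if $u=0$, $\alpha(0,u)=+\infty$ if $u\neq0$; with $|\lambda|=f\otimes f+|U|$, $\mathcal A(f,U)=\iint_{\mathbb R^2_{\neq}}\alpha\big(\frac{d(f\otimes f)}{d|\lambda|},\frac{dU}{d|\lambda|}\big)\sigma_e(|v-v_*|)\,d|\lambda|$. Collision transport cost: $d_{\mathcal A}(\mu_0,\mu_1)^2=\inf\{\int_0^1\mathcal A(f_t,U_t)\,dt:(f,U)\in\mathrm{CE}(\mu_0,\mu_1)\}$. Absolutely continuous curves: $f\in AC([0,T];(X,d_{\mathcal A}))$, $X\subset\mathcal P(\mathbb R)$, means $f_t\in X$ and there is $m\in L^2(0,T)$ with $d_{\mathcal A}(f_{t_0},f_{t_1})\le\int_{t_0}^{t_1}m(t)\,dt$ for all $0<t_0\le t_1<T$. Its metric derivative is $|f'|(t)=\lim_{h\to0}d_{\mathcal A}(f_{t+h},f_t)/|h|$ for a.e. $t$. For such $f$ there is a unique flux $\{U_t\}$ with $(f,U)\in\mathrm{CE}_T$ and $|f'|^2(t)=\mathcal A(f_t,U_t)$ for a.e. $t$. Energy, dissipation, De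 Giorgi functional: $\mathcal E(f)=\frac12\int v^2\,df(v)$; $\mathcal D(f)=\iint_{\mathbb R^2_{\neq}}|v-v_*|^2\sigma_e(|v-v_*|)\,d(f\otimes f)$; for $f\in AC([0,T];(\mathcal P_2^{\mathrm{cm}}(\mathbb R),d_{\mathcal A}))$, $$\mathcal G_T(f)=\mathcal E(f_T)-\mathcal E(f_0)+\frac12\int_0^T\mathcal A(f_t,U_t)\,dt+\frac12\int_0^T\mathcal D(f_t)\,dt,$$ where $U_t$ is the unique flux with $|f'|^2(t)=\mathcal A(f_t,U_t)$ for a.e. $t$. A curve $f\in AC([0,T];(\mathcal P_2^{\mathrm{cm}}(\mathbb R),d_{\mathcal A}))$ is a curve of maximal slope if $\mathcal G_T(f)=0$. *)

theory Defs
  imports "HOL-Probability.Probability"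
begin

text \<open>
  A finite signed measure on the sigma-algebra of M is a real-valued, countably additive set
  function; only its values on sets M matter, and the measure component of M is not used.
  On the sigma-compact, locally compact metric space offdiag below, every such set function
  on the Borel sets is Radon, so no separate regularity condition is needed.
\<close>

definition signed_measure :: "'a measure \<Rightarrow> ('a set \<Rightarrow> real) \<Rightarrow> bool" where
  "signed_measure M U \<longleftrightarrow> U {} = 0 \<and>
     (\<forall>A. range A \<subseteq> sets M \<longrightarrow> disjoint_family A \<longrightarrow>
        (\<lambda>i::nat. U (A i)) sums U (\<Union>i. A i))"

text \<open>
  Jordan decomposition: the upper variation is the supremum of U over measurable subsets
  (negative values are truncated to 0 by ennreal, which is harmless since B may be empty).
\<close>

definition upper_variation :: "'a measure \<Rightarrow> ('a set \<Rightarrow> real) \<Rightarrow> 'a measure" where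
  "upper_variation M U =
     measure_of (space M) (sets M) (\<lambda>A. SUP B\<in>{B \<in> sets M. B \<subseteq> A}. ennreal (U B))"

definition lower_variation :: "'a measure \<Rightarrow> ('a set \<Rightarrow> real) \<Rightarrow> 'a measure" where
  "lower_variation M U = upper_variation M (\<lambda>A. - U A)"

definition add_measure :: "'a measure \<Rightarrow> 'a measure \<Rightarrow> 'a measure" where
  "add_measure M N = measure_of (space M) (sets M) (\<lambda>A. emeasure M A + emeasure N A)"

definition tot_variation :: "'a measure \<Rightarrow> ('a set \<Rightarrow> real) \<Rightarrow> 'a measure" where
  "tot_variation M U = add_measure (upper_variation M U) (lower_variation M U)"

definition signed_integral :: "'a measure \<Rightarrow> ('a set \<Rightarrow> real) \<Rightarrow> ('a \<Rightarrow> real) \<Rightarrow> real" where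
  "signed_integral M U g =
     (\<integral>x. g x \<partial>upper_variation M U) - (\<integral>x. g x \<partial>lower_variation M U)"

text \<open>The Radon-Nikodym density dU/dL of a signed measure U on the sigma-algebra of M.\<close>

definition signed_RN_deriv :: "'a measure \<Rightarrow> 'a measure \<Rightarrow> ('a set \<Rightarrow> real) \<Rightarrow> 'a \<Rightarrow> real" where
  "signed_RN_deriv L M U x =
     enn2real (RN_deriv L (upper_variation M U) x) - enn2real (RN_deriv L (lower_variation M U) x)"

definition offdiag :: "(real \<times> real) set" where
  "offdiag = {(v, w). v \<noteq> w}"

definition offdiag_borel :: "(real \<times> real) measure" where
  "offdiag_borel = restrict_space borel offdiag"

definition borel_prob :: "real measure set" where
  "borel_prob = {f. sets f = sets borel \<and> prob_space f}"

definition P2cm :: "real measure set" where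
  "P2cm = {f \<in> borel_prob. integrable f (\<lambda>v. v\<^sup>2) \<and> (\<integral>v. v \<partial>f) = 0}"

definition tensor :: "real measure \<Rightarrow> (real \<times> real) measure" where
  "tensor f = restrict_space (f \<Otimes>\<^sub>M f) offdiag"

definition sigma_e :: "real \<Rightarrow> real \<Rightarrow> real" where
  "sigma_e e r = (1 - e) / 4 * r"

definition nonlocal_grad :: "(real \<Rightarrow> real) \<Rightarrow> real \<times> real \<Rightarrow> real" where
  "nonlocal_grad \<phi> = (\<lambda>(v, w). deriv \<phi> w - deriv \<phi> v)"

text \<open>
  Continuously differentiable functions with compact support in the open strip (0,T) x R,
  extended by 0 to the whole plane.
\<close>

definition C1c_strip :: "real \<Rightarrow> (real \<Rightarrow> real \<Rightarrow> real) set" where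
  "C1c_strip T = {\<phi>.
     (\<forall>t v. (\<lambda>s. \<phi> s v) differentiable (at t) \<and> \<phi> t differentiable (at v)) \<and>
     continuous_on UNIV (\<lambda>(t, v). deriv (\<lambda>s. \<phi> s v) t) \<and>
     continuous_on UNIV (\<lambda>(t, v). deriv (\<phi> t) v) \<and>
     (\<exists>K. compact K \<and> K \<subseteq> {0<..<T} \<times> UNIV \<and> (\<forall>t v. (t, v) \<notin> K \<longrightarrow> \<phi> t v = 0))}"

definition Cc_on :: "'a::topological_space set \<Rightarrow> ('a \<Rightarrow> real) set" where
  "Cc_on S = {g. continuous_on S g \<and> (\<exists>K. compact K \<and> K \<subseteq> S \<and> (\<forall>x\<in>S - K. g x = 0))}"

text \<open>
  Weak-* measurability is Lebesgue measurability in t of the pairings with continuous compactly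
  supported functions; these are dense in the predual of continuous functions vanishing at infinity.
\<close>

definition weak_star_measurable :: "real \<Rightarrow> (real \<Rightarrow> real measure) \<Rightarrow> bool" where
  "weak_star_measurable T f \<longleftrightarrow>
     (\<forall>g\<in>Cc_on UNIV. (\<lambda>t. \<integral>v. g v \<partial>f t) \<in> borel_measurable (lebesgue_on {0..T}))"

definition weak_star_measurable_signed :: "real \<Rightarrow> (real \<Rightarrow> (real \<times> real) set \<Rightarrow> real) \<Rightarrow> bool" where
  "weak_star_measurable_signed T U \<longleftrightarrow>
     (\<forall>g\<in>Cc_on offdiag.
        (\<lambda>t. signed_integral offdiag_borel (U t) g) \<in> borel_measurable (lebesgue_on {0..T}))"

definition narrowly_continuous :: "real \<Rightarrow> (real \<Rightarrow> real measure) \<Rightarrow> bool" where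
  "narrowly_continuous T f \<longleftrightarrow>
     (\<forall>g :: real \<Rightarrow> real. continuous_on UNIV g \<longrightarrow> bounded (range g) \<longrightarrow>
        continuous_on {0..T} (\<lambda>t. \<integral>v. g v \<partial>f t))"

text \<open>
  Solutions of the continuity equation, with f its narrowly continuous representative.
  Curves are functions on all of R of which only the restriction to [0,T] is constrained.
\<close>

definition CE :: "real \<Rightarrow> real \<Rightarrow> ((real \<Rightarrow> real measure) \<times> (real \<Rightarrow> (real \<times> real) set \<Rightarrow> real)) set" where
  "CE e T = {(f, U).
     (\<forall>t\<in>{0..T}. f t \<in> borel_prob) \<and>
     (\<forall>t\<in>{0..T}. signed_measure offdiag_borel (U t)) \<and>
     weak_star_measurable T f \<and> weak_star_measurable_signed T U \<and> narrowly_continuous T f \<and>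
     (\<integral>\<^sup>+t. (\<integral>\<^sup>+p. ennreal (sigma_e e \<bar>fst p - snd p\<bar>) \<partial>tot_variation offdiag_borel (U t))
        \<partial>lebesgue_on {0..T}) < \<infinity> \<and>
     (\<forall>\<phi>\<in>C1c_strip T.
        (\<integral>t. (\<integral>v. deriv (\<lambda>s. \<phi> s v) t \<partial>f t) \<partial>lebesgue_on {0..T}) +
        (\<integral>t. signed_integral offdiag_borel (U t)
               (\<lambda>p. sigma_e e \<bar>fst p - snd p\<bar> * nonlocal_grad (\<phi> t) p) \<partial>lebesgue_on {0..T}) = 0)}"

definition CE_between where
  "CE_between e T \<mu>0 \<mu>T = {(f, U) \<in> CE e T. f 0 = \<mu>0 \<and> f T = \<mu>T}"

definition action_density :: "real \<Rightarrow> real \<Rightarrow> ennreal" where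
  "action_density s u = (if s > 0 then ennreal (u\<^sup>2 / s) else if u = 0 then 0 else \<infinity>)"

definition action :: "real \<Rightarrow> real measure \<Rightarrow> ((real \<times> real) set \<Rightarrow> real) \<Rightarrow> ennreal" where
  "action e f U =
     (let L = add_measure (tensor f) (tot_variation offdiag_borel U) in
      \<integral>\<^sup>+p. action_density (enn2real (RN_deriv L (tensor f) p)) (signed_RN_deriv L offdiag_borel U p)
           * ennreal (sigma_e e \<bar>fst p - snd p\<bar>) \<partial>L)"

definition transport_cost_sq :: "real \<Rightarrow> real measure \<Rightarrow> real measure \<Rightarrow> ennreal" where
  "transport_cost_sq e \<mu>0 \<mu>1 =
     (INF (f, U)\<in>CE_between e 1 \<mu>0 \<mu>1. \<integral>\<^sup>+t. action e (f t) (U t) \<partial>lebesgue_on {0..1})"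

definition transport_cost :: "real \<Rightarrow> real measure \<Rightarrow> real measure \<Rightarrow> ennreal" where
  "transport_cost e \<mu>0 \<mu>1 =
     (if transport_cost_sq e \<mu>0 \<mu>1 = \<infinity> then \<infinity>
      else ennreal (sqrt (enn2real (transport_cost_sq e \<mu>0 \<mu>1))))"

definition AC :: "real \<Rightarrow> real \<Rightarrow> real measure set \<Rightarrow> (real \<Rightarrow> real measure) set" where
  "AC e T X = {f.
     (\<forall>t\<in>{0..T}. f t \<in> X) \<and>
     (\<exists>m :: real \<Rightarrow> real.
        m \<in> borel_measurable (lebesgue_on {0<..<T}) \<and>
        integrable (lebesgue_on {0<..<T}) (\<lambda>t. (m t)\<^sup>2) \<and>
        (\<forall>t0 t1. 0 < t0 \<and> t0 \<le> t1 \<and> t1 < T \<longrightarrow>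
           enn2ereal (transport_cost e (f t0) (f t1)) \<le> ereal (\<integral>t. m t \<partial>lebesgue_on {t0..t1})))}"

definition has_metric_deriv :: "real \<Rightarrow> (real \<Rightarrow> real measure) \<Rightarrow> real \<Rightarrow> ennreal \<Rightarrow> bool" where
  "has_metric_deriv e f t l \<longleftrightarrow>
     ((\<lambda>h. transport_cost e (f (t + h)) (f t) / ennreal \<bar>h\<bar>) \<longlongrightarrow> l) (at 0)"

definition is_flux :: "real \<Rightarrow> real \<Rightarrow> (real \<Rightarrow> real measure) \<Rightarrow> (real \<Rightarrow> (real \<times> real) set \<Rightarrow> real) \<Rightarrow> bool" where
  "is_flux e T f U \<longleftrightarrow> (f, U) \<in> CE e T \<and>
     (AE t in lebesgue_on {0..T}. \<exists>l. has_metric_deriv e f t l \<and> l\<^sup>2 = action e (f t) (U t))"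

text \<open>
  The flux of an absolutely continuous curve is unique only up to null sets of times
  (and up to its values on non-Borel sets); the choice does not affect the time integrals below.
\<close>

definition the_flux :: "real \<Rightarrow> real \<Rightarrow> (real \<Rightarrow> real measure) \<Rightarrow> real \<Rightarrow> (real \<times> real) set \<Rightarrow> real" where
  "the_flux e T f = (SOME U. is_flux e T f U)"

definition energy :: "real measure \<Rightarrow> real" where
  "energy f = 1 / 2 * (\<integral>v. v\<^sup>2 \<partial>f)"

definition dissipation :: "real \<Rightarrow> real measure \<Rightarrow> ennreal" where
  "dissipation e f =
     (\<integral>\<^sup>+p. ennreal (\<bar>fst p - snd p\<bar>\<^sup>2 * sigma_e e \<bar>fst p - snd p\<bar>) \<partial>tensor f)"

definition De_Giorgi :: "real \<Rightarrow> real \<Rightarrow> (real \<Rightarrow> real measure) \<Rightarrow> ereal" where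
  "De_Giorgi e T f =
     ereal (energy (f T) - energy (f 0)) +
     ereal (1 / 2) * enn2ereal (\<integral>\<^sup>+t. action e (f t) (the_flux e T f t) \<partial>lebesgue_on {0..T}) +
     ereal (1 / 2) * enn2ereal (\<integral>\<^sup>+t. dissipation e (f t) \<partial>lebesgue_on {0..T})"

text \<open>
  The existence of a flux is stated so that the choice in the_flux is never vacuous. It also
  makes f narrowly continuous up to the endpoints of [0,T], which the defining inequality
  of AC (for times in the open interval only) does not give by itself.
\<close>

definition curve_of_maximal_slope :: "real \<Rightarrow> real \<Rightarrow> (real \<Rightarrow> real measure) \<Rightarrow> bool" where
  "curve_of_maximal_slope e T f \<longleftrightarrow>
     f \<in> AC e T P2cm \<and> (\<exists>U. is_flux e T f U) \<and> De_Giorgi e T f = 0"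

end

theory Submission
  imports Defs "HOL-Complex_Analysis.Great_Picard"
begin

text \<open>
  The curve is the solution of the friction equation that is the formal gradient flow of the energy.
  Write \<open>c = (1 - e) / 4\<close>. With the flux \<open>U = (v - w) f \<otimes> f\<close> the
  action and the dissipation of a measure coincide, and the continuity equation becomes the law of
  particles obeying the mean-field equation
  \<open>v' = - 2 c \<integral> \<bar>v - w\<bar> (v - w) df(w)\<close>. The equation is solved on the
  Lagrangian side: the initial law is kept fixed, and every initial position \<open>x\<close> gets a
  trajectory \<open>X t x\<close> (\<open>flow_exists\<close>). The friction is an increasing function
  of the relative velocity, so the flow map preserves the order of the particles and contracts their
  distances. This controls an explicit Euler scheme although the friction grows quadratically, and it
  makes all later uses of dominated convergence possible with second moments of the initial law only.
  The curve is \<open>law t\<close>, the image of the initial law under \<open>X t\<close>.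

  Because the friction is quadratic, two particles at distance \<open>g\<close> approach at a rate of at
  least \<open>c g\<^sup>2\<close>, and their distance is at most \<open>1 / (c t)\<close> at time
  \<open>t > 0\<close> (\<open>gap_decay\<close>). Since the mean stays zero, the laws have bounded support
  at positive times, and the dissipation is finite and continuous there, even if it is infinite at
  the start. Testing the equation with the velocity itself gives the energy identity: the energy
  decreases at a rate equal to the dissipation (\<open>energy_identity\<close>).

  The De Giorgi functional therefore vanishes as soon as the squared metric derivative of the curve is
  its dissipation, because every flux that realizes the metric derivative then has the dissipation
  as its action for almost every time. The metric derivative is computed from two sides.

  From above, the curve itself, run through with another speed, is a competitor for the transport cost
  (\<open>curve_in_CE\<close>). A linear change of time bounds the difference quotients of the cost
  (\<open>cost_le_linear\<close>), and a change of time inverse to the speed bounds the cost between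
  any two times by a length, which is absolute continuity (\<open>cost_le_length\<close>).

  From below, Cauchy--Schwarz bounds the flux of an arbitrary competitor, tested with the nonlocal
  gradient of a function, by its action and a kinetic term of that function
  (\<open>flux_bound_by_action\<close>). Along a competitor of small cost the first moments stay bounded
  and the kinetic term hardly changes, so the increment of one test function bounds the cost from below
  to leading order (\<open>transport_cost_lower_bound\<close>). A test function that
  equals \<open>v\<^sup>2 / 2\<close> up to a constant on the support of \<open>law t\<close> has the dissipation both as its
  kinetic term and as its rate of decrease, and with it the lower bound meets the upper one
  (\<open>metric_derivative\<close>).
\<close>

section \<open>Finite signed measures\<close>

lemma signed_measure_empty: "signed_measure M U \<Longrightarrow> U {} = 0"
  by (simp add: signed_measure_def)

lemma signed_measure_sums:
  "signed_measure M U \<Longrightarrow> range A \<subseteq> sets M \<Longrightarrow> disjoint_family A \<Longrightarrow>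
    (\<lambda>i::nat. U (A i)) sums U (\<Union>i. A i)"
  by (simp add: signed_measure_def)

lemma signed_measure_uminus:
  assumes "signed_measure M U"
  shows "signed_measure M (\<lambda>A. - U A)"
  using assms unfolding signed_measure_def by (auto intro: sums_minus)

lemma signed_measure_Un:
  assumes U: "signed_measure M U" and A: "A \<in> sets M" and B: "B \<in> sets M" and "A \<inter> B = {}"
  shows "U (A \<union> B) = U A + U B"
proof -
  have "disjoint_family (binaryset A B)"
    using \<open>A \<inter> B = {}\<close> by (auto simp: disjoint_family_on_def binaryset_def)
  then have "(\<lambda>i. U (binaryset A B i)) sums U (\<Union>i. binaryset A B i)"
    using A B by (intro signed_measure_sums[OF U]) (auto simp: range_binaryset_eq)
  moreover have "(\<lambda>i. U (binaryset A B i)) sums (U A + U B)"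
    using binaryset_sums[of U A B] signed_measure_empty[OF U] by simp
  ultimately show ?thesis
    by (metis UN_binaryset_eq sums_unique2)
qed

lemma signed_measure_Diff:
  assumes U: "signed_measure M U" and A: "A \<in> sets M" and B: "B \<in> sets M" and "B \<subseteq> A"
  shows "U (A - B) = U A - U B"
proof -
  have "B \<union> (A - B) = A" using \<open>B \<subseteq> A\<close> by auto
  then show ?thesis
    using signed_measure_Un[OF U B, of "A - B"] A B by auto
qed

text \<open>
  The set function whose measure is the upper variation. That it is a finite measure is the core of the
  Jordan decomposition.
\<close>

definition sup_below :: "'a measure \<Rightarrow> ('a set \<Rightarrow> real) \<Rightarrow> 'a set \<Rightarrow> ennreal" where
  "sup_below M U A = (SUP B\<in>{B \<in> sets M. B \<subseteq> A}. ennreal (U B))"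

lemma sup_below_upper: "B \<in> sets M \<Longrightarrow> B \<subseteq> A \<Longrightarrow> ennreal (U B) \<le> sup_below M U A"
  unfolding sup_below_def by (rule SUP_upper) auto

lemma sup_below_empty: "signed_measure M U \<Longrightarrow> sup_below M U {} = 0"
  unfolding sup_below_def by (auto simp: signed_measure_empty cong: conj_cong)

lemma sup_below_mono: "A \<subseteq> B \<Longrightarrow> sup_below M U A \<le> sup_below M U B"
  unfolding sup_below_def by (rule SUP_subset_mono) auto

text \<open>
  Witnesses below two disjoint sets combine into a witness below the union; a witness of negative
  value is worth zero, and the other one alone suffices.
\<close>

lemma sup_below_superadditive:
  assumes U: "signed_measure M U" and "A \<inter> B = {}"
  shows "sup_below M U A + sup_below M U B \<le> sup_below M U (A \<union> B)"
proof -
  let ?S = "\<lambda>A. {B \<in> sets M. B \<subseteq> A}"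
  have ne: "?S X \<noteq> {}" for X by (auto intro: exI[of _ "{}"])
  have key: "ennreal (U C) + ennreal (U D) \<le> sup_below M U (A \<union> B)" if "C \<in> ?S A" "D \<in> ?S B" for C D
  proof -
    have CD: "U (C \<union> D) = U C + U D" using signed_measure_Un[OF U] that assms(2) by blast
    have 1: "ennreal (U C) \<le> sup_below M U (A \<union> B)" "ennreal (U D) \<le> sup_below M U (A \<union> B)"
      "ennreal (U (C \<union> D)) \<le> sup_below M U (A \<union> B)"
      using that by (auto intro!: sup_below_upper)
    show ?thesis
    proof (cases "U C \<ge> 0 \<and> U D \<ge> 0")
      case True
      then show ?thesis using 1(3) CD by (simp add: ennreal_plus)
    next
      case False
      then show ?thesis using 1(1,2) by (auto simp: ennreal_neg not_le less_imp_le)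
    qed
  qed
  have "sup_below M U A + sup_below M U B
      = (SUP C\<in>?S A. ennreal (U C) + sup_below M U B)"
    unfolding sup_below_def[of M U A] by (rule ennreal_SUP_add_left[OF ne, symmetric])
  also have "\<dots> \<le> sup_below M U (A \<union> B)"
  proof (rule SUP_least)
    fix C assume C: "C \<in> ?S A"
    have "ennreal (U C) + sup_below M U B = (SUP D\<in>?S B. ennreal (U C) + ennreal (U D))"
      unfolding sup_below_def[of M U B] using ne[of B] by (simp add: ennreal_SUP_add_right)
    also have "\<dots> \<le> sup_below M U (A \<union> B)" by (rule SUP_least) (use key[OF C] in auto)
    finally show "ennreal (U C) + sup_below M U B \<le> sup_below M U (A \<union> B)" .
  qed
  finally show ?thesis .
qed

lemma sup_below_countably_additive:
  assumes U: "signed_measure M U"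
  shows "countably_additive (sets M) (sup_below M U)"
proof (rule countably_additiveI)
  fix A :: "nat \<Rightarrow> 'a set"
  assume A: "range A \<subseteq> sets M" "disjoint_family A" "(\<Union>i. A i) \<in> sets M"
  have fin: "(\<Sum>i<n. sup_below M U (A i)) \<le> sup_below M U (\<Union>i<n. A i)" for n
  proof (induction n)
    case 0 then show ?case by simp
  next
    case (Suc n)
    have "(\<Sum>i<Suc n. sup_below M U (A i)) \<le> sup_below M U (\<Union>i<n. A i) + sup_below M U (A n)"
      using Suc by (simp add: add_right_mono)
    also have "\<dots> \<le> sup_below M U ((\<Union>i<n. A i) \<union> A n)"
    proof (rule sup_below_superadditive[OF U])
      show "(\<Union>i<n. A i) \<inter> A n = {}"
      proof -
        have "A i \<inter> A n = {}" if "i < n" for i using disjoint_family_onD[OF A(2), of i n] that by auto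
        then show ?thesis by blast
      qed
    qed
    also have "(\<Union>i<n. A i) \<union> A n = (\<Union>i<Suc n. A i)" by (auto simp: less_Suc_eq)
    finally show ?case .
  qed
  have "(\<Sum>i. sup_below M U (A i)) = sup_below M U (\<Union>i. A i)"
  proof (rule antisym)
    show "(\<Sum>i. sup_below M U (A i)) \<le> sup_below M U (\<Union>i. A i)"
      unfolding suminf_eq_SUP
      by (rule SUP_least, rule order_trans[OF fin], rule sup_below_mono) auto
    show "sup_below M U (\<Union>i. A i) \<le> (\<Sum>i. sup_below M U (A i))"
      unfolding sup_below_def[of M U "\<Union>i. A i"]
    proof (rule SUP_least, clarsimp)
      fix B assume B: "B \<in> sets M" "B \<subseteq> (\<Union>i. A i)"
      have dis: "disjoint_family (\<lambda>i. B \<inter> A i)" using A(2) by (auto simp: disjoint_family_on_def)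
      have "(\<lambda>i. U (B \<inter> A i)) sums U (\<Union>i. B \<inter> A i)"
        using A(1) B by (intro signed_measure_sums[OF U _ dis]) auto
      moreover have "(\<Union>i. B \<inter> A i) = B" using B by auto
      ultimately have s: "(\<lambda>i. U (B \<inter> A i)) sums U B" by simp
      have "ennreal (\<Sum>i<n. U (B \<inter> A i)) \<le> (\<Sum>i. sup_below M U (A i))" for n
      proof -
        have "ennreal (\<Sum>i<n. U (B \<inter> A i)) \<le> ennreal (\<Sum>i<n. max 0 (U (B \<inter> A i)))"
          by (intro ennreal_leI sum_mono) auto
        also have "\<dots> = (\<Sum>i<n. ennreal (max 0 (U (B \<inter> A i))))" by (rule sum_ennreal[symmetric]) auto
        also have "\<dots> \<le> (\<Sum>i<n. sup_below M U (A i))"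
        proof (rule sum_mono)
          fix i
          have "ennreal (U (B \<inter> A i)) \<le> sup_below M U (A i)"
            using A(1) B by (intro sup_below_upper) auto
          then show "ennreal (max 0 (U (B \<inter> A i))) \<le> sup_below M U (A i)"
            by (cases "U (B \<inter> A i) \<le> 0") (auto simp: max_def)
        qed
        also have "\<dots> \<le> (\<Sum>i. sup_below M U (A i))" by (rule sum_le_suminf) auto
        finally show ?thesis .
      qed
      moreover have "(\<lambda>n. ennreal (\<Sum>i<n. U (B \<inter> A i))) \<longlonglongrightarrow> ennreal (U B)"
        using s unfolding sums_def by (rule tendsto_ennrealI)
      ultimately show "ennreal (U B) \<le> (\<Sum>i. sup_below M U (A i))"
        by (intro LIMSEQ_le_const2) auto
    qed
  qed
  then show "(\<Sum>i. sup_below M U (A i)) = sup_below M U (\<Union>i. A i)" .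
qed

lemma sets_upper_variation [simp, measurable_cong]: "sets (upper_variation M U) = sets M"
  unfolding upper_variation_def by simp

lemma space_upper_variation [simp]: "space (upper_variation M U) = space M"
  unfolding upper_variation_def by simp

lemma emeasure_upper_variation:
  assumes U: "signed_measure M U" and A: "A \<in> sets M"
  shows "emeasure (upper_variation M U) A = sup_below M U A"
  unfolding upper_variation_def sup_below_def[symmetric]
proof (rule emeasure_measure_of_sigma)
  show "sigma_algebra (space M) (sets M)" ..
  show "positive (sets M) (sup_below M U)" by (simp add: positive_def sup_below_empty[OF U])
qed (use U A in \<open>auto intro: sup_below_countably_additive\<close>)

text \<open>
  If the upper variation of a set were infinite, a piece with absolute value at least one could be
  split off so that the rest still has infinite upper variation. Repeating this produces disjoint
  sets on which the signed measure does not tend to zero, against countable additivity.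
\<close>

lemma sup_below_split:
  assumes U: "signed_measure M U" and A: "A \<in> sets M" and inf: "sup_below M U A = \<infinity>"
  shows "\<exists>B\<in>sets M. B \<subseteq> A \<and> sup_below M U B = \<infinity> \<and> \<bar>U (A - B)\<bar> \<ge> 1"
proof -
  have "ennreal (1 + \<bar>U A\<bar>) < sup_below M U A" unfolding inf by simp
  then obtain C where C: "C \<in> sets M" "C \<subseteq> A" "ennreal (1 + \<bar>U A\<bar>) < ennreal (U C)"
    unfolding sup_below_def by (auto simp: less_SUP_iff)
  have UC: "U C > 1 + \<bar>U A\<bar>"
    using C(3) ennreal_less_iff[of "1 + \<bar>U A\<bar>" "U C"] by (simp del: ennreal_plus)
  have "emeasure (upper_variation M U) C + emeasure (upper_variation M U) (A - C)
      = emeasure (upper_variation M U) (C \<union> (A - C))"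
    using A C by (intro plus_emeasure) auto
  also have "C \<union> (A - C) = A" using C by auto
  finally have "sup_below M U C + sup_below M U (A - C) = \<infinity>"
    using A C inf by (simp add: emeasure_upper_variation[OF U] sets.Diff)
  then consider "sup_below M U C = \<infinity>" | "sup_below M U (A - C) = \<infinity>" by auto
  then show ?thesis
  proof cases
    case 1
    have "U (A - C) = U A - U C" by (rule signed_measure_Diff[OF U A C(1,2)])
    then have "\<bar>U (A - C)\<bar> \<ge> 1" using UC by linarith
    then show ?thesis using 1 C by blast
  next
    case 2
    have "A - (A - C) = C" using C by auto
    then have "\<bar>U (A - (A - C))\<bar> \<ge> 1" using UC by simp
    then show ?thesis using 2 A C by blast
  qed
qed

lemma sup_below_finite:
  assumes U: "signed_measure M U" and A: "A \<in> sets M"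
  shows "sup_below M U A < \<infinity>"
proof (rule ccontr)
  assume "\<not> ?thesis"
  then have inf: "sup_below M U A = \<infinity>" by (simp add: less_top[symmetric])
  define P where "P B \<longleftrightarrow> B \<in> sets M \<and> sup_below M U B = \<infinity>" for B
  have "\<exists>B. \<forall>n. P (B n) \<and> (B (Suc n) \<subseteq> B n \<and> \<bar>U (B n - B (Suc n))\<bar> \<ge> 1)"
  proof (rule dependent_nat_choice)
    show "\<exists>B. P B" using A inf by (auto simp: P_def)
    show "\<exists>B'. P B' \<and> B' \<subseteq> B \<and> \<bar>U (B - B')\<bar> \<ge> 1" if "P B" for B
      using sup_below_split[OF U, of B] that by (auto simp: P_def)
  qed
  then obtain B where PB: "\<forall>n. P (B n) \<and> (B (Suc n) \<subseteq> B n \<and> \<bar>U (B n - B (Suc n))\<bar> \<ge> 1)" ..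
  then have B: "P (B n)" "B (Suc n) \<subseteq> B n" "\<bar>U (B n - B (Suc n))\<bar> \<ge> 1" for n
    by auto
  have dec: "decseq B" using B(2) by (simp add: decseq_Suc_iff)
  have dis: "disjoint_family (\<lambda>n. B n - B (Suc n))"
  proof -
    have "(B m - B (Suc m)) \<inter> (B n - B (Suc n)) = {}" if "m < n" for m n
      using decseqD[OF dec, of "Suc m" n] that by auto
    then show ?thesis
      unfolding disjoint_family_on_def
      by (intro ballI impI) (metis Int_commute nat_neq_iff)
  qed
  have "range (\<lambda>n. B n - B (Suc n)) \<subseteq> sets M"
    using B(1) unfolding P_def by auto
  then have "(\<lambda>n. U (B n - B (Suc n))) sums U (\<Union>n. B n - B (Suc n))"
    by (rule signed_measure_sums[OF U _ dis])
  then have "(\<lambda>n. U (B n - B (Suc n))) \<longlonglongrightarrow> 0"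
    by (intro summable_LIMSEQ_zero) (auto simp: sums_iff)
  then have "\<forall>\<^sub>F n in sequentially. \<bar>U (B n - B (Suc n))\<bar> < 1"
    by (auto simp: dist_real_def dest: tendstoD[of _ _ _ 1])
  then show False
    using B(3) by (auto simp: eventually_sequentially not_less[symmetric])
qed

lemma finite_measure_upper_variation:
  assumes U: "signed_measure M U"
  shows "finite_measure (upper_variation M U)"
proof (rule finite_measureI)
  show "emeasure (upper_variation M U) (space (upper_variation M U)) \<noteq> \<infinity>"
    using sup_below_finite[OF U sets.top] by (simp add: emeasure_upper_variation[OF U])
qed

text \<open>
  A Hahn set for the two variations is one for the signed measure: each variation vanishes on one
  side of it.
\<close>

lemma signed_Hahn_set:
  assumes U: "signed_measure M U"
  obtains Y where "Y \<in> sets M" "emeasure (lower_variation M U) Y = 0"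
    "emeasure (upper_variation M U) (space M - Y) = 0"
proof -
  have U': "signed_measure M (\<lambda>A. - U A)" by (rule signed_measure_uminus[OF U])
  let ?P = "upper_variation M U" and ?N = "lower_variation M U"
  have eN: "emeasure ?N A = sup_below M (\<lambda>A. - U A) A" if "A \<in> sets M" for A
    unfolding lower_variation_def using emeasure_upper_variation[OF U' that] .
  have sN: "sets ?N = sets M" unfolding lower_variation_def by simp
  interpret P: finite_measure ?P by (rule finite_measure_upper_variation[OF U])
  interpret N: finite_measure ?N unfolding lower_variation_def by (rule finite_measure_upper_variation[OF U'])
  have "\<exists>Y\<in>sets ?P. (\<forall>X\<in>sets ?P. X \<subseteq> Y \<longrightarrow> ?N X \<le> ?P X) \<and> (\<forall>X\<in>sets ?P. X \<inter> Y = {} \<longrightarrow> ?P X \<le> ?N X)"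
    by (rule finite_unsigned_Hahn_decomposition) (use sN in \<open>auto intro: P.finite_measure_axioms N.finite_measure_axioms\<close>)
  then obtain Y where Y: "Y \<in> sets M" "\<And>X. X \<in> sets M \<Longrightarrow> X \<subseteq> Y \<Longrightarrow> ?N X \<le> ?P X"
      "\<And>X. X \<in> sets M \<Longrightarrow> X \<inter> Y = {} \<Longrightarrow> ?P X \<le> ?N X" by auto
  have nonneg: "V X \<ge> 0"
    if V: "signed_measure M V" and X: "X \<in> sets M" and le: "sup_below M (\<lambda>A. - V A) X \<le> sup_below M V X" for V X
  proof (rule ccontr)
    assume n: "\<not> V X \<ge> 0"
    have V': "signed_measure M (\<lambda>A. - V A)" by (rule signed_measure_uminus[OF V])
    obtain B where *: "sup_below M V X = ennreal B" "B \<ge> 0"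
      using sup_below_finite[OF V X] by (cases "sup_below M V X") auto
    have "sup_below M V X + ennreal (- V X) \<le> sup_below M (\<lambda>A. - V A) X"
    proof -
      have "ennreal (V C) + ennreal (- V X) \<le> sup_below M (\<lambda>A. - V A) X" if C: "C \<in> sets M" "C \<subseteq> X" for C
      proof -
        have "- V X + V C = - V (X - C)" using signed_measure_Diff[OF V X C] by simp
        moreover have "ennreal (- V (X - C)) \<le> sup_below M (\<lambda>A. - V A) X" "ennreal (- V X) \<le> sup_below M (\<lambda>A. - V A) X"
          using C X by (auto intro!: sup_below_upper[where U="\<lambda>A. - V A"])
        ultimately show ?thesis
          using n by (cases "V C \<ge> 0") (auto simp: ennreal_plus[symmetric] ennreal_neg add.commute simp del: ennreal_plus)
      qed
      then have "(SUP C\<in>{C \<in> sets M. C \<subseteq> X}. ennreal (V C) + ennreal (- V X)) \<le> sup_below M (\<lambda>A. - V A) X"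
        by (intro SUP_least) auto
      then show ?thesis
        unfolding sup_below_def[of M V X] by (subst (asm) ennreal_SUP_add_left) auto
    qed
    then have "ennreal B + ennreal (- V X) \<le> ennreal B" using le unfolding * by (rule order_trans)
    then have "B - V X \<le> B" using n * by (simp add: ennreal_plus[symmetric] ennreal_le_iff del: ennreal_plus)
    then show False using n by simp
  qed
  have "emeasure ?N Y = 0"
  proof -
    have "ennreal (- U B) = 0" if "B \<in> sets M" "B \<subseteq> Y" for B
      using nonneg[OF U that(1)] Y(2)[OF that] that(1)
      by (simp add: eN emeasure_upper_variation[OF U] ennreal_neg)
    then show ?thesis using Y(1) by (subst eN) (auto simp: sup_below_def intro!: SUP_eq_const)
  qed
  moreover have "emeasure ?P (space M - Y) = 0"
  proof -
    have "ennreal (U B) = 0" if "B \<in> sets M" "B \<subseteq> space M - Y" for B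
    proof -
      have "B \<inter> Y = {}" using that by auto
      then show ?thesis
        using nonneg[OF U' that(1)] Y(3)[OF that(1)] that(1)
        by (simp add: eN emeasure_upper_variation[OF U] ennreal_neg)
    qed
    then show ?thesis using Y(1) by (subst emeasure_upper_variation[OF U]) (auto simp: sup_below_def intro!: SUP_eq_const)
  qed
  ultimately show ?thesis using Y(1) that by blast
qed

section \<open>The action controls the flux\<close>

lemma sets_add_measure [simp, measurable_cong]: "sets (add_measure M N) = sets M"
  unfolding add_measure_def by simp

lemma space_add_measure [simp]: "space (add_measure M N) = space M"
  unfolding add_measure_def by simp

lemma emeasure_add_measure:
  assumes "sets N = sets M" and "A \<in> sets M"
  shows "emeasure (add_measure M N) A = emeasure M A + emeasure N A"
  unfolding add_measure_def
proof (rule emeasure_measure_of_sigma)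
  show "sigma_algebra (space M) (sets M)" ..
  show "positive (sets M) (\<lambda>A. emeasure M A + emeasure N A)" by (simp add: positive_def)
  show "countably_additive (sets M) (\<lambda>A. emeasure M A + emeasure N A)"
  proof (rule countably_additiveI)
    fix A :: "nat \<Rightarrow> _"
    assume A: "range A \<subseteq> sets M" "disjoint_family A" "\<Union> (range A) \<in> sets M"
    have "(\<Sum>i. emeasure M (A i) + emeasure N (A i)) = (\<Sum>i. emeasure M (A i)) + (\<Sum>i. emeasure N (A i))"
      by (rule suminf_add[symmetric]) auto
    then show "(\<Sum>i. emeasure M (A i) + emeasure N (A i)) = emeasure M (\<Union> (range A)) + emeasure N (\<Union> (range A))"
      using A assms(1) by (simp add: suminf_emeasure)
  qed
qed (use assms in auto)

lemma nn_integral_add_measure: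
  assumes S: "sets N = sets M" and f: "f \<in> borel_measurable M"
  shows "(\<integral>\<^sup>+x. f x \<partial>add_measure M N) = (\<integral>\<^sup>+x. f x \<partial>M) + (\<integral>\<^sup>+x. f x \<partial>N)"
proof -
  have sp: "space N = space M" using S by (rule sets_eq_imp_space_eq)
  show ?thesis using f
  proof (induction rule: borel_measurable_induct)
    case (cong f g)
    then show ?case using sp by (simp cong: nn_integral_cong_simp)
  next
    case (set A)
    then show ?case using S by (simp add: emeasure_add_measure)
  next
    case (mult u c)
    then show ?case using S by (simp add: nn_integral_cmult distrib_left measurable_cong_sets[OF S refl]
          measurable_cong_sets[OF sets_add_measure refl])
  next
    case (add u v)
    then show ?case using S by (simp add: nn_integral_add ac_simps measurable_cong_sets[OF S refl]
          measurable_cong_sets[OF sets_add_measure refl])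
  next
    case (seq U)
    have m: "U i \<in> borel_measurable N" "U i \<in> borel_measurable (add_measure M N)" for i
      using seq(1)[of i] S by (simp_all cong: measurable_cong_sets)
    have "(\<integral>\<^sup>+x. (SUP i. U i x) \<partial>add_measure M N) = (SUP i. (\<integral>\<^sup>+x. U i x \<partial>M) + (\<integral>\<^sup>+x. U i x \<partial>N))"
      using seq m by (subst nn_integral_monotone_convergence_SUP) auto
    also have "\<dots> = (SUP i. \<integral>\<^sup>+x. U i x \<partial>M) + (SUP i. \<integral>\<^sup>+x. U i x \<partial>N)"
      using seq(3) by (intro ennreal_SUP_add) (auto simp: incseq_def le_fun_def intro!: nn_integral_mono)
    also have "\<dots> = (\<integral>\<^sup>+x. (SUP i. U i x) \<partial>M) + (\<integral>\<^sup>+x. (SUP i. U i x) \<partial>N)"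
      using seq m by (simp add: nn_integral_monotone_convergence_SUP)
    finally show ?case by (simp add: image_comp)
  qed
qed

lemma sets_lower_variation [simp, measurable_cong]: "sets (lower_variation M U) = sets M"
  and space_lower_variation [simp]: "space (lower_variation M U) = space M"
  unfolding lower_variation_def by simp_all

lemma sets_tot_variation [simp, measurable_cong]: "sets (tot_variation M U) = sets M"
  and space_tot_variation [simp]: "space (tot_variation M U) = space M"
  unfolding tot_variation_def by simp_all

lemma finite_measure_lower_variation:
  "signed_measure M U \<Longrightarrow> finite_measure (lower_variation M U)"
  unfolding lower_variation_def by (intro finite_measure_upper_variation signed_measure_uminus)

lemma signed_integral_le_tot_variation:
  assumes g: "g \<in> borel_measurable M"
  shows "ennreal \<bar>signed_integral M U g\<bar> \<le> (\<integral>\<^sup>+x. ennreal \<bar>g x\<bar> \<partial>tot_variation M U)"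
proof -
  have le: "ennreal \<bar>\<integral>x. g x \<partial>N\<bar> \<le> (\<integral>\<^sup>+x. ennreal \<bar>g x\<bar> \<partial>N)" for N
    using integral_norm_bound_ennreal[of N g] by (cases "integrable N g") (auto simp: not_integrable_integral_eq)
  have "ennreal \<bar>signed_integral M U g\<bar> \<le>
     ennreal (\<bar>\<integral>x. g x \<partial>upper_variation M U\<bar> + \<bar>\<integral>x. g x \<partial>lower_variation M U\<bar>)"
    unfolding signed_integral_def by (intro ennreal_leI) auto
  also have "\<dots> \<le> (\<integral>\<^sup>+x. ennreal \<bar>g x\<bar> \<partial>upper_variation M U) + (\<integral>\<^sup>+x. ennreal \<bar>g x\<bar> \<partial>lower_variation M U)"
    by (simp add: ennreal_plus add_mono le)
  also have "\<dots> = (\<integral>\<^sup>+x. ennreal \<bar>g x\<bar> \<partial>tot_variation M U)"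
    unfolding tot_variation_def using g by (subst nn_integral_add_measure) (auto cong: measurable_cong_sets)
  finally show ?thesis .
qed

lemma offdiag_sets [measurable]: "offdiag \<in> sets (borel :: (real \<times> real) measure)"
proof -
  have "closed {p :: real \<times> real. fst p = snd p}" by (intro closed_Collect_eq continuous_intros)
  moreover have "offdiag = - {p. fst p = snd p}" unfolding offdiag_def by auto
  ultimately show ?thesis by (metis borel_comp borel_closed)
qed

lemma space_offdiag_borel [simp]: "space offdiag_borel = offdiag"
  unfolding offdiag_borel_def by (simp add: space_restrict_space)

lemma borel_probD: "f \<in> borel_prob \<Longrightarrow> sets f = sets borel" "f \<in> borel_prob \<Longrightarrow> prob_space f"
  unfolding borel_prob_def by auto

lemma sets_prod_borel_prob:
  "f \<in> borel_prob \<Longrightarrow> sets (f \<Otimes>\<^sub>M f) = sets (borel :: (real \<times> real) measure)"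
  by (metis borel_probD(1) borel_prod sets_pair_measure_cong)

lemma sets_tensor: "f \<in> borel_prob \<Longrightarrow> sets (tensor f) = sets offdiag_borel"
  unfolding tensor_def offdiag_borel_def by (simp add: sets_restrict_space sets_prod_borel_prob)

lemma prob_space_prod: "f \<in> borel_prob \<Longrightarrow> prob_space (f \<Otimes>\<^sub>M f)"
proof -
  assume f: "f \<in> borel_prob"
  interpret prob_space f using f by (rule borel_probD)
  interpret pair_prob_space f f ..
  show ?thesis by (rule prob_space_axioms)
qed

lemma finite_measure_tensor: "f \<in> borel_prob \<Longrightarrow> finite_measure (tensor f)"
proof -
  assume f: "f \<in> borel_prob"
  interpret prob_space "f \<Otimes>\<^sub>M f" using f by (rule prob_space_prod)
  show ?thesis unfolding tensor_def
    by (rule finite_measure_restrict_space[OF finite_measure_axioms]) (simp add: sets_prod_borel_prob f)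
qed

lemma action_density_eq: "s > 0 \<Longrightarrow> action_density s u = ennreal (u\<^sup>2 / s)"
  by (simp add: action_density_def)

text \<open>
  Cauchy--Schwarz: on the set where the product measure has positive density, the flux density is
  the product of the square roots of the action density and of the density; elsewhere finite
  action forces the flux to vanish. The Hahn set ensures that the difference of the variations
  carries the whole total variation. Positivity of the bound covers the case of infinite action.
\<close>

lemma flux_bound_by_action:
  assumes e: "e < 1" and f: "f \<in> borel_prob" and U: "signed_measure offdiag_borel U"
    and g: "g \<in> borel_measurable offdiag_borel" and C: "C > 0"
    and gC: "(\<integral>\<^sup>+p. ennreal (sigma_e e \<bar>fst p - snd p\<bar> * (g p)\<^sup>2) \<partial>tensor f) \<le> ennreal C"
  shows "(\<integral>\<^sup>+p. ennreal \<bar>sigma_e e \<bar>fst p - snd p\<bar> * g p\<bar> \<partial>tot_variation offdiag_borel U)\<^sup>2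
           \<le> action e f U * ennreal C"
proof (cases "action e f U = \<infinity>")
  case True
  then show ?thesis using C by (simp add: ennreal_top_mult)
next
  case False
  let ?M = offdiag_borel
  let ?P = "upper_variation ?M U" and ?N = "lower_variation ?M U" and ?T = "tensor f"
  define L where "L = add_measure ?T (tot_variation ?M U)"
  let ?s = "\<lambda>p::real\<times>real. sigma_e e \<bar>fst p - snd p\<bar>"
  interpret P: finite_measure ?P by (rule finite_measure_upper_variation[OF U])
  interpret N: finite_measure ?N by (rule finite_measure_lower_variation[OF U])
  interpret T: finite_measure ?T by (rule finite_measure_tensor[OF f])
  have sT: "sets ?T = sets ?M" by (rule sets_tensor[OF f])
  have sL[measurable_cong]: "sets L = sets ?M" unfolding L_def by (simp add: sT)
  have spL: "space L = offdiag" using sL by (metis sets_eq_imp_space_eq space_offdiag_borel)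
  have eL: "emeasure L A = emeasure ?T A + (emeasure ?P A + emeasure ?N A)" if "A \<in> sets ?M" for A
    using that sT unfolding L_def tot_variation_def by (simp add: emeasure_add_measure)
  interpret L: finite_measure L
  proof (rule finite_measureI)
    have "emeasure ?T offdiag < \<infinity>" "emeasure ?P offdiag < \<infinity>" "emeasure ?N offdiag < \<infinity>"
      using T.emeasure_finite P.emeasure_finite N.emeasure_finite by (auto simp: less_top[symmetric])
    then show "emeasure L (space L) \<noteq> \<infinity>"
      unfolding spL using eL[of offdiag] sets.top[of ?M] by simp
  qed
  have ac: "absolutely_continuous L ?T" "absolutely_continuous L ?P" "absolutely_continuous L ?N"
    unfolding absolutely_continuous_def null_sets_def using sL sT eL by auto
  let ?p = "RN_deriv L ?T" and ?a = "RN_deriv L ?P" and ?b = "RN_deriv L ?N"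
  have dT: "density L ?p = ?T" and dP: "density L ?a = ?P" and dN: "density L ?b = ?N"
    using L.density_RN_deriv ac sL sT by auto
  have fp: "AE x in L. ?p x \<noteq> \<infinity>" and fa: "AE x in L. ?a x \<noteq> \<infinity>" and fb: "AE x in L. ?b x \<noteq> \<infinity>"
    using L.RN_deriv_finite[OF T.sigma_finite_measure_axioms ac(1)]
      L.RN_deriv_finite[OF P.sigma_finite_measure_axioms ac(2)]
      L.RN_deriv_finite[OF N.sigma_finite_measure_axioms ac(3)] sL sT by auto
  obtain Y where Y: "Y \<in> sets ?M" "emeasure ?N Y = 0" "emeasure ?P (space ?M - Y) = 0"
    using signed_Hahn_set[OF U] .
  have Yb: "AE x in L. x \<in> Y \<longrightarrow> ?b x = 0"
  proof -
    have "(\<integral>\<^sup>+x. ?b x * indicator Y x \<partial>L) = 0"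
      using Y(1,2) dN emeasure_density[of ?b L Y] sL by simp
    then have "AE x in L. ?b x * indicator Y x = 0"
      using Y(1) sL by (subst (asm) nn_integral_0_iff_AE) auto
    then show ?thesis by eventually_elim (auto simp: indicator_def)
  qed
  have Ya: "AE x in L. x \<notin> Y \<longrightarrow> ?a x = 0"
  proof -
    have m: "offdiag - Y \<in> sets L" using Y(1) sL sets.top[of ?M] by auto
    have "(\<integral>\<^sup>+x. ?a x * indicator (offdiag - Y) x \<partial>L) = 0"
      using Y(3) dP emeasure_density[of ?a L "offdiag - Y"] m by simp
    then have "AE x in L. ?a x * indicator (offdiag - Y) x = 0"
      using m by (subst (asm) nn_integral_0_iff_AE) auto
    then show ?thesis using AE_space by eventually_elim (auto simp: indicator_def spL)
  qed
  define u where "u x = signed_RN_deriv L ?M U x" for x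
  define p where "p x = enn2real (?p x)" for x
  have u_meas[measurable]: "u \<in> borel_measurable L" unfolding u_def signed_RN_deriv_def by measurable
  have p_meas[measurable]: "p \<in> borel_measurable L" unfolding p_def by measurable
  have g_meas[measurable]: "g \<in> borel_measurable L" using g by (simp cong: measurable_cong_sets add: sL)
  have s_meas: "?s \<in> borel_measurable offdiag_borel"
    unfolding offdiag_borel_def sigma_e_def
    by (intro measurable_restrict_space1 borel_measurable_continuous_onI continuous_intros)
  then have s_meas'[measurable]: "?s \<in> borel_measurable L" by (simp cong: measurable_cong_sets add: sL)
  have sg_meas: "(\<lambda>p. ?s p * g p) \<in> borel_measurable L" by measurable
  have abs_u: "AE x in L. ?a x + ?b x = ennreal \<bar>u x\<bar>"
    using fa fb Ya Yb
  proof eventually_elim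
    case (elim x)
    have "?a x = ennreal (enn2real (?a x))" "?b x = ennreal (enn2real (?b x))"
      using elim(1,2) by (simp_all add: ennreal_enn2real less_top[symmetric])
    then show ?case
      using elim(3,4) by (cases "x \<in> Y") (simp_all add: u_def signed_RN_deriv_def)
  qed
  have s_pos: "?s x > 0" if "x \<in> offdiag" for x
    using that e by (auto simp: offdiag_def sigma_e_def intro!: mult_pos_pos)
  have act: "action e f U = (\<integral>\<^sup>+x. action_density (p x) (u x) * ennreal (?s x) \<partial>L)"
    unfolding action_def Let_def L_def p_def u_def ..
  have ad_meas: "(\<lambda>x. action_density (p x) (u x)) \<in> borel_measurable L"
    unfolding action_density_def by measurable
  have "AE x in L. action_density (p x) (u x) * ennreal (?s x) \<noteq> \<infinity>"
    by (rule nn_integral_PInf_AE) (use False ad_meas in \<open>auto simp: act infinity_ennreal_def\<close>)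
  then have p0: "AE x in L. p x = 0 \<longrightarrow> u x = 0"
    using AE_space
  proof eventually_elim
    case (elim x)
    then show ?case using s_pos[of x]
      by (auto simp: action_density_def spL ennreal_top_mult split: if_splits)
  qed
  let ?F = "\<lambda>x. if p x = 0 then 0 else \<bar>u x\<bar> / sqrt (p x) * sqrt (?s x)"
  let ?G = "\<lambda>x. sqrt (p x) * sqrt (?s x) * \<bar>g x\<bar>"
  have p_nonneg: "p x \<ge> 0" for x unfolding p_def by simp
  have "(\<integral>\<^sup>+x. ennreal \<bar>?s x * g x\<bar> \<partial>tot_variation ?M U)
      = (\<integral>\<^sup>+x. ennreal \<bar>?s x * g x\<bar> \<partial>?P) + (\<integral>\<^sup>+x. ennreal \<bar>?s x * g x\<bar> \<partial>?N)"
    unfolding tot_variation_def using g s_meas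
    by (subst nn_integral_add_measure) (auto cong: measurable_cong_sets)
  also have "\<dots> = (\<integral>\<^sup>+x. ?a x * ennreal \<bar>?s x * g x\<bar> \<partial>L) + (\<integral>\<^sup>+x. ?b x * ennreal \<bar>?s x * g x\<bar> \<partial>L)"
  proof -
    have "(\<integral>\<^sup>+x. ennreal \<bar>?s x * g x\<bar> \<partial>density L ?a) = (\<integral>\<^sup>+x. ?a x * ennreal \<bar>?s x * g x\<bar> \<partial>L)"
      "(\<integral>\<^sup>+x. ennreal \<bar>?s x * g x\<bar> \<partial>density L ?b) = (\<integral>\<^sup>+x. ?b x * ennreal \<bar>?s x * g x\<bar> \<partial>L)"
      using sg_meas by (auto intro!: nn_integral_density)
    then show ?thesis by (simp only: dP dN)
  qed
  also have "\<dots> = (\<integral>\<^sup>+x. (?a x + ?b x) * ennreal \<bar>?s x * g x\<bar> \<partial>L)"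
    using sg_meas by (subst nn_integral_add[symmetric]) (auto simp: distrib_right)
  also have "\<dots> = (\<integral>\<^sup>+x. ennreal (?F x) * ennreal (?G x) \<partial>L)"
  proof (rule nn_integral_cong_AE, use abs_u p0 AE_space in eventually_elim)
    case (elim x)
    have "?s x > 0" using s_pos elim(3) spL by auto
    then have "\<bar>u x\<bar> * \<bar>?s x * g x\<bar> = ?F x * ?G x"
    proof (cases "p x = 0")
      case True then show ?thesis using elim(2) by simp
    next
      case False
      have gen: "a / r * s * (r * s * b) = a * (s * s) * b" if "r \<noteq> 0" for a r s b :: real
        using that by simp
      have "sqrt (?s x) * sqrt (?s x) = ?s x" using \<open>?s x > 0\<close> by simp
      moreover have "\<bar>?s x * g x\<bar> = ?s x * \<bar>g x\<bar>" using \<open>?s x > 0\<close> by (simp add: abs_mult)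
      moreover have "sqrt (p x) \<noteq> 0" using False by simp
      ultimately show ?thesis
        using gen[OF \<open>sqrt (p x) \<noteq> 0\<close>, of "\<bar>u x\<bar>" "sqrt (?s x)" "\<bar>g x\<bar>"] False by (simp only: if_False mult.assoc)
    qed
    moreover have "?F x \<ge> 0" "?G x \<ge> 0" using p_nonneg[of x] \<open>?s x > 0\<close> by auto
    ultimately show ?case
      unfolding elim(1) by (metis abs_ge_zero ennreal_mult)
  qed
  finally have "(\<integral>\<^sup>+x. ennreal \<bar>?s x * g x\<bar> \<partial>tot_variation ?M U)\<^sup>2
     = (\<integral>\<^sup>+x. ennreal (?F x) * ennreal (?G x) \<partial>L)\<^sup>2" by simp
  also have "\<dots> \<le> (\<integral>\<^sup>+x. (ennreal (?F x))\<^sup>2 \<partial>L) * (\<integral>\<^sup>+x. (ennreal (?G x))\<^sup>2 \<partial>L)"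
    by (rule Cauchy_Schwarz_nn_integral) measurable
  also have "\<dots> \<le> action e f U * ennreal C"
  proof (rule mult_mono)
    show "(\<integral>\<^sup>+x. (ennreal (?F x))\<^sup>2 \<partial>L) \<le> action e f U"
      unfolding act
    proof (rule nn_integral_mono)
      fix x assume "x \<in> space L"
      then have sx: "?s x > 0" using s_pos spL by auto
      show "(ennreal (?F x))\<^sup>2 \<le> action_density (p x) (u x) * ennreal (?s x)"
      proof (cases "p x = 0")
        case True then show ?thesis by simp
      next
        case False
        then have "p x > 0" using p_nonneg[of x] by simp
        then show ?thesis using sx
          unfolding action_density_eq[OF \<open>p x > 0\<close>]
          by (subst ennreal_mult''[symmetric]) (auto simp: ennreal_power power_mult_distrib power_divide)
      qed
    qed
    have "(\<integral>\<^sup>+x. (ennreal (?G x))\<^sup>2 \<partial>L) = (\<integral>\<^sup>+x. ?p x * ennreal (?s x * (g x)\<^sup>2) \<partial>L)"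
    proof (rule nn_integral_cong_AE, use fp AE_space in eventually_elim)
      case (elim x)
      have sx: "?s x > 0" using s_pos elim(2) spL by auto
      have "?p x = ennreal (p x)" unfolding p_def using elim(1) by (simp add: ennreal_enn2real less_top[symmetric])
      then show ?case using sx p_nonneg[of x]
        by (simp add: ennreal_power ennreal_mult[symmetric] power_mult_distrib)
    qed
    also have "\<dots> = (\<integral>\<^sup>+x. ennreal (?s x * (g x)\<^sup>2) \<partial>?T)"
    proof -
      have "(\<integral>\<^sup>+x. ?p x * ennreal (?s x * (g x)\<^sup>2) \<partial>L) = (\<integral>\<^sup>+x. ennreal (?s x * (g x)\<^sup>2) \<partial>density L ?p)"
        by (rule nn_integral_density[symmetric]) measurable
      then show ?thesis by (simp only: dT)
    qed
    finally show "(\<integral>\<^sup>+x. (ennreal (?G x))\<^sup>2 \<partial>L) \<le> ennreal C" using gC by simp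
  qed auto
  finally show ?thesis .
qed

section \<open>Fluxes with a density\<close>

definition density_flux :: "(real \<times> real) measure \<Rightarrow> (real \<times> real \<Rightarrow> real) \<Rightarrow> (real \<times> real) set \<Rightarrow> real" where
  "density_flux \<tau> u A = (\<integral>p. indicator A p * u p \<partial>\<tau>)"

text \<open>
  Truncation by ennreal turns the density of a signed measure into its positive or negative part, so
  the variations of such a measure are again given by densities.
\<close>

lemma density_flux_eq_measure_diff:
  assumes u: "integrable \<tau> u" and A: "A \<in> sets \<tau>"
  shows "density_flux \<tau> u A
     = measure (density \<tau> (\<lambda>x. ennreal (u x))) A - measure (density \<tau> (\<lambda>x. ennreal (- u x))) A"
proof -
  have [measurable]: "u \<in> borel_measurable \<tau>" using u by auto
  have m: "measure (density \<tau> (\<lambda>x. ennreal (v x))) A = (\<integral>x. indicator A x * max 0 (v x) \<partial>\<tau>)"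
    if v: "integrable \<tau> v" for v
  proof -
    have [measurable]: "v \<in> borel_measurable \<tau>" using v by auto
    have i: "integrable \<tau> (\<lambda>x. indicator A x * max 0 (v x))"
      using A v by (intro integrable_mult_indicator[where 'b=real, simplified]) auto
    have "emeasure (density \<tau> (\<lambda>x. ennreal (v x))) A = (\<integral>\<^sup>+x. ennreal (indicator A x * max 0 (v x)) \<partial>\<tau>)"
      using A by (subst emeasure_density) (auto intro!: nn_integral_cong simp: indicator_def max_def ennreal_neg)
    also have "\<dots> = ennreal (\<integral>x. indicator A x * max 0 (v x) \<partial>\<tau>)"
      by (rule nn_integral_eq_integral[OF i]) auto
    finally show ?thesis by (simp add: measure_def)
  qed
  have i: "integrable \<tau> (\<lambda>x. indicator A x * max 0 (u x))" "integrable \<tau> (\<lambda>x. indicator A x * max 0 (- u x))"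
    using A u by (auto intro!: integrable_mult_indicator[where 'b=real, simplified])
  show ?thesis
    unfolding density_flux_def m[OF u] m[OF integrable_minus[OF u]]
    by (subst Bochner_Integration.integral_diff[OF i, symmetric])
      (auto intro!: Bochner_Integration.integral_cong simp: max_def)
qed

lemma finite_measure_density_real:
  assumes "integrable \<tau> u" shows "finite_measure (density \<tau> (\<lambda>x. ennreal (u x)))"
proof (rule finite_measureI)
  have "(\<integral>\<^sup>+x. ennreal (u x) \<partial>\<tau>) \<le> (\<integral>\<^sup>+x. ennreal (norm (u x)) \<partial>\<tau>)"
    by (intro nn_integral_mono ennreal_leI) auto
  also have "\<dots> < \<infinity>" using assms by (simp add: integrable_iff_bounded)
  finally show "emeasure (density \<tau> (\<lambda>x. ennreal (u x))) (space (density \<tau> (\<lambda>x. ennreal (u x)))) \<noteq> \<infinity>"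
    using assms by (subst emeasure_density) (auto cong: nn_integral_cong_simp)
qed

lemma signed_measure_density_flux:
  assumes u: "integrable \<tau> u" and S: "sets \<tau> = sets M"
  shows "signed_measure M (density_flux \<tau> u)"
  unfolding signed_measure_def
proof (intro conjI allI impI)
  show "density_flux \<tau> u {} = 0" by (simp add: density_flux_def)
  fix A :: "nat \<Rightarrow> _" assume A: "range A \<subseteq> sets M" "disjoint_family A"
  interpret P: finite_measure "density \<tau> (\<lambda>x. ennreal (u x))"
    by (rule finite_measure_density_real[OF u])
  interpret N: finite_measure "density \<tau> (\<lambda>x. ennreal (- u x))"
    by (rule finite_measure_density_real) (use u in auto)
  have A': "A i \<in> sets \<tau>" "(\<Union>i. A i) \<in> sets \<tau>" for i using A S by auto
  show "(\<lambda>i. density_flux \<tau> u (A i)) sums density_flux \<tau> u (\<Union> (range A))"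
    unfolding density_flux_eq_measure_diff[OF u A'(1)] density_flux_eq_measure_diff[OF u A'(2)]
    using A A' by (intro sums_diff P.finite_measure_UNION N.finite_measure_UNION) auto
qed

lemma upper_variation_density_flux:
  assumes u: "integrable \<tau> u" and S: "sets \<tau> = sets M"
  shows "upper_variation M (density_flux \<tau> u) = density \<tau> (\<lambda>x. ennreal (u x))"
proof (rule measure_eqI)
  show "sets (upper_variation M (density_flux \<tau> u)) = sets (density \<tau> (\<lambda>x. ennreal (u x)))" using S by simp
  fix A assume "A \<in> sets (upper_variation M (density_flux \<tau> u))"
  then have A: "A \<in> sets M" "A \<in> sets \<tau>" using S by auto
  have [measurable]: "u \<in> borel_measurable \<tau>" using u by auto
  let ?P = "density \<tau> (\<lambda>x. ennreal (u x))"
  interpret P: finite_measure ?P by (rule finite_measure_density_real[OF u])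
  have "sup_below M (density_flux \<tau> u) A = emeasure ?P A"
  proof (rule antisym)
    show "sup_below M (density_flux \<tau> u) A \<le> emeasure ?P A"
      unfolding sup_below_def
    proof (rule SUP_least, clarsimp)
      fix B assume B: "B \<in> sets M" "B \<subseteq> A"
      then have "ennreal (density_flux \<tau> u B) \<le> ennreal (measure ?P B)"
        using S by (intro ennreal_leI) (auto simp: density_flux_eq_measure_diff[OF u])
      also have "\<dots> = emeasure ?P B" by (simp add: P.emeasure_eq_measure)
      also have "\<dots> \<le> emeasure ?P A" using B A by (intro emeasure_mono) auto
      finally show "ennreal (density_flux \<tau> u B) \<le> emeasure ?P A" .
    qed
    let ?B = "A \<inter> {x \<in> space \<tau>. u x > 0}"
    have B: "?B \<in> sets \<tau>" using A by auto
    have 1: "emeasure ?P ?B = emeasure ?P A"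
      using A B sets.sets_into_space[OF A(2)]
      by (subst (1 2) emeasure_density) (auto intro!: nn_integral_cong simp: indicator_def ennreal_neg)
    have 2: "emeasure (density \<tau> (\<lambda>x. ennreal (- u x))) ?B = 0"
    proof -
      have "ennreal (- u x) * indicator ?B x = 0" for x
        by (cases "u x > 0") (auto simp: ennreal_neg)
      then have "emeasure (density \<tau> (\<lambda>x. ennreal (- u x))) ?B = (\<integral>\<^sup>+x. 0 \<partial>\<tau>)"
        using B by (subst emeasure_density) (simp_all del: mult_eq_0_iff)
      then show ?thesis by simp
    qed
    have "emeasure ?P A = ennreal (density_flux \<tau> u ?B)"
      using 2 by (simp add: density_flux_eq_measure_diff[OF u B] measure_def 1[symmetric])
        (simp add: P.emeasure_eq_measure measure_def[symmetric])
    also have "\<dots> \<le> sup_below M (density_flux \<tau> u) A"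
      using B S by (intro sup_below_upper) auto
    finally show "emeasure ?P A \<le> sup_below M (density_flux \<tau> u) A" .
  qed
  then show "emeasure (upper_variation M (density_flux \<tau> u)) A = emeasure ?P A"
    using A by (simp add: emeasure_upper_variation[OF signed_measure_density_flux[OF u S]])
qed

lemma lower_variation_density_flux:
  assumes u: "integrable \<tau> u" and S: "sets \<tau> = sets M"
  shows "lower_variation M (density_flux \<tau> u) = density \<tau> (\<lambda>x. ennreal (- u x))"
proof -
  have "(\<lambda>A. - density_flux \<tau> u A) = density_flux \<tau> (\<lambda>x. - u x)"
    by (auto simp: density_flux_def)
  then show ?thesis
    unfolding lower_variation_def using upper_variation_density_flux[OF integrable_minus[OF u] S] by simp
qed

lemma tot_variation_density_flux:
  assumes u: "integrable \<tau> u" and S: "sets \<tau> = sets M"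
  shows "tot_variation M (density_flux \<tau> u) = density \<tau> (\<lambda>x. ennreal \<bar>u x\<bar>)"
proof (rule measure_eqI)
  have [measurable]: "u \<in> borel_measurable \<tau>" using u by auto
  show "sets (tot_variation M (density_flux \<tau> u)) = sets (density \<tau> (\<lambda>x. ennreal \<bar>u x\<bar>))" using S by simp
  fix A assume "A \<in> sets (tot_variation M (density_flux \<tau> u))"
  then have A: "A \<in> sets \<tau>" using S by auto
  have "emeasure (tot_variation M (density_flux \<tau> u)) A
     = (\<integral>\<^sup>+x. ennreal (u x) * indicator A x \<partial>\<tau>) + (\<integral>\<^sup>+x. ennreal (- u x) * indicator A x \<partial>\<tau>)"
    using A S unfolding tot_variation_def
    by (simp add: emeasure_add_measure upper_variation_density_flux[OF u S] lower_variation_density_flux[OF u S] emeasure_density)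
  also have "\<dots> = (\<integral>\<^sup>+x. ennreal \<bar>u x\<bar> * indicator A x \<partial>\<tau>)"
    using A by (subst nn_integral_add[symmetric])
      (auto intro!: nn_integral_cong simp: indicator_def abs_if ennreal_neg)
  finally show "emeasure (tot_variation M (density_flux \<tau> u)) A = emeasure (density \<tau> (\<lambda>x. ennreal \<bar>u x\<bar>)) A"
    using A by (simp add: emeasure_density)
qed

lemma signed_integral_density_flux:
  assumes u: "integrable \<tau> u" and S: "sets \<tau> = sets M" and g: "g \<in> borel_measurable \<tau>"
    and ug: "integrable \<tau> (\<lambda>x. u x * g x)"
  shows "signed_integral M (density_flux \<tau> u) g = (\<integral>x. u x * g x \<partial>\<tau>)"
proof -
  have [measurable]: "u \<in> borel_measurable \<tau>" using u by auto
  have max: "(\<lambda>x. ennreal (v x)) = (\<lambda>x. ennreal (max 0 (v x)))" for v :: "_ \<Rightarrow> real"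
    by (auto simp: max_def ennreal_neg)
  have e: "(\<integral>x. g x \<partial>density \<tau> (\<lambda>x. ennreal (v x))) = (\<integral>x. max 0 (v x) * g x \<partial>\<tau>)"
    if [measurable]: "v \<in> borel_measurable \<tau>" for v
    unfolding max[of v] using g by (subst integral_density) auto
  have i: "integrable \<tau> (\<lambda>x. max 0 (u x) * g x)" "integrable \<tau> (\<lambda>x. max 0 (- u x) * g x)"
    using g by (auto intro!: Bochner_Integration.integrable_bound[OF ug] AE_I2 mult_right_mono simp: abs_mult)
  show ?thesis
    unfolding signed_integral_def upper_variation_density_flux[OF u S] lower_variation_density_flux[OF u S]
  proof (subst (1 2) e)
    have "(\<integral>x. max 0 (u x) * g x \<partial>\<tau>) - (\<integral>x. max 0 (- u x) * g x \<partial>\<tau>)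
      = (\<integral>x. max 0 (u x) * g x - max 0 (- u x) * g x \<partial>\<tau>)"
      by (rule Bochner_Integration.integral_diff[OF i, symmetric])
    also have "\<dots> = (\<integral>x. u x * g x \<partial>\<tau>)"
      by (intro Bochner_Integration.integral_cong) (auto simp: max_def)
    finally show "(\<integral>x. max 0 (u x) * g x \<partial>\<tau>) - (\<integral>x. max 0 (- u x) * g x \<partial>\<tau>) = (\<integral>x. u x * g x \<partial>\<tau>)" .
  qed auto
qed

text \<open>
  All measures involved have densities with respect to the product measure, the reference measure of
  the action has density \<open>1 + \<bar>u\<bar>\<close>, and the action density is homogeneous of
  degree one, so the weight \<open>1 + \<bar>u\<bar>\<close> cancels.
\<close>

lemma action_density_flux:
  assumes e: "e < 1" and f: "f \<in> borel_prob" and u: "integrable (tensor f) u"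
  shows "action e f (density_flux (tensor f) u)
     = (\<integral>\<^sup>+p. ennreal (sigma_e e \<bar>fst p - snd p\<bar> * (u p)\<^sup>2) \<partial>tensor f)"
proof -
  let ?T = "tensor f" and ?M = offdiag_borel
  let ?U = "density_flux ?T u"
  let ?s = "\<lambda>p::real\<times>real. sigma_e e \<bar>fst p - snd p\<bar>"
  interpret T: finite_measure ?T by (rule finite_measure_tensor[OF f])
  have sT: "sets ?T = sets ?M" by (rule sets_tensor[OF f])
  have [measurable]: "u \<in> borel_measurable ?T" using u by auto
  have s_meas: "?s \<in> borel_measurable offdiag_borel"
    unfolding offdiag_borel_def sigma_e_def
    by (intro measurable_restrict_space1 borel_measurable_continuous_onI continuous_intros)
  then have s_meas'[measurable]: "?s \<in> borel_measurable ?T" by (simp cong: measurable_cong_sets add: sT)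
  define d where "d x = ennreal (1 + \<bar>u x\<bar>)" for x
  have [measurable]: "d \<in> borel_measurable ?T" unfolding d_def by measurable
  define L where "L = add_measure ?T (tot_variation ?M ?U)"
  have L: "L = density ?T d"
  proof (rule measure_eqI)
    show "sets L = sets (density ?T d)" unfolding L_def by simp
    fix A assume "A \<in> sets L"
    then have A: "A \<in> sets ?T" unfolding L_def by simp
    have "emeasure L A = emeasure ?T A + (\<integral>\<^sup>+x. ennreal \<bar>u x\<bar> * indicator A x \<partial>?T)"
      unfolding L_def tot_variation_density_flux[OF u sT] using A by (simp add: emeasure_add_measure emeasure_density)
    also have "\<dots> = (\<integral>\<^sup>+x. d x * indicator A x \<partial>?T)"
      using A unfolding d_def
      by (simp add: ennreal_plus distrib_right nn_integral_add del: nn_integral_indicator flip: nn_integral_indicator)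
    finally show "emeasure L A = emeasure (density ?T d) A" using A by (simp add: emeasure_density)
  qed
  interpret L: finite_measure L
    unfolding L d_def by (rule finite_measure_density_real) (use u in \<open>auto intro!: T.integrable_const\<close>)
  have sL[measurable_cong]: "sets L = sets ?T" unfolding L by simp
  have AE_L: "(AE x in L. P x) \<longleftrightarrow> (AE x in ?T. P x)" for P
    unfolding L by (subst AE_density) (auto simp: d_def)
  have RN: "AE x in L. RN_deriv L (density ?T (\<lambda>x. ennreal (w x))) x = ennreal (w x / (1 + \<bar>u x\<bar>))"
    if [measurable]: "w \<in> borel_measurable ?T" for w
  proof -
    have "d x * ennreal (w x / (1 + \<bar>u x\<bar>)) = ennreal (w x)" for x
    proof -
      have "1 + \<bar>u x\<bar> \<noteq> 0" by linarith
      then show ?thesis unfolding d_def by (subst ennreal_mult'[symmetric]) auto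
    qed
    then have "density L (\<lambda>x. ennreal (w x / (1 + \<bar>u x\<bar>))) = density ?T (\<lambda>x. ennreal (w x))"
      unfolding L by (subst density_density_eq) auto
    then have "AE x in L. ennreal (w x / (1 + \<bar>u x\<bar>)) = RN_deriv L (density ?T (\<lambda>x. ennreal (w x))) x"
      by (intro L.RN_deriv_unique) (auto simp: L)
    then show ?thesis by eventually_elim simp
  qed
  have one: "density ?T (\<lambda>x. ennreal 1) = ?T" using density_1[of ?T] by simp
  have RN1: "AE x in L. RN_deriv L ?T x = ennreal (1 / (1 + \<bar>u x\<bar>))"
    using RN[of "\<lambda>_. 1", unfolded one] by simp
  have RNu: "AE x in L. RN_deriv L (density ?T (\<lambda>x. ennreal (u x))) x = ennreal (u x / (1 + \<bar>u x\<bar>))"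
    and RNm: "AE x in L. RN_deriv L (density ?T (\<lambda>x. ennreal (- u x))) x = ennreal (- u x / (1 + \<bar>u x\<bar>))"
    by (rule RN; measurable)+
  have "action e f ?U = (\<integral>\<^sup>+x. action_density (enn2real (RN_deriv L ?T x)) (signed_RN_deriv L ?M ?U x) * ennreal (?s x) \<partial>L)"
    unfolding action_def Let_def L_def ..
  also have "\<dots> = (\<integral>\<^sup>+x. ennreal ((u x)\<^sup>2 / (1 + \<bar>u x\<bar>)) * ennreal (?s x) \<partial>L)"
  proof (rule nn_integral_cong_AE, use RN1 RNu RNm in eventually_elim)
    case (elim x)
    have "signed_RN_deriv L ?M ?U x = u x / (1 + \<bar>u x\<bar>)"
      unfolding signed_RN_deriv_def upper_variation_density_flux[OF u sT] lower_variation_density_flux[OF u sT]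
      using elim by (cases "u x \<ge> 0") (auto simp: ennreal_neg divide_nonpos_pos)
    moreover have "enn2real (RN_deriv L ?T x) = 1 / (1 + \<bar>u x\<bar>)" using elim by simp
    moreover have "(u x / (1 + \<bar>u x\<bar>))\<^sup>2 / (1 / (1 + \<bar>u x\<bar>)) = (u x)\<^sup>2 / (1 + \<bar>u x\<bar>)"
    proof -
      have "1 + \<bar>u x\<bar> > 0" by linarith
      then show ?thesis by (simp add: power2_eq_square divide_simps)
    qed
    moreover have "1 / (1 + \<bar>u x\<bar>) > 0" by (simp add: add_pos_nonneg)
    ultimately show ?case by (simp add: action_density_eq)
  qed
  also have "\<dots> = (\<integral>\<^sup>+x. d x * (ennreal ((u x)\<^sup>2 / (1 + \<bar>u x\<bar>)) * ennreal (?s x)) \<partial>?T)"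
    unfolding L by (subst nn_integral_density) auto
  also have "\<dots> = (\<integral>\<^sup>+p. ennreal (?s p * (u p)\<^sup>2) \<partial>?T)"
  proof (rule nn_integral_cong)
    fix x
    have "?s x \<ge> 0" using e by (auto simp: sigma_e_def)
    moreover have eq: "(1 + \<bar>u x\<bar>) * ((u x)\<^sup>2 / (1 + \<bar>u x\<bar>)) = (u x)\<^sup>2"
    proof -
      have "1 + \<bar>u x\<bar> \<noteq> 0" by linarith
      then show ?thesis by simp
    qed
    ultimately have "d x * (ennreal ((u x)\<^sup>2 / (1 + \<bar>u x\<bar>)) * ennreal (?s x))
        = ennreal ((1 + \<bar>u x\<bar>) * ((u x)\<^sup>2 / (1 + \<bar>u x\<bar>) * ?s x))"
      unfolding d_def by (subst ennreal_mult'[symmetric], simp, subst ennreal_mult'[symmetric], simp_all add: mult.commute del: ennreal_plus)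
    also have "(1 + \<bar>u x\<bar>) * ((u x)\<^sup>2 / (1 + \<bar>u x\<bar>) * ?s x) = ?s x * (u x)\<^sup>2"
      unfolding mult.assoc[symmetric] eq by (rule mult.commute)
    finally show "d x * (ennreal ((u x)\<^sup>2 / (1 + \<bar>u x\<bar>)) * ennreal (?s x)) = ennreal (?s x * (u x)\<^sup>2)" .
  qed
  finally show ?thesis .
qed

section \<open>Increments of test integrals along solutions\<close>

definition C1c :: "(real \<Rightarrow> real) \<Rightarrow> bool" where
  "C1c \<psi> \<longleftrightarrow> (\<forall>v. \<psi> differentiable (at v)) \<and> continuous_on UNIV (deriv \<psi>) \<and>
     (\<exists>L. \<forall>v. L < \<bar>v\<bar> \<longrightarrow> \<psi> v = 0)"

lemma C1cI:
  assumes "\<And>v. (\<psi> has_real_derivative \<psi>' v) (at v)" "continuous_on UNIV \<psi>'" "\<And>v. L < \<bar>v\<bar> \<Longrightarrow> \<psi> v = 0"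
  shows "C1c \<psi>" "deriv \<psi> = \<psi>'"
proof -
  show *: "deriv \<psi> = \<psi>'" using assms(1) by (auto intro: DERIV_imp_deriv)
  show "C1c \<psi>" unfolding C1c_def * using assms
    by (auto simp: real_differentiable_def)
qed

lemma deriv_eq_0_outside:
  assumes "\<And>v::real. L < \<bar>v\<bar> \<Longrightarrow> \<psi> v = (0::real)" "L < \<bar>v\<bar>"
  shows "deriv \<psi> v = 0"
proof (rule DERIV_imp_deriv)
  have "open {v::real. L < \<bar>v\<bar>}" by (intro open_Collect_less continuous_intros)
  then show "(\<psi> has_real_derivative 0) (at v)"
    by (rule has_field_derivative_transform_within_open[of "\<lambda>_. 0", OF DERIV_const]) (use assms in auto)
qed

text \<open>A quadratic spline that climbs from 0 to 1 on the unit interval; its derivative is a tent.\<close>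

definition ramp :: "real \<Rightarrow> real" where
  "ramp x = 2 * (max 0 x)\<^sup>2 - 4 * (max 0 (x - 1/2))\<^sup>2 + 2 * (max 0 (x - 1))\<^sup>2"

definition ramp' :: "real \<Rightarrow> real" where
  "ramp' x = 4 * max 0 x - 8 * max 0 (x - 1/2) + 4 * max 0 (x - 1)"

lemma DERIV_square_pos_part:
  "((\<lambda>x::real. (max 0 (x - a))\<^sup>2) has_real_derivative 2 * max 0 (x - a)) (at x)"
proof (cases "x = a")
  case True
  have "((\<lambda>h. (max 0 h)\<^sup>2 / h) \<longlongrightarrow> 0) (at (0::real))"
  proof (rule Lim_null_comparison)
    show "\<forall>\<^sub>F h in at (0::real). norm ((max 0 h)\<^sup>2 / h) \<le> \<bar>h\<bar>"
      by (intro always_eventually allI) (auto simp: max_def power2_eq_square)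
    show "((\<lambda>h::real. \<bar>h\<bar>) \<longlongrightarrow> 0) (at 0)" by (rule tendsto_rabs_zero[OF tendsto_ident_at])
  qed
  then show ?thesis unfolding DERIV_def True by simp
next
  case False
  show ?thesis
  proof (cases "x < a")
    case True
    have "((\<lambda>x. (max 0 (x - a))\<^sup>2) has_real_derivative 0) (at x)"
      by (rule has_field_derivative_transform_within_open[of "\<lambda>_. 0", OF DERIV_const, of "{..<a}"]) (use True in auto)
    then show ?thesis using True by simp
  next
    case F: False
    have "((\<lambda>x. (x - a)\<^sup>2) has_real_derivative 2 * (x - a)) (at x)"
      by (auto intro!: derivative_eq_intros)
    then have "((\<lambda>x. (max 0 (x - a))\<^sup>2) has_real_derivative 2 * (x - a)) (at x)"
      by (rule has_field_derivative_transform_within_open[of _ _ _ "{a<..}"]) (use F False in auto)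
    then show ?thesis using F False by simp
  qed
qed

lemma DERIV_ramp: "(ramp has_real_derivative ramp' x) (at x)"
proof -
  have "((\<lambda>x. 2 * (max 0 (x - 0))\<^sup>2 - 4 * (max 0 (x - 1/2))\<^sup>2 + 2 * (max 0 (x - 1))\<^sup>2) has_real_derivative
      2 * (2 * max 0 (x - 0)) - 4 * (2 * max 0 (x - 1/2)) + 2 * (2 * max 0 (x - 1))) (at x)"
    by (intro DERIV_add DERIV_diff DERIV_cmult DERIV_square_pos_part)
  then show ?thesis unfolding ramp_def[abs_def] ramp'_def by simp
qed

lemma DERIV_ramp_scaled:
  "((\<lambda>t. ramp ((t - s) / \<epsilon>)) has_real_derivative ramp' ((t - s) / \<epsilon>) / \<epsilon>) (at t)"
proof -
  have "((\<lambda>t. (t - s) / \<epsilon>) has_real_derivative 1 / \<epsilon>) (at t)"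
    by (auto intro!: derivative_eq_intros simp: divide_inverse)
  from DERIV_chain2[OF DERIV_ramp this] show ?thesis by simp
qed

lemma continuous_ramp': "continuous_on S ramp'"
  unfolding ramp'_def by (intro continuous_intros)

lemma ramp'_nonneg: "0 \<le> ramp' x"
  unfolding ramp'_def by (auto simp: max_def)

lemma ramp'_eq_0: "x \<le> 0 \<or> 1 \<le> x \<Longrightarrow> ramp' x = 0"
  unfolding ramp'_def by (auto simp: max_def)

lemma ramp_mono: "x \<le> y \<Longrightarrow> ramp x \<le> ramp y"
  by (rule DERIV_nonneg_imp_nondecreasing) (auto intro: DERIV_ramp ramp'_nonneg)

lemma ramp_le_0: "x \<le> 0 \<Longrightarrow> ramp x = 0"
  unfolding ramp_def by (auto simp: max_def)

lemma ramp_ge_1: "1 \<le> x \<Longrightarrow> ramp x = 1"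
  unfolding ramp_def by (auto simp: max_def power2_eq_square algebra_simps)

lemma ramp_bounds: "0 \<le> ramp x" "ramp x \<le> 1"
  using ramp_mono[of "min x 0" x] ramp_mono[of x "max x 1"] ramp_le_0[of "min x 0"] ramp_ge_1[of "max x 1"] by auto

lemma ramp_average:
  fixes F :: "real \<Rightarrow> real"
  assumes F: "continuous_on {0..1} F" and s: "0 \<le> s" "0 < \<epsilon>" "s + \<epsilon> \<le> 1"
    and near: "\<And>t. s \<le> t \<Longrightarrow> t \<le> s + \<epsilon> \<Longrightarrow> \<bar>F t - F s\<bar> \<le> \<delta>"
  shows "\<bar>integral {0..1} (\<lambda>t. ramp' ((t - s) / \<epsilon>) / \<epsilon> * F t) - F s\<bar> \<le> \<delta>"
proof -
  let ?r = "\<lambda>t. ramp' ((t - s) / \<epsilon>) / \<epsilon>"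
  have "((\<lambda>t. ramp ((t - s) / \<epsilon>)) has_real_derivative ?r t) (at t)" for t
    by (rule DERIV_ramp_scaled)
  then have "(?r has_integral ramp ((1 - s) / \<epsilon>) - ramp ((0 - s) / \<epsilon>)) {0..1}"
    by (intro fundamental_theorem_of_calculus)
      (auto simp flip: has_real_derivative_iff_has_vector_derivative intro: has_field_derivative_at_within)
  moreover have "ramp ((1 - s) / \<epsilon>) = 1" "ramp ((0 - s) / \<epsilon>) = 0"
    using s by (auto intro!: ramp_ge_1 ramp_le_0 simp: field_simps)
  ultimately have r: "(?r has_integral 1) {0..1}" by simp
  have cr: "continuous_on {0..1} ?r"
    using s by (intro continuous_on_divide continuous_on_diff
        continuous_on_id continuous_on_const continuous_on_compose2[OF continuous_ramp'[of UNIV]]) auto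
  define r where "r = ?r"
  have rF: "(\<lambda>t. r t * F t) integrable_on {0..1}" and rc: "(\<lambda>t. r t * c) integrable_on {0..1}" for c
    unfolding r_def by (intro integrable_continuous_interval continuous_on_mult cr F continuous_on_const)+
  have ir: "integral {0..1} (\<lambda>t. r t * c) = c" for c
    using has_integral_mult_left[OF r, of c] unfolding r_def by (intro integral_unique) simp
  have "integral {0..1} (\<lambda>t. r t * F t) - F s = integral {0..1} (\<lambda>t. r t * F t) - integral {0..1} (\<lambda>t. r t * F s)"
    by (subst ir) (rule refl)
  also have "\<dots> = integral {0..1} (\<lambda>t. r t * (F t - F s))"
    unfolding right_diff_distrib by (rule Henstock_Kurzweil_Integration.integral_diff[OF rF rc, symmetric])
  also have "\<bar>\<dots>\<bar> \<le> integral {0..1} (\<lambda>t. r t * \<delta>)"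
  proof -
    have "norm (integral {0..1} (\<lambda>t. r t * (F t - F s))) \<le> integral {0..1} (\<lambda>t. r t * \<delta>)"
    proof (rule integral_norm_bound_integral)
      show "(\<lambda>t. r t * (F t - F s)) integrable_on {0..1}"
        unfolding right_diff_distrib by (intro Henstock_Kurzweil_Integration.integrable_diff rF rc)
      show "(\<lambda>t. r t * \<delta>) integrable_on {0..1}" by (rule rc)
      fix t
      have r0: "0 \<le> r t" unfolding r_def using ramp'_nonneg s by simp
      show "norm (r t * (F t - F s)) \<le> r t * \<delta>"
      proof (cases "s \<le> t \<and> t \<le> s + \<epsilon>")
        case True
        then show ?thesis using near[of t] r0 by (simp add: abs_mult mult_left_mono)
      next
        case False
        then have "(t - s) / \<epsilon> \<le> 0 \<or> 1 \<le> (t - s) / \<epsilon>" using s by (auto simp: field_simps)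
        then have "r t = 0" unfolding r_def by (simp add: ramp'_eq_0)
        then show ?thesis by simp
      qed
    qed
    then show ?thesis by simp
  qed
  also have "\<dots> = \<delta>" by (rule ir)
  finally show ?thesis unfolding r_def .
qed

text \<open>
  A difference of two steep ramps is an admissible cutoff in time, and its derivative is an
  approximate difference of two point evaluations.
\<close>

lemma weak_increment_bound:
  fixes F :: "real \<Rightarrow> real"
  assumes F: "continuous_on {0..1} F"
    and H: "\<And>\<eta> \<eta>' a b. \<lbrakk>\<And>s. (\<eta> has_real_derivative \<eta>' s) (at s); continuous_on UNIV \<eta>'; 0 < a; b < 1;
        \<And>s. s \<notin> {a..b} \<Longrightarrow> \<eta> s = 0; \<And>s. 0 \<le> \<eta> s \<and> \<eta> s \<le> 1\<rbrakk>
        \<Longrightarrow> \<bar>integral {0..1} (\<lambda>s. \<eta>' s * F s)\<bar> \<le> \<Gamma>"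
    and s: "s \<in> {0..1}" "s' \<in> {0..1}"
  shows "\<bar>F s - F s'\<bar> \<le> \<Gamma>"
proof -
  have G0: "0 \<le> \<Gamma>" using H[of "\<lambda>_. 0" "\<lambda>_. 0" "1/2" "1/2"] by auto
  have inner: "\<bar>F a - F b\<bar> \<le> \<Gamma>" if ab: "0 < a" "a < b" "b < 1" for a b
  proof (rule field_le_epsilon)
    fix \<delta> :: real assume d: "\<delta> > 0"
    have key: "\<exists>\<epsilon>>0. s + \<epsilon> < 1 \<and> (\<forall>t. s \<le> t \<longrightarrow> t \<le> s + \<epsilon> \<longrightarrow> \<bar>F t - F s\<bar> \<le> \<delta> / 2)" if sI: "0 < s" "s < 1" for s
    proof -
      have s01: "s \<in> {0..1}" "\<delta> / 2 > 0" using that d by auto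
      obtain r where r: "r > 0" "\<forall>t\<in>{0..1}. dist t s < r \<longrightarrow> dist (F t) (F s) < \<delta> / 2"
        using F[unfolded continuous_on_iff, rule_format, OF s01] by metis
      obtain m where m: "0 < m" "m < min r (1 - s)" using dense[of 0 "min r (1 - s)"] r(1) sI by auto
      show ?thesis
      proof (intro exI[of _ m] conjI allI impI)
        show "0 < m" "s + m < 1" using m by auto
        fix t assume "s \<le> t" "t \<le> s + m"
        then have "0 \<le> t" "t \<le> 1" "\<bar>t - s\<bar> < r" using m that by (auto simp: abs_if)
        then have "dist (F t) (F s) < \<delta> / 2" using r(2) by (simp add: dist_real_def)
        then show "\<bar>F t - F s\<bar> \<le> \<delta> / 2" by (simp add: dist_real_def)
      qed
    qed
    have a1: "0 < a" "a < 1" and b1: "0 < b" "b < 1" using ab by auto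
    from key[OF a1] obtain p where
      p: "p > 0" "a + p < 1" "\<And>t. a \<le> t \<Longrightarrow> t \<le> a + p \<Longrightarrow> \<bar>F t - F a\<bar> \<le> \<delta> / 2" by blast
    from key[OF b1] obtain q where
      q: "q > 0" "b + q < 1" "\<And>t. b \<le> t \<Longrightarrow> t \<le> b + q \<Longrightarrow> \<bar>F t - F b\<bar> \<le> \<delta> / 2" by blast
    define \<epsilon> where "\<epsilon> = min p q"
    have e: "\<epsilon> > 0" "\<epsilon> \<le> p" "\<epsilon> \<le> q" using p q by (auto simp: \<epsilon>_def)
    let ?r = "\<lambda>s t. ramp' ((t - s) / \<epsilon>) / \<epsilon>"
    let ?\<eta> = "\<lambda>t. ramp ((t - a) / \<epsilon>) - ramp ((t - b) / \<epsilon>)"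
    have "\<bar>integral {0..1} (\<lambda>t. (?r a t - ?r b t) * F t)\<bar> \<le> \<Gamma>"
    proof (rule H)
      show "(?\<eta> has_real_derivative ?r a t - ?r b t) (at t)" for t
        by (intro DERIV_diff DERIV_ramp_scaled)
      show "continuous_on UNIV (\<lambda>t. ?r a t - ?r b t)"
        using e by (intro continuous_on_divide continuous_on_diff
          continuous_on_id continuous_on_const continuous_on_compose2[OF continuous_ramp'[of UNIV]]) auto
      show "0 < a" "b + q < 1" using ab q by auto
      show "?\<eta> t = 0" if "t \<notin> {a..b + q}" for t
      proof (cases "t < a")
        case True
        then have "(t - a) / \<epsilon> \<le> 0" "(t - b) / \<epsilon> \<le> 0" using ab e by (auto simp: divide_nonpos_pos)
        then show ?thesis by (simp add: ramp_le_0)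
      next
        case False
        then have "1 \<le> (t - a) / \<epsilon>" "1 \<le> (t - b) / \<epsilon>" using that ab e by (auto simp: field_simps)
        then show ?thesis by (simp add: ramp_ge_1)
      qed
      have "ramp ((t - b) / \<epsilon>) \<le> ramp ((t - a) / \<epsilon>)" for t
        using ab e by (intro ramp_mono divide_right_mono) auto
      then show "0 \<le> ?\<eta> t \<and> ?\<eta> t \<le> 1" for t
        using ramp_bounds[of "(t - a) / \<epsilon>"] ramp_bounds[of "(t - b) / \<epsilon>"] by (simp add: add_increasing2 diff_le_eq)
    qed
    moreover have "(\<lambda>t. ?r s t * F t) integrable_on {0..1}" for s
      using e by (intro integrable_continuous_interval continuous_on_mult F continuous_on_divide continuous_on_diff
          continuous_on_id continuous_on_const continuous_on_compose2[OF continuous_ramp'[of UNIV]]) auto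
    then have "integral {0..1} (\<lambda>t. (?r a t - ?r b t) * F t)
       = integral {0..1} (\<lambda>t. ?r a t * F t) - integral {0..1} (\<lambda>t. ?r b t * F t)"
      by (simp add: left_diff_distrib Henstock_Kurzweil_Integration.integral_diff)
    moreover have "\<bar>integral {0..1} (\<lambda>t. ?r a t * F t) - F a\<bar> \<le> \<delta> / 2"
      using ab p e by (intro ramp_average F) auto
    moreover have "\<bar>integral {0..1} (\<lambda>t. ?r b t * F t) - F b\<bar> \<le> \<delta> / 2"
      using ab q e by (intro ramp_average F) auto
    ultimately show "\<bar>F a - F b\<bar> \<le> \<Gamma> + \<delta>" by linarith
  qed
  have inner': "\<bar>F a - F b\<bar> \<le> \<Gamma>" if "a \<in> {0<..<1}" "b \<in> {0<..<1}" for a b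
    using inner[of a b] inner[of b a] that G0 by (cases a b rule: linorder_cases) (auto simp: abs_minus_commute)
  define r where "r n = inverse (real (Suc n)) / 2" for n
  have r: "0 < r n" "r n < 1" for n by (auto simp: r_def field_simps)
  define p where "p s n = s + (1/2 - s) * r n" for s n
  have p: "p s n \<in> {0<..<1}" if "s \<in> {0..1}" for s n
  proof -
    define q where "q = (1 - r n) * s"
    have "p s n = q + r n / 2" by (simp add: p_def q_def algebra_simps)
    moreover have "0 \<le> q" "q \<le> 1 - r n"
      unfolding q_def using that r[of n] by (auto intro!: mult_left_le mult_nonneg_nonneg)
    ultimately have "0 < p s n" "p s n < 1" using r[of n] by linarith+
    then show ?thesis by simp
  qed
  have "r \<longlonglongrightarrow> 0 / 2"
    unfolding r_def by (rule tendsto_divide[OF LIMSEQ_inverse_real_of_nat tendsto_const]) simp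
  then have "(\<lambda>n. p s n) \<longlonglongrightarrow> s + (1/2 - s) * (0 / 2)" for s
    unfolding p_def by (rule tendsto_add[OF tendsto_const tendsto_mult[OF tendsto_const]])
  then have "(\<lambda>n. p s n) \<longlonglongrightarrow> s" for s by simp
  then have "(\<lambda>n. F (p s n)) \<longlonglongrightarrow> F s" if "s \<in> {0..1}" for s
    using p[OF that] that by (intro continuous_on_tendsto_compose[OF F]) (auto intro!: always_eventually less_imp_le)
  then have "(\<lambda>n. \<bar>F (p s n) - F (p s' n)\<bar>) \<longlonglongrightarrow> \<bar>F s - F s'\<bar>"
    using s by (intro tendsto_intros) auto
  then show ?thesis
    by (rule LIMSEQ_le_const2) (use inner' p s in auto)
qed

lemma integral_lebesgue_on_continuous:
  fixes G :: "real \<Rightarrow> real"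
  assumes "continuous_on {a..b} G"
  shows "integrable (lebesgue_on {a..b}) G" "(\<integral>t. G t \<partial>lebesgue_on {a..b}) = integral {a..b} G"
proof -
  show i: "integrable (lebesgue_on {a..b}) G" by (rule continuous_imp_integrable_real[OF assms])
  show "(\<integral>t. G t \<partial>lebesgue_on {a..b}) = integral {a..b} G"
    by (rule lebesgue_integral_eq_integral[OF i]) simp
qed

lemma borel_measurable_offdiag_borel:
  "g \<in> borel_measurable borel \<Longrightarrow> g \<in> borel_measurable offdiag_borel"
  unfolding offdiag_borel_def by (rule measurable_restrict_space1)

lemma CE_D:
  assumes "(f, U) \<in> CE e T"
  shows "t \<in> {0..T} \<Longrightarrow> f t \<in> borel_prob" "t \<in> {0..T} \<Longrightarrow> signed_measure offdiag_borel (U t)"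
    "narrowly_continuous T f"
    "(\<integral>\<^sup>+t. (\<integral>\<^sup>+p. ennreal (sigma_e e \<bar>fst p - snd p\<bar>) \<partial>tot_variation offdiag_borel (U t)) \<partial>lebesgue_on {0..T}) < \<infinity>"
    "\<phi> \<in> C1c_strip T \<Longrightarrow>
        (\<integral>t. (\<integral>v. deriv (\<lambda>s. \<phi> s v) t \<partial>f t) \<partial>lebesgue_on {0..T}) +
        (\<integral>t. signed_integral offdiag_borel (U t)
               (\<lambda>p. sigma_e e \<bar>fst p - snd p\<bar> * nonlocal_grad (\<phi> t) p) \<partial>lebesgue_on {0..T}) = 0"
  using assms unfolding CE_def by auto

lemma C1c_bounded:
  assumes "C1c \<psi>" shows "bounded (range \<psi>)" "continuous_on UNIV \<psi>"
proof -
  show c: "continuous_on UNIV \<psi>" using assms unfolding C1c_def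
    by (auto simp: continuous_on_eq_continuous_at intro: differentiable_imp_continuous_within)
  obtain L where L: "\<And>v. L < \<bar>v\<bar> \<Longrightarrow> \<psi> v = 0" using assms unfolding C1c_def by auto
  have "compact (\<psi> ` {- \<bar>L\<bar>..\<bar>L\<bar>})"
    using c by (intro compact_continuous_image) (auto intro: continuous_on_subset)
  then have "bounded (\<psi> ` {- \<bar>L\<bar>..\<bar>L\<bar>} \<union> {0})" by (auto dest: compact_imp_bounded)
  moreover have "range \<psi> \<subseteq> \<psi> ` {- \<bar>L\<bar>..\<bar>L\<bar>} \<union> {0}"
  proof
    fix y assume "y \<in> range \<psi>"
    then obtain v where v: "y = \<psi> v" by auto
    show "y \<in> \<psi> ` {- \<bar>L\<bar>..\<bar>L\<bar>} \<union> {0}"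
    proof (cases "\<bar>v\<bar> \<le> \<bar>L\<bar>")
      case True
      then have "v \<in> {- \<bar>L\<bar>..\<bar>L\<bar>}" by auto
      then show ?thesis using v by blast
    qed (use v L[of v] in auto)
  qed
  ultimately show "bounded (range \<psi>)" by (rule bounded_subset)
qed

text \<open>
  A cutoff in time times a function of the velocity is an admissible test function of the weak
  equation, which turns the increments of the test integral into a flux integral.
\<close>

lemma CE_increment:
  assumes CE: "(f, U) \<in> CE e 1" and \<psi>: "C1c \<psi>" and s: "s \<in> {0..1}" "s' \<in> {0..1}"
  shows "ennreal \<bar>(\<integral>v. \<psi> v \<partial>f s) - (\<integral>v. \<psi> v \<partial>f s')\<bar>
    \<le> (\<integral>\<^sup>+t. (\<integral>\<^sup>+p. ennreal \<bar>sigma_e e \<bar>fst p - snd p\<bar> * nonlocal_grad \<psi> p\<bar>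
          \<partial>tot_variation offdiag_borel (U t)) \<partial>lebesgue_on {0..1})" (is "_ \<le> ?R")
proof (cases "?R = \<infinity>")
  case True then show ?thesis by simp
next
  case False
  define F where "F t = (\<integral>v. \<psi> v \<partial>f t)" for t
  let ?M = offdiag_borel
  have contF: "continuous_on {0..1} F"
    using CE_D(3)[OF CE] C1c_bounded[OF \<psi>] unfolding narrowly_continuous_def F_def by auto
  obtain L where L: "\<And>v. L < \<bar>v\<bar> \<Longrightarrow> \<psi> v = 0" using \<psi> unfolding C1c_def by auto
  have d\<psi>: "(\<psi> has_real_derivative deriv \<psi> v) (at v)" for v
    using \<psi> unfolding C1c_def by (auto simp: DERIV_deriv_iff_real_differentiable)
  have c\<psi>': "continuous_on UNIV (deriv \<psi>)" using \<psi> unfolding C1c_def by auto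
  have c\<psi>: "continuous_on UNIV \<psi>" using C1c_bounded[OF \<psi>] by simp
  have gm: "(\<lambda>p. sigma_e e \<bar>fst p - snd p\<bar> * (c * nonlocal_grad \<psi> p)) \<in> borel_measurable ?M" for c
    unfolding nonlocal_grad_def sigma_e_def split_beta
    by (intro borel_measurable_offdiag_borel borel_measurable_continuous_onI continuous_intros
        continuous_on_compose2[OF c\<psi>']) auto
  have "\<bar>F s - F s'\<bar> \<le> enn2real ?R"
  proof (rule weak_increment_bound[OF contF _ s])
    fix \<eta> \<eta>' :: "real \<Rightarrow> real" and a b
    assume d: "\<And>s. (\<eta> has_real_derivative \<eta>' s) (at s)" and c: "continuous_on UNIV \<eta>'"
      and ab: "0 < a" "b < 1" "\<And>s. s \<notin> {a..b} \<Longrightarrow> \<eta> s = 0" and bd: "\<And>s. 0 \<le> \<eta> s \<and> \<eta> s \<le> 1"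
    define \<phi> where "\<phi> t v = \<eta> t * \<psi> v" for t v
    have D1: "((\<lambda>s. \<phi> s v) has_real_derivative \<eta>' t * \<psi> v) (at t)" for t v
      unfolding \<phi>_def by (rule DERIV_cmult_right[OF d])
    have D2: "(\<phi> t has_real_derivative \<eta> t * deriv \<psi> v) (at v)" for t v
      unfolding \<phi>_def[abs_def] by (rule DERIV_cmult[OF d\<psi>])
    note d1 = D1[THEN DERIV_imp_deriv] and d2 = D2[THEN DERIV_imp_deriv]
    have c\<eta>: "continuous_on UNIV \<eta>" using d DERIV_isCont continuous_at_imp_continuous_on by blast
    have "\<phi> \<in> C1c_strip 1"
      unfolding C1c_strip_def
    proof (intro CollectI conjI allI)
      show "(\<lambda>s. \<phi> s v) differentiable at t" for v t
        unfolding real_differentiable_def using D1 by blast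
      show "\<phi> t differentiable at v" for v t
        unfolding real_differentiable_def using D2 by blast
      show "continuous_on UNIV (\<lambda>(t, v). deriv (\<lambda>s. \<phi> s v) t)"
        unfolding d1 split_beta
        by (intro continuous_intros continuous_on_compose2[OF c] continuous_on_compose2[OF c\<psi>]) auto
      show "continuous_on UNIV (\<lambda>(t, v). deriv (\<phi> t) v)"
        unfolding d2 split_beta
        by (intro continuous_intros continuous_on_compose2[OF c\<eta>] continuous_on_compose2[OF c\<psi>']) auto
      show "\<exists>K. compact K \<and> K \<subseteq> {0<..<1} \<times> UNIV \<and> (\<forall>t v. (t, v) \<notin> K \<longrightarrow> \<phi> t v = 0)"
      proof (intro exI conjI allI impI)
        show "compact ({a..b} \<times> {-L..L})" by (intro compact_Times compact_Icc)
        show "{a..b} \<times> {-L..L} \<subseteq> {0<..<1} \<times> UNIV" using ab by auto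
        fix t v assume n: "(t, v) \<notin> {a..b} \<times> {-L..L}"
        show "\<phi> t v = 0"
        proof (cases "t \<in> {a..b}")
          case True
          then have "L < \<bar>v\<bar>" using n by auto
          then show ?thesis using L by (simp add: \<phi>_def)
        qed (use ab in \<open>simp add: \<phi>_def\<close>)
      qed
    qed
    from CE_D(5)[OF CE this]
    have eq: "(\<integral>t. \<eta>' t * F t \<partial>lebesgue_on {0..1}) =
       - (\<integral>t. signed_integral ?M (U t) (\<lambda>p. sigma_e e \<bar>fst p - snd p\<bar> * nonlocal_grad (\<phi> t) p) \<partial>lebesgue_on {0..1})"
      unfolding d1 F_def by simp
    have ng: "nonlocal_grad (\<phi> t) = (\<lambda>p. \<eta> t * nonlocal_grad \<psi> p)" for t
      unfolding nonlocal_grad_def d2 by (auto simp: algebra_simps)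
    have "continuous_on {0..1} (\<lambda>t. \<eta>' t * F t)"
      by (intro continuous_intros contF continuous_on_subset[OF c]) auto
    then have "integral {0..1} (\<lambda>t. \<eta>' t * F t) = (\<integral>t. \<eta>' t * F t \<partial>lebesgue_on {0..1})"
      by (rule integral_lebesgue_on_continuous(2)[symmetric])
    then have "ennreal \<bar>integral {0..1} (\<lambda>t. \<eta>' t * F t)\<bar> =
       ennreal \<bar>\<integral>t. signed_integral ?M (U t) (\<lambda>p. sigma_e e \<bar>fst p - snd p\<bar> * nonlocal_grad (\<phi> t) p) \<partial>lebesgue_on {0..1}\<bar>"
      unfolding eq by simp
    also have "\<dots> \<le> (\<integral>\<^sup>+t. ennreal \<bar>signed_integral ?M (U t) (\<lambda>p. sigma_e e \<bar>fst p - snd p\<bar> * nonlocal_grad (\<phi> t) p)\<bar> \<partial>lebesgue_on {0..1})"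
      (is "ennreal \<bar>integral\<^sup>L ?N ?h\<bar> \<le> _")
      using integral_norm_bound_ennreal[of ?N ?h] by (cases "integrable ?N ?h") (auto simp: not_integrable_integral_eq)
    also have "\<dots> \<le> ?R"
    proof (rule nn_integral_mono)
      fix t
      have "ennreal \<bar>?h t\<bar> \<le> (\<integral>\<^sup>+p. ennreal \<bar>sigma_e e \<bar>fst p - snd p\<bar> * (\<eta> t * nonlocal_grad \<psi> p)\<bar> \<partial>tot_variation ?M (U t))"
        unfolding ng by (rule signed_integral_le_tot_variation[OF gm])
      also have "\<dots> \<le> (\<integral>\<^sup>+p. ennreal \<bar>sigma_e e \<bar>fst p - snd p\<bar> * nonlocal_grad \<psi> p\<bar> \<partial>tot_variation ?M (U t))"
      proof (intro nn_integral_mono ennreal_leI)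
        fix p
        have "\<bar>\<eta> t\<bar> * \<bar>sigma_e e \<bar>fst p - snd p\<bar> * nonlocal_grad \<psi> p\<bar> \<le> 1 * \<bar>sigma_e e \<bar>fst p - snd p\<bar> * nonlocal_grad \<psi> p\<bar>"
          using bd[of t] by (intro mult_right_mono) auto
        then show "\<bar>sigma_e e \<bar>fst p - snd p\<bar> * (\<eta> t * nonlocal_grad \<psi> p)\<bar> \<le> \<bar>sigma_e e \<bar>fst p - snd p\<bar> * nonlocal_grad \<psi> p\<bar>"
          by (simp add: abs_mult ac_simps)
      qed
      finally show "ennreal \<bar>?h t\<bar> \<le> \<dots>" .
    qed
    also have "?R = ennreal (enn2real ?R)" using False by (simp add: less_top[symmetric])
    finally show "\<bar>integral {0..1} (\<lambda>t. \<eta>' t * F t)\<bar> \<le> enn2real ?R" by simp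
  qed
  then have "ennreal \<bar>F s - F s'\<bar> \<le> ennreal (enn2real ?R)" by (rule ennreal_leI)
  also have "\<dots> = ?R" using False by (simp add: less_top[symmetric])
  finally show ?thesis unfolding F_def .
qed

text \<open>
  The action of a competitor need not be known to depend measurably on time, so its time integral
  is a lower integral; Cauchy--Schwarz survives because a lower integral is attained by a
  measurable minorant.
\<close>

lemma measurable_minorant:
  fixes h :: "'a \<Rightarrow> ennreal"
  obtains G where "G \<in> borel_measurable M" "\<And>x. G x \<le> h x" "(\<integral>\<^sup>+x. h x \<partial>M) \<le> (\<integral>\<^sup>+x. G x \<partial>M)"
proof -
  let ?S = "{g. simple_function M g \<and> g \<le> h}"
  have "?S \<noteq> {}" by (auto intro!: exI[of _ "\<lambda>_. 0"] simp: le_fun_def)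
  then have "\<exists>r::nat \<Rightarrow> ennreal. range r \<subseteq> integral\<^sup>S M ` ?S \<and> Sup (integral\<^sup>S M ` ?S) = (SUP i. r i)"
    using ennreal_Sup_countable_SUP[of "integral\<^sup>S M ` ?S"] by auto
  then obtain r where r: "range r \<subseteq> integral\<^sup>S M ` ?S" "(\<integral>\<^sup>+x. h x \<partial>M) = (SUP i::nat. r i)"
    unfolding nn_integral_def by auto
  have "\<exists>g. \<forall>i. g i \<in> ?S \<and> r i = integral\<^sup>S M (g i)"
    using r(1) by (intro choice) (auto simp: image_subset_iff image_iff)
  then obtain g where g: "\<And>i. g i \<in> ?S" "\<And>i. r i = integral\<^sup>S M (g i)" by auto
  show ?thesis
  proof (rule that[of "\<lambda>x. SUP i. g i x"])
    show m: "(\<lambda>x. SUP i. g i x) \<in> borel_measurable M"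
      using g(1) by (intro borel_measurable_SUP) (auto intro: borel_measurable_simple_function)
    show "(SUP i. g i x) \<le> h x" for x using g(1) by (auto intro!: SUP_least simp: le_fun_def)
    show "(\<integral>\<^sup>+x. h x \<partial>M) \<le> (\<integral>\<^sup>+x. (SUP i. g i x) \<partial>M)"
      unfolding r(2)
    proof (rule SUP_least)
      fix i
      have "r i = (\<integral>\<^sup>+x. g i x \<partial>M)" using g by (simp add: nn_integral_eq_simple_integral)
      also have "\<dots> \<le> (\<integral>\<^sup>+x. (SUP i. g i x) \<partial>M)" by (intro nn_integral_mono SUP_upper) auto
      finally show "r i \<le> (\<integral>\<^sup>+x. (SUP i. g i x) \<partial>M)" .
    qed
  qed
qed

lemma lower_integral_Cauchy_Schwarz:
  fixes h A :: "'a \<Rightarrow> ennreal"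
  assumes M: "emeasure M (space M) = 1" and C: "0 < C"
    and le: "\<And>x. x \<in> space M \<Longrightarrow> (h x)\<^sup>2 \<le> A x * ennreal C"
  shows "(\<integral>\<^sup>+x. h x \<partial>M)\<^sup>2 \<le> (\<integral>\<^sup>+x. A x \<partial>M) * ennreal C"
proof -
  obtain G where G[measurable]: "G \<in> borel_measurable M" and Gh: "\<And>x. G x \<le> h x"
    and I: "(\<integral>\<^sup>+x. h x \<partial>M) \<le> (\<integral>\<^sup>+x. G x \<partial>M)" 
    using measurable_minorant[of M h] by blast
  have "(\<integral>\<^sup>+x. h x \<partial>M)\<^sup>2 \<le> (\<integral>\<^sup>+x. G x * 1 \<partial>M)\<^sup>2" using I by (intro power_mono) auto
  also have "\<dots> \<le> (\<integral>\<^sup>+x. (G x)\<^sup>2 \<partial>M) * (\<integral>\<^sup>+x. 1\<^sup>2 \<partial>M)" by (rule Cauchy_Schwarz_nn_integral) auto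
  also have "\<dots> = (\<integral>\<^sup>+x. (G x)\<^sup>2 \<partial>M)" by (simp add: M)
  also have "\<dots> = (\<integral>\<^sup>+x. (G x)\<^sup>2 * ennreal (1 / C) * ennreal C \<partial>M)"
    using C by (simp add: mult.assoc ennreal_mult'[symmetric])
  also have "\<dots> = (\<integral>\<^sup>+x. (G x)\<^sup>2 * ennreal (1 / C) \<partial>M) * ennreal C"
    by (rule nn_integral_multc) measurable
  also have "\<dots> \<le> (\<integral>\<^sup>+x. A x \<partial>M) * ennreal C"
  proof (intro mult_right_mono nn_integral_mono)
    fix x assume "x \<in> space M"
    then have "(G x)\<^sup>2 \<le> A x * ennreal C" using power_mono[OF Gh[of x], of 2] le by (auto intro: order_trans)
    then have "(G x)\<^sup>2 * ennreal (1 / C) \<le> A x * ennreal C * ennreal (1 / C)" by (rule mult_right_mono) simp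
    also have "\<dots> = A x" using C by (simp add: mult.assoc ennreal_mult'[symmetric])
    finally show "(G x)\<^sup>2 * ennreal (1 / C) \<le> A x" .
  qed simp
  finally show ?thesis .
qed

section \<open>Lipschitz test functions and first moments\<close>

definition lip1 :: "(real \<Rightarrow> real) \<Rightarrow> bool" where
  "lip1 \<psi> \<longleftrightarrow> (\<forall>x y. \<bar>\<psi> x - \<psi> y\<bar> \<le> \<bar>x - y\<bar>)"

lemma lip1D: "lip1 \<psi> \<Longrightarrow> \<bar>\<psi> x - \<psi> y\<bar> \<le> \<bar>x - y\<bar>"
  by (simp add: lip1_def)

lemma lip1_continuous: "lip1 \<psi> \<Longrightarrow> continuous_on S \<psi>"
proof -
  assume "lip1 \<psi>"
  then have "1-lipschitz_on S \<psi>" by (auto simp: lipschitz_on_def lip1_def dist_real_def)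
  then show ?thesis by (rule lipschitz_on_continuous_on)
qed

lemma lip1_measurable: "lip1 \<psi> \<Longrightarrow> \<psi> \<in> borel_measurable borel"
  by (intro borel_measurable_continuous_onI lip1_continuous)

lemma lip1_abs: "lip1 (\<lambda>v. \<bar>v\<bar>)" by (auto simp: lip1_def)
lemma lip1_const: "lip1 (\<lambda>v. c)" by (auto simp: lip1_def)
lemma lip1_uminus: "lip1 f \<Longrightarrow> lip1 (\<lambda>v. - f v)"
  by (simp add: lip1_def) (metis abs_minus_commute)

lemma lip1_max: "lip1 f \<Longrightarrow> lip1 g \<Longrightarrow> lip1 (\<lambda>v. max (f v) (g v))"
  unfolding lip1_def
proof (intro allI)
  fix x y assume *: "\<forall>x y. \<bar>f x - f y\<bar> \<le> \<bar>x - y\<bar>" "\<forall>x y. \<bar>g x - g y\<bar> \<le> \<bar>x - y\<bar>"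
  have "\<bar>f x - f y\<bar> \<le> \<bar>x - y\<bar>" "\<bar>g x - g y\<bar> \<le> \<bar>x - y\<bar>" using * by auto
  then show "\<bar>max (f x) (g x) - max (f y) (g y)\<bar> \<le> \<bar>x - y\<bar>" by linarith
qed

lemma lip1_min: "lip1 f \<Longrightarrow> lip1 g \<Longrightarrow> lip1 (\<lambda>v. min (f v) (g v))"
  using lip1_uminus[OF lip1_max[OF lip1_uminus lip1_uminus], of f g]
  by (simp add: minus_max_eq_min)

lemma antiderivative_exists:
  fixes \<psi> :: "real \<Rightarrow> real"
  assumes "continuous_on UNIV \<psi>"
  obtains \<Psi> where "\<And>x. (\<Psi> has_real_derivative \<psi> x) (at x)"
proof -
  have "\<exists>F. \<forall>x. -\<infinity> < ereal x \<longrightarrow> ereal x < \<infinity> \<longrightarrow> (F has_vector_derivative \<psi> x) (at x)"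
    using assms by (intro einterval_antiderivative) (auto simp: continuous_on_eq_continuous_at)
  then obtain F where F: "\<forall>x. -\<infinity> < ereal x \<longrightarrow> ereal x < \<infinity> \<longrightarrow> (F has_vector_derivative \<psi> x) (at x)" ..
  show thesis by (rule that[of F]) (use F in \<open>simp add: has_real_derivative_iff_has_vector_derivative\<close>)
qed

text \<open>Averaging over a short window makes a Lipschitz function continuously differentiable.\<close>

lemma lip1_smoothing:
  assumes \<psi>: "lip1 \<psi>" and L: "\<And>v. L < \<bar>v\<bar> \<Longrightarrow> \<psi> v = 0" and \<epsilon>: "\<epsilon> > 0"
  obtains \<zeta> where "C1c \<zeta>" "\<And>v. \<bar>deriv \<zeta> v\<bar> \<le> 1" "\<And>v. \<bar>\<zeta> v - \<psi> v\<bar> \<le> \<epsilon>"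
proof -
  have c: "continuous_on UNIV \<psi>" by (rule lip1_continuous[OF \<psi>])
  obtain \<Psi> where \<Psi>: "\<And>x. (\<Psi> has_real_derivative \<psi> x) (at x)" using antiderivative_exists[OF c] by blast
  define \<zeta> where "\<zeta> v = (\<Psi> (v + \<epsilon>) - \<Psi> v) / \<epsilon>" for v
  define \<zeta>' where "\<zeta>' v = (\<psi> (v + \<epsilon>) - \<psi> v) / \<epsilon>" for v
  have d: "(\<zeta> has_real_derivative \<zeta>' v) (at v)" for v
  proof -
    have "((\<lambda>v. \<Psi> (v + \<epsilon>)) has_real_derivative \<psi> (v + \<epsilon>)) (at v)"
      using \<Psi>[of "v + \<epsilon>"] by (simp add: DERIV_shift)
    from DERIV_cdivide[OF DERIV_diff[OF this \<Psi>[of v]], of \<epsilon>] show ?thesis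
      unfolding \<zeta>_def[abs_def] \<zeta>'_def .
  qed
  have mv: "\<exists>\<xi>. v \<le> \<xi> \<and> \<xi> \<le> v + \<epsilon> \<and> \<zeta> v = \<psi> \<xi>" for v
  proof -
    have "\<exists>z>v. z < v + \<epsilon> \<and> \<Psi> (v + \<epsilon>) - \<Psi> v = (v + \<epsilon> - v) * \<psi> z"
      using \<epsilon> \<Psi> by (intro MVT2) auto
    then obtain z where "z > v" "z < v + \<epsilon>" "\<Psi> (v + \<epsilon>) - \<Psi> v = \<epsilon> * \<psi> z" by auto
    then show ?thesis using \<epsilon> by (intro exI[of _ z]) (auto simp: \<zeta>_def)
  qed
  have c': "continuous_on UNIV \<zeta>'"
    unfolding \<zeta>'_def using \<epsilon>
    by (intro continuous_on_divide continuous_on_diff c continuous_on_const continuous_on_compose2[OF c]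
        continuous_on_add continuous_on_id) auto
  have z: "\<zeta> v = 0" if "L + \<epsilon> < \<bar>v\<bar>" for v
  proof -
    obtain \<xi> where \<xi>: "v \<le> \<xi>" "\<xi> \<le> v + \<epsilon>" "\<zeta> v = \<psi> \<xi>" using mv by blast
    then have "L < \<bar>\<xi>\<bar>" using that by linarith
    then show ?thesis using \<xi> L by simp
  qed
  have C: "C1c \<zeta>" "deriv \<zeta> = \<zeta>'"
    using C1cI[of \<zeta> \<zeta>' "L + \<epsilon>"] d c' z by blast+
  show thesis
  proof (rule that[of \<zeta>])
    show "C1c \<zeta>" by (rule C)
    show "\<bar>deriv \<zeta> v\<bar> \<le> 1" for v
      unfolding C(2) \<zeta>'_def using lip1D[OF \<psi>, of "v + \<epsilon>" v] \<epsilon> by (simp add: abs_divide)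
    show "\<bar>\<zeta> v - \<psi> v\<bar> \<le> \<epsilon>" for v
    proof -
      obtain \<xi> where \<xi>: "v \<le> \<xi>" "\<xi> \<le> v + \<epsilon>" "\<zeta> v = \<psi> \<xi>" using mv by blast
      have "\<bar>\<psi> \<xi> - \<psi> v\<bar> \<le> \<bar>\<xi> - v\<bar>" by (rule lip1D[OF \<psi>])
      then show ?thesis using \<xi> by linarith
    qed
  qed
qed

lemma borel_prob_measurable: "f \<in> borel_prob \<Longrightarrow> h \<in> borel_measurable borel \<Longrightarrow> h \<in> borel_measurable f"
  using borel_probD(1) by (simp cong: measurable_cong_sets)

lemma borel_prob_integrable_bounded:
  assumes f: "f \<in> borel_prob" and h: "h \<in> borel_measurable borel" and B: "\<And>v. \<bar>h v\<bar> \<le> (B::real)"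
  shows "integrable f h"
proof -
  interpret prob_space f by (rule borel_probD[OF f])
  show ?thesis using borel_prob_measurable[OF f h] B by (intro integrable_const_bound[of _ B]) auto
qed

lemma borel_prob_integral_const: "f \<in> borel_prob \<Longrightarrow> (\<integral>v. c \<partial>f) = (c::real)"
  using borel_probD(2)[THEN prob_space.prob_space] by simp

lemma abs_moment_nonneg: "0 \<le> (\<integral>v. \<bar>v\<bar> \<partial>f)" for f :: "real measure"
  by (rule integral_nonneg_AE) auto

lemma lip1_integrable:
  assumes f: "f \<in> borel_prob" and i: "integrable f (\<lambda>v. \<bar>v\<bar>)" and \<psi>: "lip1 \<psi>"
  shows "integrable f \<psi>"
proof -
  have "integrable f (\<lambda>v. \<bar>v\<bar> + \<bar>\<psi> 0\<bar>)"
    by (intro Bochner_Integration.integrable_add i borel_prob_integrable_bounded[OF f, of _ "\<bar>\<psi> 0\<bar>"]) auto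
  then show ?thesis
  proof (rule Bochner_Integration.integrable_bound[OF _ borel_prob_measurable[OF f lip1_measurable[OF \<psi>]]], intro AE_I2)
    fix v show "norm (\<psi> v) \<le> norm (\<bar>v\<bar> + \<bar>\<psi> 0\<bar>)" using lip1D[OF \<psi>, of v 0] by simp
  qed
qed

definition tent :: "real \<Rightarrow> real \<Rightarrow> real" where
  "tent r v = max 0 (min \<bar>v\<bar> (2 * r - \<bar>v\<bar>))"

lemma lip1_tent: "lip1 (tent r)"
  unfolding tent_def by (intro lip1_max lip1_min lip1_const lip1_abs) (auto simp: lip1_def)

lemma tent_facts:
  "0 \<le> tent r v" "tent r v \<le> \<bar>v\<bar>" "\<bar>v\<bar> \<le> r \<Longrightarrow> tent r v = \<bar>v\<bar>" "2 * r < \<bar>v\<bar> \<Longrightarrow> tent r v = 0" "0 \<le> r \<Longrightarrow> tent r v \<le> r"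
  by (auto simp: tent_def)

text \<open>
  The hypothesis below bounds the Kantorovich--Rubinstein distance of two probability measures
  through smooth compactly supported test functions only; it then holds for all Lipschitz
  functions, and it carries a finite first moment from one measure to the other.
\<close>

locale close_measures =
  fixes \<nu>1 \<nu>2 :: "real measure" and \<Gamma> :: real
  assumes p1: "\<nu>1 \<in> borel_prob" and p2: "\<nu>2 \<in> borel_prob"
    and close: "\<And>\<psi>. C1c \<psi> \<Longrightarrow> (\<And>v. \<bar>deriv \<psi> v\<bar> \<le> 1) \<Longrightarrow> \<bar>(\<integral>v. \<psi> v \<partial>\<nu>1) - (\<integral>v. \<psi> v \<partial>\<nu>2)\<bar> \<le> \<Gamma>"
begin

lemma close_lip1_compact:
  assumes \<psi>: "lip1 \<psi>" and L: "\<And>v. L < \<bar>v\<bar> \<Longrightarrow> \<psi> v = 0"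
  shows "\<bar>(\<integral>v. \<psi> v \<partial>\<nu>1) - (\<integral>v. \<psi> v \<partial>\<nu>2)\<bar> \<le> \<Gamma>"
proof (rule field_le_epsilon)
  fix \<delta> :: real assume "\<delta> > 0"
  then have e: "\<delta> / 2 > 0" by simp
  obtain \<zeta> where \<zeta>: "C1c \<zeta>" "\<And>v. \<bar>deriv \<zeta> v\<bar> \<le> 1" "\<And>v. \<bar>\<zeta> v - \<psi> v\<bar> \<le> \<delta> / 2"
    using lip1_smoothing[OF \<psi> L e] by blast
  obtain B where B: "\<And>v. \<bar>\<zeta> v\<bar> \<le> B"
    using C1c_bounded(1)[OF \<zeta>(1)] by (auto simp: bounded_iff)
  have m: "\<zeta> \<in> borel_measurable borel" "\<psi> \<in> borel_measurable borel"
    using C1c_bounded(2)[OF \<zeta>(1)] lip1_measurable[OF \<psi>] by (auto intro: borel_measurable_continuous_onI)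
  have B': "\<bar>\<psi> v\<bar> \<le> B + \<delta> / 2" for v using B[of v] \<zeta>(3)[of v] by linarith
  have near: "\<bar>(\<integral>v. \<zeta> v \<partial>f) - (\<integral>v. \<psi> v \<partial>f)\<bar> \<le> \<delta> / 2" if f: "f \<in> borel_prob" for f
  proof -
    have i: "integrable f \<zeta>" "integrable f \<psi>"
      using borel_prob_integrable_bounded[OF f m(1) B] borel_prob_integrable_bounded[OF f m(2) B'] by auto
    have "\<bar>(\<integral>v. \<zeta> v \<partial>f) - (\<integral>v. \<psi> v \<partial>f)\<bar> = \<bar>\<integral>v. \<zeta> v - \<psi> v \<partial>f\<bar>" using i by simp
    also have "\<dots> \<le> (\<integral>v. \<bar>\<zeta> v - \<psi> v\<bar> \<partial>f)" by (rule integral_abs_bound)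
    also have "\<dots> \<le> (\<integral>v. \<delta> / 2 \<partial>f)"
      using i \<zeta>(3) borel_prob_integrable_bounded[OF f, of "\<lambda>_. \<delta> / 2" "\<bar>\<delta> / 2\<bar>"] by (intro integral_mono) auto
    also have "\<dots> = \<delta> / 2" by (rule borel_prob_integral_const[OF f])
    finally show ?thesis .
  qed
  show "\<bar>(\<integral>v. \<psi> v \<partial>\<nu>1) - (\<integral>v. \<psi> v \<partial>\<nu>2)\<bar> \<le> \<Gamma> + \<delta>"
    using near[OF p1] near[OF p2] close[OF \<zeta>(1,2)] by linarith
qed

text \<open>
  The tents increase to the absolute value, so Fatou's lemma transfers the first moment.
\<close>

lemma first_moment_transfer:
  assumes i2: "integrable \<nu>2 (\<lambda>v. \<bar>v\<bar>)"
  shows "integrable \<nu>1 (\<lambda>v. \<bar>v\<bar>)" "(\<integral>v. \<bar>v\<bar> \<partial>\<nu>1) \<le> (\<integral>v. \<bar>v\<bar> \<partial>\<nu>2) + \<Gamma>"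
proof -
  let ?c = "(\<integral>v. \<bar>v\<bar> \<partial>\<nu>2) + \<Gamma>"
  have G0: "0 \<le> \<Gamma>" using close_lip1_compact[of "\<lambda>_. 0" 0] lip1_const[of 0] by simp
  have c0: "0 \<le> ?c" using G0 by (simp add: integral_nonneg_AE add_nonneg_nonneg)
  have it: "integrable f (tent (real n))" if "f \<in> borel_prob" for f n
    using tent_facts[of "real n"] by (intro borel_prob_integrable_bounded[OF that lip1_measurable[OF lip1_tent]]) auto
  have b: "(\<integral>v. tent (real n) v \<partial>\<nu>1) \<le> ?c" for n
  proof -
    have "\<bar>(\<integral>v. tent (real n) v \<partial>\<nu>1) - (\<integral>v. tent (real n) v \<partial>\<nu>2)\<bar> \<le> \<Gamma>"
      by (rule close_lip1_compact[OF lip1_tent]) (rule tent_facts)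
    moreover have "(\<integral>v. tent (real n) v \<partial>\<nu>2) \<le> (\<integral>v. \<bar>v\<bar> \<partial>\<nu>2)"
      by (rule integral_mono[OF it[OF p2] i2]) (rule tent_facts)
    ultimately show ?thesis by linarith
  qed
  have "(\<integral>\<^sup>+v. ennreal \<bar>v\<bar> \<partial>\<nu>1) \<le> (\<integral>\<^sup>+v. liminf (\<lambda>n. ennreal (tent (real n) v)) \<partial>\<nu>1)"
  proof (rule nn_integral_mono)
    fix v :: real
    have "\<forall>\<^sub>F n in sequentially. ennreal \<bar>v\<bar> \<le> ennreal (tent (real n) v)"
      using eventually_ge_at_top[of "nat \<lceil>\<bar>v\<bar>\<rceil>"]
      by eventually_elim (auto simp: tent_facts(3) nat_ceiling_le_eq)
    then show "ennreal \<bar>v\<bar> \<le> liminf (\<lambda>n. ennreal (tent (real n) v))" by (rule Liminf_bounded)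
  qed
  also have "\<dots> \<le> liminf (\<lambda>n. \<integral>\<^sup>+v. ennreal (tent (real n) v) \<partial>\<nu>1)"
    by (rule nn_integral_liminf)
      (intro measurable_compose[OF borel_prob_measurable[OF p1 lip1_measurable[OF lip1_tent]]] measurable_ennreal)
  also have "\<dots> \<le> ennreal ?c"
  proof (rule Liminf_le)
    show "\<forall>\<^sub>F n in sequentially. (\<integral>\<^sup>+v. ennreal (tent (real n) v) \<partial>\<nu>1) \<le> ennreal ?c"
      using b tent_facts(1) by (intro always_eventually allI) (simp add: nn_integral_eq_integral[OF it[OF p1]] ennreal_leI)
  qed simp
  finally have le: "(\<integral>\<^sup>+v. ennreal \<bar>v\<bar> \<partial>\<nu>1) \<le> ennreal ?c" .
  have m: "(\<lambda>v. \<bar>v\<bar>) \<in> borel_measurable \<nu>1" by (rule borel_prob_measurable[OF p1]) simp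
  show i1: "integrable \<nu>1 (\<lambda>v. \<bar>v\<bar>)"
    using m le by (intro integrableI_bounded) (auto simp: le_less_trans)
  show "(\<integral>v. \<bar>v\<bar> \<partial>\<nu>1) \<le> ?c"
    using le c0 by (simp add: nn_integral_eq_integral[OF i1])
qed

text \<open>
  After subtraction of a constant the function lies between plus and minus the absolute value.
  Truncating it with tents gives compactly supported functions, and the first moment dominates.
\<close>

lemma close_lip1:
  assumes \<psi>: "lip1 \<psi>" and i2: "integrable \<nu>2 (\<lambda>v. \<bar>v\<bar>)"
  shows "\<bar>(\<integral>v. \<psi> v \<partial>\<nu>1) - (\<integral>v. \<psi> v \<partial>\<nu>2)\<bar> \<le> \<Gamma>"
proof -
  define \<zeta> where "\<zeta> v = \<psi> v - \<psi> 0" for v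
  have \<zeta>: "lip1 \<zeta>" using \<psi> by (auto simp: lip1_def \<zeta>_def)
  have \<zeta>v: "\<bar>\<zeta> v\<bar> \<le> \<bar>v\<bar>" for v using lip1D[OF \<psi>, of v 0] by (simp add: \<zeta>_def)
  define \<theta> where "\<theta> n v = max (- tent (real n) v) (min (\<zeta> v) (tent (real n) v))" for n v
  have \<theta>: "lip1 (\<theta> n)" for n unfolding \<theta>_def by (intro lip1_max lip1_min lip1_uminus lip1_tent \<zeta>)
  have \<theta>0: "\<theta> n v = 0" if "2 * real n < \<bar>v\<bar>" for n v using tent_facts(4)[OF that] by (simp add: \<theta>_def)
  have \<theta>b: "\<bar>\<theta> n v\<bar> \<le> \<bar>v\<bar>" for n v using tent_facts(1,2)[of "real n" v] unfolding \<theta>_def by linarith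
  have \<theta>l: "(\<lambda>n. \<theta> n v) \<longlonglongrightarrow> \<zeta> v" for v
  proof (rule tendsto_eventually)
    show "\<forall>\<^sub>F n in sequentially. \<theta> n v = \<zeta> v"
      using eventually_ge_at_top[of "nat \<lceil>\<bar>v\<bar>\<rceil>"]
    proof eventually_elim
      case (elim n)
      then have "\<bar>v\<bar> \<le> real n" by (simp add: nat_ceiling_le_eq)
      then show ?case using \<zeta>v[of v] tent_facts(3)[of v "real n"] unfolding \<theta>_def by linarith
    qed
  qed
  have lim: "(\<lambda>n. \<integral>v. \<theta> n v \<partial>f) \<longlonglongrightarrow> (\<integral>v. \<zeta> v \<partial>f)" "(\<integral>v. \<zeta> v \<partial>f) = (\<integral>v. \<psi> v \<partial>f) - \<psi> 0"
    if f: "f \<in> borel_prob" and i: "integrable f (\<lambda>v. \<bar>v\<bar>)" for f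
  proof -
    show "(\<lambda>n. \<integral>v. \<theta> n v \<partial>f) \<longlonglongrightarrow> (\<integral>v. \<zeta> v \<partial>f)"
      using \<theta>l \<theta>b by (intro integral_dominated_convergence[OF _ _ i] AE_I2)
        (auto intro: borel_prob_measurable[OF f] lip1_measurable \<theta> \<zeta>)
    have ic: "integrable f (\<lambda>_. \<psi> 0)" by (rule borel_prob_integrable_bounded[OF f, of _ "\<bar>\<psi> 0\<bar>"]) auto
    have i\<psi>: "integrable f \<psi>" by (rule lip1_integrable[OF f i \<psi>])
    show "(\<integral>v. \<zeta> v \<partial>f) = (\<integral>v. \<psi> v \<partial>f) - \<psi> 0"
      unfolding \<zeta>_def using i\<psi> ic by (simp add: prob_space.prob_space[OF borel_probD(2)[OF f]])
  qed
  note l1 = lim[OF p1 first_moment_transfer(1)[OF i2]] and l2 = lim[OF p2 i2]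
  have "(\<lambda>n. \<bar>(\<integral>v. \<theta> n v \<partial>\<nu>1) - (\<integral>v. \<theta> n v \<partial>\<nu>2)\<bar>) \<longlonglongrightarrow> \<bar>(\<integral>v. \<zeta> v \<partial>\<nu>1) - (\<integral>v. \<zeta> v \<partial>\<nu>2)\<bar>"
    by (intro tendsto_rabs tendsto_diff l1(1) l2(1))
  then have "\<bar>(\<integral>v. \<zeta> v \<partial>\<nu>1) - (\<integral>v. \<zeta> v \<partial>\<nu>2)\<bar> \<le> \<Gamma>"
    by (rule LIMSEQ_le_const2) (use close_lip1_compact[OF \<theta> \<theta>0] in auto)
  then show ?thesis using l1(2) l2(2) by simp
qed

end

section \<open>Local lower bound for the transport cost\<close>

text \<open>
  Twice the kinetic energy that the nonlocal gradient of a potential with derivative \<open>p\<close>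
  carries; it is the quantity dual to the action.
\<close>

definition kinetic :: "real \<Rightarrow> (real \<Rightarrow> real) \<Rightarrow> real measure \<Rightarrow> real" where
  "kinetic e p f = (\<integral>z. sigma_e e \<bar>fst z - snd z\<bar> * (p (snd z) - p (fst z))\<^sup>2 \<partial>(f \<Otimes>\<^sub>M f))"

lemma integrable_prod_fst_snd:
  assumes f: "f \<in> borel_prob" and h: "integrable f h"
  shows "integrable (f \<Otimes>\<^sub>M f) (\<lambda>z. h (fst z))" "integrable (f \<Otimes>\<^sub>M f) (\<lambda>z. h (snd z))"
    "(\<integral>z. h (fst z) \<partial>(f \<Otimes>\<^sub>M f)) = (\<integral>v. h v \<partial>f)" "(\<integral>z. h (snd z) \<partial>(f \<Otimes>\<^sub>M f)) = ((\<integral>v. h v \<partial>f)::real)"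
proof -
  interpret P: prob_space f by (rule borel_probD[OF f])
  interpret Q: pair_prob_space f f ..
  have d1: "distr (f \<Otimes>\<^sub>M f) f fst = f" by (rule P.distr_pair_fst)
  have d2: "distr (f \<Otimes>\<^sub>M f) f snd = f"
  proof (rule measure_eqI)
    fix A assume "A \<in> sets (distr (f \<Otimes>\<^sub>M f) f snd)"
    then have A: "A \<in> sets f" by simp
    then have "snd -` A \<inter> space (f \<Otimes>\<^sub>M f) = space f \<times> A"
      using sets.sets_into_space[OF A] by (auto simp: space_pair_measure)
    then show "emeasure (distr (f \<Otimes>\<^sub>M f) f snd) A = emeasure f A"
      using A by (simp add: emeasure_distr P.emeasure_pair_measure_Times P.emeasure_space_1)
  qed simp
  show "integrable (f \<Otimes>\<^sub>M f) (\<lambda>z. h (fst z))" by (subst integrable_distr_eq[symmetric, of fst _ f]) (use h d1 in auto)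
  show "integrable (f \<Otimes>\<^sub>M f) (\<lambda>z. h (snd z))" by (subst integrable_distr_eq[symmetric, of snd _ f]) (use h d2 in auto)
  show "(\<integral>z. h (fst z) \<partial>(f \<Otimes>\<^sub>M f)) = (\<integral>v. h v \<partial>f)" by (subst integral_distr[symmetric, of fst _ f]) (use h d1 in auto)
  show "(\<integral>z. h (snd z) \<partial>(f \<Otimes>\<^sub>M f)) = (\<integral>v. h v \<partial>f)" by (subst integral_distr[symmetric, of snd _ f]) (use h d2 in auto)
qed

lemma borel_measurable_prod_borel_prob:
  "f \<in> borel_prob \<Longrightarrow> h \<in> borel_measurable borel \<Longrightarrow> h \<in> borel_measurable (f \<Otimes>\<^sub>M f)"
  using sets_prod_borel_prob by (simp cong: measurable_cong_sets)

lemma nn_integral_tensor: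
  assumes f: "f \<in> borel_prob" and d: "\<And>z. z \<notin> offdiag \<Longrightarrow> h z = 0"
  shows "(\<integral>\<^sup>+z. h z \<partial>tensor f) = (\<integral>\<^sup>+z. h z \<partial>(f \<Otimes>\<^sub>M f))"
proof -
  have "(\<integral>\<^sup>+z. h z \<partial>tensor f) = (\<integral>\<^sup>+z. h z * indicator offdiag z \<partial>(f \<Otimes>\<^sub>M f))"
    unfolding tensor_def using offdiag_sets sets_prod_borel_prob[OF f] 
    by (intro nn_integral_restrict_space) (metis sets.Int sets.top)
  also have "\<dots> = (\<integral>\<^sup>+z. h z \<partial>(f \<Otimes>\<^sub>M f))"
    using d by (intro nn_integral_cong) (auto simp: indicator_def)
  finally show ?thesis .
qed

lemma sigma_e_bounds:
  assumes "0 \<le> e" "e < 1" "0 \<le> r" shows "0 \<le> sigma_e e r" "sigma_e e r \<le> r / 4"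
  using assms mult_right_mono[of "1 - e" 1 r] by (auto simp: sigma_e_def)

lemma kinetic_bounded:
  assumes e: "0 \<le> e" "e < 1" and f: "f \<in> borel_prob" and i: "integrable f (\<lambda>v. \<bar>v\<bar>)"
    and p: "continuous_on UNIV p" "\<And>v. \<bar>p v\<bar> \<le> P"
  shows "integrable (f \<Otimes>\<^sub>M f) (\<lambda>z. sigma_e e \<bar>fst z - snd z\<bar> * (p (snd z) - p (fst z))\<^sup>2)"
    "0 \<le> kinetic e p f" "kinetic e p f \<le> 2 * P\<^sup>2 * (\<integral>v. \<bar>v\<bar> \<partial>f)"
    "(\<integral>\<^sup>+z. ennreal (sigma_e e \<bar>fst z - snd z\<bar> * (p (snd z) - p (fst z))\<^sup>2) \<partial>tensor f) = ennreal (kinetic e p f)"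
proof -
  let ?k = "\<lambda>z. sigma_e e \<bar>fst z - snd z\<bar> * (p (snd z) - p (fst z))\<^sup>2"
  have m: "?k \<in> borel_measurable (f \<Otimes>\<^sub>M f)"
    unfolding sigma_e_def
    by (intro borel_measurable_prod_borel_prob f borel_measurable_continuous_onI continuous_intros
        continuous_on_compose2[OF p(1)]) auto
  have k0: "0 \<le> ?k z" for z using sigma_e_bounds[OF e] by simp
  have kb: "?k z \<le> P\<^sup>2 * \<bar>fst z\<bar> + P\<^sup>2 * \<bar>snd z\<bar>" for z
  proof -
    have "\<bar>p (snd z) - p (fst z)\<bar> \<le> 2 * P" using p(2)[of "snd z"] p(2)[of "fst z"] by linarith
    then have "(p (snd z) - p (fst z))\<^sup>2 \<le> (2 * P)\<^sup>2" by (metis abs_ge_zero power2_abs power_mono)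
    moreover have "sigma_e e \<bar>fst z - snd z\<bar> \<le> (\<bar>fst z\<bar> + \<bar>snd z\<bar>) / 4"
    proof -
      have "sigma_e e \<bar>fst z - snd z\<bar> \<le> \<bar>fst z - snd z\<bar> / 4" by (rule sigma_e_bounds(2)[OF e]) simp
      also have "\<dots> \<le> (\<bar>fst z\<bar> + \<bar>snd z\<bar>) / 4" by (intro divide_right_mono abs_triangle_ineq4) simp
      finally show ?thesis .
    qed
    ultimately have "?k z \<le> (\<bar>fst z\<bar> + \<bar>snd z\<bar>) / 4 * (2 * P)\<^sup>2"
      by (intro mult_mono) (auto simp: add_nonneg_nonneg)
    then show ?thesis by (simp add: power2_eq_square algebra_simps)
  qed
  note I = integrable_prod_fst_snd[OF f i]
  have ib: "integrable (f \<Otimes>\<^sub>M f) (\<lambda>z. P\<^sup>2 * \<bar>fst z\<bar> + P\<^sup>2 * \<bar>snd z\<bar>)" using I by auto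
  show ik: "integrable (f \<Otimes>\<^sub>M f) ?k"
  proof (rule Bochner_Integration.integrable_bound[OF ib m], rule AE_I2)
    fix z show "norm (?k z) \<le> norm (P\<^sup>2 * \<bar>fst z\<bar> + P\<^sup>2 * \<bar>snd z\<bar>)" using k0[of z] kb[of z] by simp
  qed
  show "0 \<le> kinetic e p f" unfolding kinetic_def by (rule integral_nonneg_AE) (use k0 in auto)
  have "kinetic e p f \<le> (\<integral>z. P\<^sup>2 * \<bar>fst z\<bar> + P\<^sup>2 * \<bar>snd z\<bar> \<partial>(f \<Otimes>\<^sub>M f))"
    unfolding kinetic_def by (rule integral_mono[OF ik ib]) (rule kb)
  also have "\<dots> = 2 * P\<^sup>2 * (\<integral>v. \<bar>v\<bar> \<partial>f)" using I by simp
  finally show "kinetic e p f \<le> 2 * P\<^sup>2 * (\<integral>v. \<bar>v\<bar> \<partial>f)" .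
  have "(\<integral>\<^sup>+z. ennreal (?k z) \<partial>tensor f) = (\<integral>\<^sup>+z. ennreal (?k z) \<partial>(f \<Otimes>\<^sub>M f))"
    by (rule nn_integral_tensor[OF f]) (auto simp: offdiag_def sigma_e_def)
  also have "\<dots> = ennreal (kinetic e p f)"
    unfolding kinetic_def using k0 by (intro nn_integral_eq_integral ik) auto
  finally show "(\<integral>\<^sup>+z. ennreal (?k z) \<partial>tensor f) = ennreal (kinetic e p f)" .
qed

lemma emeasure_lebesgue_unit: "emeasure (lebesgue_on {0..1::real}) (space (lebesgue_on {0..1::real})) = 1"
  by (simp add: emeasure_restrict_space space_restrict_space)

text \<open>
  The increment of a test integral is at most the tested flux, and Cauchy--Schwarz in velocity and
  then in time separates the action from the kinetic term.
\<close>

lemma CE_speed: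
  assumes e: "0 \<le> e" "e < 1" and CE: "(f, U) \<in> CE e 1" and \<psi>: "C1c \<psi>" and C: "C > 0"
    and P: "\<And>v. \<bar>deriv \<psi> v\<bar> \<le> P"
    and i: "\<And>s. s \<in> {0..1} \<Longrightarrow> integrable (f s) (\<lambda>v. \<bar>v\<bar>)"
    and kin: "\<And>s. s \<in> {0..1} \<Longrightarrow> kinetic e (deriv \<psi>) (f s) \<le> C"
    and b: "0 \<le> b" "(\<integral>\<^sup>+t. action e (f t) (U t) \<partial>lebesgue_on {0..1}) \<le> ennreal b"
    and s: "s \<in> {0..1}" "s' \<in> {0..1}"
  shows "((\<integral>v. \<psi> v \<partial>f s) - (\<integral>v. \<psi> v \<partial>f s'))\<^sup>2 \<le> b * C"
proof -
  have c: "continuous_on UNIV (deriv \<psi>)" using \<psi> by (simp add: C1c_def)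
  have gm: "nonlocal_grad \<psi> \<in> borel_measurable offdiag_borel"
    unfolding nonlocal_grad_def split_beta
    by (intro borel_measurable_offdiag_borel borel_measurable_continuous_onI continuous_intros
        continuous_on_compose2[OF c]) auto
  let ?h = "\<lambda>t. \<integral>\<^sup>+p. ennreal \<bar>sigma_e e \<bar>fst p - snd p\<bar> * nonlocal_grad \<psi> p\<bar> \<partial>tot_variation offdiag_borel (U t)"
  let ?d = "(\<integral>v. \<psi> v \<partial>f s) - (\<integral>v. \<psi> v \<partial>f s')"
  have "(\<integral>\<^sup>+t. ?h t \<partial>lebesgue_on {0..1})\<^sup>2 \<le> (\<integral>\<^sup>+t. action e (f t) (U t) \<partial>lebesgue_on {0..1}) * ennreal C"
  proof (rule lower_integral_Cauchy_Schwarz[OF emeasure_lebesgue_unit C])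
    fix t assume "t \<in> space (lebesgue_on {0..1::real})"
    then have t: "t \<in> {0..1}" by (simp add: space_restrict_space)
    have ft: "f t \<in> borel_prob" by (rule CE_D(1)[OF CE t])
    have "(\<integral>\<^sup>+p. ennreal (sigma_e e \<bar>fst p - snd p\<bar> * (nonlocal_grad \<psi> p)\<^sup>2) \<partial>tensor (f t)) = ennreal (kinetic e (deriv \<psi>) (f t))"
      using kinetic_bounded(4)[OF e ft i[OF t] c P] by (simp add: nonlocal_grad_def split_beta)
    also have "\<dots> \<le> ennreal C" by (intro ennreal_leI kin t)
    finally show "(?h t)\<^sup>2 \<le> action e (f t) (U t) * ennreal C"
      by (intro flux_bound_by_action e ft CE_D(2)[OF CE t] gm C)
  qed
  also have "\<dots> \<le> ennreal b * ennreal C" by (intro mult_right_mono b) simp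
  finally have "(\<integral>\<^sup>+t. ?h t \<partial>lebesgue_on {0..1})\<^sup>2 \<le> ennreal (b * C)" using b C by (simp add: ennreal_mult)
  moreover have "(ennreal \<bar>?d\<bar>)\<^sup>2 \<le> (\<integral>\<^sup>+t. ?h t \<partial>lebesgue_on {0..1})\<^sup>2"
    by (intro power_mono CE_increment[OF CE \<psi> s]) simp
  ultimately have "(ennreal \<bar>?d\<bar>)\<^sup>2 \<le> ennreal (b * C)" by (rule order_trans[rotated])
  then show ?thesis using b C by (simp add: ennreal_power)
qed

text \<open>
  Finiteness comes from the integrability of the flux that is part of the continuity equation; this
  bound depends on the competitor and is only a starting point.
\<close>

lemma CE_first_moment_finite:
  assumes e: "0 \<le> e" "e < 1" and CE: "(f, U) \<in> CE e 1" and i: "integrable (f 1) (\<lambda>v. \<bar>v\<bar>)"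
  shows "\<exists>K. \<forall>s\<in>{0..1}. integrable (f s) (\<lambda>v. \<bar>v\<bar>) \<and> (\<integral>v. \<bar>v\<bar> \<partial>f s) \<le> K"
proof -
  let ?G = "\<integral>\<^sup>+t. (\<integral>\<^sup>+p. ennreal (sigma_e e \<bar>fst p - snd p\<bar>) \<partial>tot_variation offdiag_borel (U t)) \<partial>lebesgue_on {0..1}"
  have G: "?G < \<infinity>" by (rule CE_D(4)[OF CE])
  have main: "integrable (f s) (\<lambda>v. \<bar>v\<bar>) \<and> (\<integral>v. \<bar>v\<bar> \<partial>f s) \<le> (\<integral>v. \<bar>v\<bar> \<partial>f 1) + 2 * enn2real ?G" if s: "s \<in> {0..1}" for s
  proof -
    interpret close_measures "f s" "f 1" "2 * enn2real ?G"
    proof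
      show "f s \<in> borel_prob" "f 1 \<in> borel_prob" using CE_D(1)[OF CE] s by auto
      fix \<psi> assume \<psi>: "C1c \<psi>" "\<And>v. \<bar>deriv \<psi> v\<bar> \<le> 1"
      obtain L where L: "\<And>v. L < \<bar>v\<bar> \<Longrightarrow> \<psi> v = 0" using \<psi>(1) unfolding C1c_def by auto
      have dh: "((\<lambda>v. \<psi> v / 2) has_real_derivative deriv \<psi> v / 2) (at v)" for v
        using \<psi>(1) unfolding C1c_def by (intro DERIV_cdivide) (auto simp: DERIV_deriv_iff_real_differentiable)
      have ch: "continuous_on UNIV (\<lambda>v. deriv \<psi> v / 2)"
        using \<psi>(1) unfolding C1c_def by (intro continuous_on_divide continuous_on_const) auto
      have zh: "\<psi> v / 2 = 0" if "L < \<bar>v\<bar>" for v using L[OF that] by simp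
      have h: "C1c (\<lambda>v. \<psi> v / 2)" "deriv (\<lambda>v. \<psi> v / 2) = (\<lambda>v. deriv \<psi> v / 2)"
        using C1cI[of "\<lambda>v. \<psi> v / 2" "\<lambda>v. deriv \<psi> v / 2" L] dh ch zh by blast+
      have "ennreal \<bar>(\<integral>v. \<psi> v / 2 \<partial>f s) - (\<integral>v. \<psi> v / 2 \<partial>f 1)\<bar> \<le>
        (\<integral>\<^sup>+t. (\<integral>\<^sup>+p. ennreal \<bar>sigma_e e \<bar>fst p - snd p\<bar> * nonlocal_grad (\<lambda>v. \<psi> v / 2) p\<bar>
          \<partial>tot_variation offdiag_borel (U t)) \<partial>lebesgue_on {0..1})"
        using s by (intro CE_increment[OF CE h(1)]) auto
      also have "\<dots> \<le> ?G"
      proof (intro nn_integral_mono ennreal_leI)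
        fix p :: "real \<times> real"
        have "\<bar>nonlocal_grad (\<lambda>v. \<psi> v / 2) p\<bar> \<le> 1"
          using \<psi>(2)[of "fst p"] \<psi>(2)[of "snd p"] unfolding nonlocal_grad_def h(2) split_beta by linarith
        then have "\<bar>sigma_e e \<bar>fst p - snd p\<bar>\<bar> * \<bar>nonlocal_grad (\<lambda>v. \<psi> v / 2) p\<bar> \<le> \<bar>sigma_e e \<bar>fst p - snd p\<bar>\<bar> * 1"
          by (intro mult_left_mono) auto
        then show "\<bar>sigma_e e \<bar>fst p - snd p\<bar> * nonlocal_grad (\<lambda>v. \<psi> v / 2) p\<bar> \<le> sigma_e e \<bar>fst p - snd p\<bar>"
          using sigma_e_bounds(1)[OF e, of "\<bar>fst p - snd p\<bar>"] by (simp add: abs_mult)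
      qed
      finally have "\<bar>(\<integral>v. \<psi> v / 2 \<partial>f s) - (\<integral>v. \<psi> v / 2 \<partial>f 1)\<bar> \<le> enn2real ?G"
        using G by (cases ?G) auto
      then show "\<bar>(\<integral>v. \<psi> v \<partial>f s) - (\<integral>v. \<psi> v \<partial>f 1)\<bar> \<le> 2 * enn2real ?G" by simp
    qed
    show ?thesis using first_moment_transfer[OF i] by simp
  qed
  then show ?thesis by blast
qed

text \<open>
  The kinetic term grows with the first moment, and the first moment is moved at a speed given by
  the square root of the kinetic term; the resulting square-root inequality bounds the first
  moment uniformly over all competitors of cost at most one.
\<close>

lemma CE_first_moment_bound:
  assumes e: "0 \<le> e" "e < 1" and CE: "(f, U) \<in> CE e 1" and i: "integrable (f 1) (\<lambda>v. \<bar>v\<bar>)"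
    and M: "(\<integral>v. \<bar>v\<bar> \<partial>f 1) \<le> M"
    and b: "0 \<le> b" "b \<le> 1" "(\<integral>\<^sup>+t. action e (f t) (U t) \<partial>lebesgue_on {0..1}) \<le> ennreal b"
    and s: "s \<in> {0..1}"
  shows "integrable (f s) (\<lambda>v. \<bar>v\<bar>)" "(\<integral>v. \<bar>v\<bar> \<partial>f s) \<le> 2 * M + 3"
    "close_measures (f s) (f 1) (sqrt (b * (4 * M + 8)))"
proof -
  define m where "m s = (\<integral>v. \<bar>v\<bar> \<partial>f s)" for s
  obtain K0 where K0: "\<And>s. s \<in> {0..1} \<Longrightarrow> integrable (f s) (\<lambda>v. \<bar>v\<bar>)" "\<And>s. s \<in> {0..1} \<Longrightarrow> m s \<le> K0"
    using CE_first_moment_finite[OF e CE i] unfolding m_def by blast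
  have bdd: "bdd_above (m ` {0..1})" using K0(2) by (intro bdd_aboveI2)
  have m0: "0 \<le> m s" for s unfolding m_def by (rule integral_nonneg_AE) auto
  have cl: "close_measures (f s) (f 1) (sqrt (b * (2 * (K + 1))))"
    if K: "\<And>s. s \<in> {0..1} \<Longrightarrow> m s \<le> K" and s: "s \<in> {0..1}" for K s
  proof
    have Kpos: "0 \<le> K" using K[OF s] m0[of s] by linarith
    show "f s \<in> borel_prob" "f 1 \<in> borel_prob" using CE_D(1)[OF CE] s by auto
    fix \<psi> assume \<psi>: "C1c \<psi>" "\<And>v. \<bar>deriv \<psi> v\<bar> \<le> 1"
    have c: "continuous_on UNIV (deriv \<psi>)" using \<psi> by (simp add: C1c_def)
    have "((\<integral>v. \<psi> v \<partial>f s) - (\<integral>v. \<psi> v \<partial>f 1))\<^sup>2 \<le> b * (2 * (K + 1))"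
    proof (rule CE_speed[OF e CE \<psi>(1) _ \<psi>(2) K0(1) _ b(1,3) s])
      show "0 < 2 * (K + 1)" using Kpos by simp
      fix r :: real assume r: "r \<in> {0..1}"
      have "kinetic e (deriv \<psi>) (f r) \<le> 2 * 1\<^sup>2 * m r"
        unfolding m_def by (rule kinetic_bounded(3)[OF e CE_D(1)[OF CE r] K0(1)[OF r] c \<psi>(2)])
      then show "kinetic e (deriv \<psi>) (f r) \<le> 2 * (K + 1)" using K[OF r] by simp
    qed auto
    then show "\<bar>(\<integral>v. \<psi> v \<partial>f s) - (\<integral>v. \<psi> v \<partial>f 1)\<bar> \<le> sqrt (b * (2 * (K + 1)))"
      by (metis real_sqrt_abs real_sqrt_le_mono)
  qed
  \<comment> \<open>the supremum of the first moments is finite, so an inequality for it can be absorbed\<close>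
  define K where "K = Sup (m ` {0..1})"
  have mK: "m s \<le> K" if "s \<in> {0..1}" for s unfolding K_def using that bdd by (intro cSUP_upper) auto
  have "m s \<le> M + (K + 3) / 2" if s: "s \<in> {0..1}" for s
  proof -
    interpret close_measures "f s" "f 1" "sqrt (b * (2 * (K + 1)))" by (rule cl[OF mK s])
    have Kpos: "0 \<le> K" using mK[OF s] m0[of s] by linarith
    have "sqrt (b * (2 * (K + 1))) \<le> sqrt (2 * (K + 1))"
      using b Kpos by (intro real_sqrt_le_mono mult_left_le_one_le) auto
    also have "\<dots> \<le> (2 + (K + 1)) / 2" using Kpos by (intro arith_geo_mean_sqrt) auto
    finally show ?thesis using first_moment_transfer(2)[OF i] M unfolding m_def by (simp add: field_simps)
  qed
  then have "K \<le> M + (K + 3) / 2" unfolding K_def by (intro cSUP_least) (auto simp: image_image)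
  then have K: "K \<le> 2 * M + 3" by (simp add: field_simps)
  show "integrable (f s) (\<lambda>v. \<bar>v\<bar>)" by (rule K0(1)[OF s])
  have mM: "m r \<le> 2 * M + 3" if "r \<in> {0..1}" for r using mK[OF that] K by simp
  show "(\<integral>v. \<bar>v\<bar> \<partial>f s) \<le> 2 * M + 3" using mM[OF s] by (simp add: m_def)
  have eq: "4 * M + 8 = 2 * (2 * M + 3 + 1)" by simp
  show "close_measures (f s) (f 1) (sqrt (b * (4 * M + 8)))" unfolding eq by (rule cl[OF mM s])
qed


text \<open>
  The kernel grows linearly in one variable, so its Lipschitz constant in the other one has to depend
  on that variable. If both varied points lie outside the support of \<open>p\<close>, only the
  distance factor changes; otherwise one of them lies in the support and bounds the distance factor.
\<close>

lemma kinetic_kernel_lipschitz: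
  assumes e: "0 \<le> e" "e < 1" and p: "lip1 p" "\<And>v. \<bar>p v\<bar> \<le> P" and L: "0 \<le> L" "\<And>v. L < \<bar>v\<bar> \<Longrightarrow> p v = 0"
  shows "\<bar>sigma_e e \<bar>v - w\<bar> * (p w - p v)\<^sup>2 - sigma_e e \<bar>v - w'\<bar> * (p w' - p v)\<^sup>2\<bar>
    \<le> (P\<^sup>2 + P * (\<bar>v\<bar> + L)) * \<bar>w - w'\<bar>"
proof -
  have P0: "0 \<le> P" using p(2)[of 0] by linarith
  define q where "q w = p w - p v" for w
  define B where "B = \<bar>v\<bar> + L"
  have B0: "0 \<le> B" using L by (simp add: B_def)
  have qb: "\<bar>q w\<bar> \<le> 2 * P" for w using p(2)[of w] p(2)[of v] unfolding q_def by linarith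
  have ql: "\<bar>q w - q w'\<bar> \<le> \<bar>w - w'\<bar>" for w w' using lip1D[OF p(1), of w w'] by (simp add: q_def)
  have main: "\<bar>\<bar>v - w\<bar> * (q w)\<^sup>2 - \<bar>v - w'\<bar> * (q w')\<^sup>2\<bar> \<le> (4 * P\<^sup>2 + 4 * P * B) * \<bar>w - w'\<bar>"
    if c: "\<bar>w'\<bar> \<le> L \<or> L < \<bar>w\<bar>" for w w'
  proof -
    have 1: "\<bar>(\<bar>v - w\<bar> - \<bar>v - w'\<bar>) * (q w)\<^sup>2\<bar> \<le> \<bar>w - w'\<bar> * (4 * P\<^sup>2)"
    proof -
      have "\<bar>q w\<bar>\<^sup>2 \<le> (2 * P)\<^sup>2" by (intro power_mono qb) simp
      then have "(q w)\<^sup>2 \<le> 4 * P\<^sup>2" by (simp add: power_mult_distrib)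
      moreover have "\<bar>\<bar>v - w\<bar> - \<bar>v - w'\<bar>\<bar> \<le> \<bar>w - w'\<bar>" by linarith
      ultimately show ?thesis unfolding abs_mult by (intro mult_mono) auto
    qed
    have 2: "\<bar>\<bar>v - w'\<bar> * ((q w)\<^sup>2 - (q w')\<^sup>2)\<bar> \<le> B * (\<bar>w - w'\<bar> * (4 * P))"
    proof (cases "\<bar>w'\<bar> \<le> L")
      case True
      then have "\<bar>v - w'\<bar> \<le> B" unfolding B_def by linarith
      moreover have "\<bar>(q w)\<^sup>2 - (q w')\<^sup>2\<bar> \<le> \<bar>w - w'\<bar> * (4 * P)"
      proof -
        have "(q w)\<^sup>2 - (q w')\<^sup>2 = (q w - q w') * (q w + q w')" by (simp add: power2_eq_square algebra_simps)
        moreover have "\<bar>q w + q w'\<bar> \<le> 4 * P" using qb[of w] qb[of w'] by linarith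
        ultimately show ?thesis using ql[of w w'] by (simp only: abs_mult) (intro mult_mono; simp)
      qed
      ultimately show ?thesis unfolding abs_mult abs_abs using B0 by (intro mult_mono) auto
    next
      case False
      then have "q w = q w'" using c L(2)[of w] L(2)[of w'] by (simp add: q_def)
      then show ?thesis using B0 P0 by simp
    qed
    have "\<bar>v - w\<bar> * (q w)\<^sup>2 - \<bar>v - w'\<bar> * (q w')\<^sup>2 = (\<bar>v - w\<bar> - \<bar>v - w'\<bar>) * (q w)\<^sup>2 + \<bar>v - w'\<bar> * ((q w)\<^sup>2 - (q w')\<^sup>2)"
      by (simp add: algebra_simps)
    also have "\<bar>\<dots>\<bar> \<le> \<bar>w - w'\<bar> * (4 * P\<^sup>2) + B * (\<bar>w - w'\<bar> * (4 * P))"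
      using 1 2 by (rule order_trans[OF abs_triangle_ineq add_mono])
    also have "\<dots> = (4 * P\<^sup>2 + 4 * P * B) * \<bar>w - w'\<bar>" by (simp add: algebra_simps)
    finally show ?thesis .
  qed
  have all: "\<bar>\<bar>v - w\<bar> * (q w)\<^sup>2 - \<bar>v - w'\<bar> * (q w')\<^sup>2\<bar> \<le> (4 * P\<^sup>2 + 4 * P * B) * \<bar>w - w'\<bar>"
  proof (cases "\<bar>w'\<bar> \<le> L \<or> L < \<bar>w\<bar>")
    case True then show ?thesis by (rule main)
  next
    case False
    then show ?thesis using main[of w w'] by (simp add: abs_minus_commute)
  qed
  have "\<bar>sigma_e e \<bar>v - w\<bar> * (p w - p v)\<^sup>2 - sigma_e e \<bar>v - w'\<bar> * (p w' - p v)\<^sup>2\<bar>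
      = (1 - e) / 4 * \<bar>\<bar>v - w\<bar> * (q w)\<^sup>2 - \<bar>v - w'\<bar> * (q w')\<^sup>2\<bar>"
  proof -
    have "sigma_e e \<bar>v - w\<bar> * (p w - p v)\<^sup>2 - sigma_e e \<bar>v - w'\<bar> * (p w' - p v)\<^sup>2
        = (1 - e) / 4 * (\<bar>v - w\<bar> * (q w)\<^sup>2 - \<bar>v - w'\<bar> * (q w')\<^sup>2)"
      unfolding sigma_e_def q_def right_diff_distrib by (simp only: mult.assoc)
    moreover have "\<bar>(1 - e) / 4\<bar> = (1 - e) / 4" using e by (intro abs_of_nonneg) simp
    ultimately show ?thesis by (simp only: abs_mult)
  qed
  also have "\<dots> \<le> 1 / 4 * ((4 * P\<^sup>2 + 4 * P * B) * \<bar>w - w'\<bar>)"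
    using e by (intro mult_mono all) auto
  finally show ?thesis by (simp add: B_def algebra_simps)
qed

lemma (in close_measures) close_scaled:
  assumes h: "\<And>x y. \<bar>h x - h y\<bar> \<le> A * \<bar>x - y\<bar>" and A: "A > 0" and i2: "integrable \<nu>2 (\<lambda>v. \<bar>v\<bar>)"
  shows "integrable \<nu>1 h" "integrable \<nu>2 h" "\<bar>(\<integral>v. h v \<partial>\<nu>1) - (\<integral>v. h v \<partial>\<nu>2)\<bar> \<le> A * \<Gamma>"
proof -
  have l: "lip1 (\<lambda>v. h v / A)"
    unfolding lip1_def using h A by (simp add: diff_divide_distrib[symmetric] pos_divide_le_eq mult.commute)
  have "integrable \<nu>1 (\<lambda>v. A * (h v / A))" "integrable \<nu>2 (\<lambda>v. A * (h v / A))"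
    by (intro integrable_mult_right lip1_integrable[OF p1 first_moment_transfer(1)[OF i2] l] lip1_integrable[OF p2 i2 l])+
  then show "integrable \<nu>1 h" "integrable \<nu>2 h" using A by simp_all
  have "\<bar>(\<integral>v. h v / A \<partial>\<nu>1) - (\<integral>v. h v / A \<partial>\<nu>2)\<bar> \<le> \<Gamma>" by (rule close_lip1[OF l i2])
  then have "\<bar>((\<integral>v. h v \<partial>\<nu>1) - (\<integral>v. h v \<partial>\<nu>2)) / A\<bar> \<le> \<Gamma>" by (simp add: diff_divide_distrib)
  then show "\<bar>(\<integral>v. h v \<partial>\<nu>1) - (\<integral>v. h v \<partial>\<nu>2)\<bar> \<le> A * \<Gamma>"
    using A by (simp add: abs_divide pos_divide_le_eq mult.commute)
qed

lemma kinetic_iterated: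
  assumes e: "0 \<le> e" "e < 1" and f: "f \<in> borel_prob" and i: "integrable f (\<lambda>v. \<bar>v\<bar>)"
    and p: "continuous_on UNIV p" "\<And>v. \<bar>p v\<bar> \<le> P"
  shows "kinetic e p f = (\<integral>v. (\<integral>w. sigma_e e \<bar>v - w\<bar> * (p w - p v)\<^sup>2 \<partial>f) \<partial>f)"
proof -
  interpret P: prob_space f by (rule borel_probD[OF f])
  interpret Q: pair_prob_space f f ..
  show ?thesis
    using Q.integral_fst'[OF kinetic_bounded(1)[OF e f i p]] by (simp add: kinetic_def)
qed

text \<open>
  The kinetic term is an iterated integral of a symmetric kernel that is Lipschitz in each variable,
  and the two measures are exchanged one variable at a time.
\<close>

lemma (in close_measures) kinetic_close:
  assumes e: "0 \<le> e" "e < 1" and i2: "integrable \<nu>2 (\<lambda>v. \<bar>v\<bar>)"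
    and K: "(\<integral>v. \<bar>v\<bar> \<partial>\<nu>1) \<le> K" "(\<integral>v. \<bar>v\<bar> \<partial>\<nu>2) \<le> K"
    and p: "lip1 p" "\<And>v. \<bar>p v\<bar> \<le> P" and L: "0 \<le> L" "\<And>v. L < \<bar>v\<bar> \<Longrightarrow> p v = 0"
  shows "kinetic e p \<nu>1 \<le> kinetic e p \<nu>2 + 2 * (P\<^sup>2 + P * L + 1 + P * K) * \<Gamma>"
proof -
  have P0: "0 \<le> P" using p(2)[of 0] by linarith
  have G0: "0 \<le> \<Gamma>" using close_lip1_compact[of "\<lambda>_. 0" 0] lip1_const[of 0] by simp
  note i1 = first_moment_transfer(1)[OF i2]
  note cp = lip1_continuous[OF p(1), of UNIV]
  define A where "A = P\<^sup>2 + P * L + 1"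
  have A0: "0 < A" using P0 L by (simp add: A_def add_nonneg_pos)
  let ?k = "\<lambda>v w. sigma_e e \<bar>v - w\<bar> * (p w - p v)\<^sup>2"
  have sym: "?k v w = ?k w v" for v w by (simp add: abs_minus_commute power2_commute)
  have lip: "\<bar>?k v w - ?k v w'\<bar> \<le> (A + P * \<bar>v\<bar>) * \<bar>w - w'\<bar>" for v w w'
  proof -
    have "\<bar>?k v w - ?k v w'\<bar> \<le> (P\<^sup>2 + P * (\<bar>v\<bar> + L)) * \<bar>w - w'\<bar>"
      by (rule kinetic_kernel_lipschitz[OF e p L])
    also have "\<dots> \<le> (A + P * \<bar>v\<bar>) * \<bar>w - w'\<bar>"
      by (intro mult_right_mono) (auto simp: A_def algebra_simps)
    finally show ?thesis .
  qed
  have Av: "0 < A + P * \<bar>v\<bar>" for v using A0 P0 by (simp add: add_pos_nonneg)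
  have K0: "0 \<le> K" using abs_moment_nonneg K(2) by (rule order_trans)
  define J where "J \<nu> v = (\<integral>w. ?k v w \<partial>\<nu>)" for \<nu> :: "real measure" and v
  note S = close_scaled[OF lip Av i2]
  have J12: "\<bar>J \<nu>1 v - J \<nu>2 v\<bar> \<le> (A + P * \<bar>v\<bar>) * \<Gamma>" for v unfolding J_def by (rule S(3))
  have J2lip: "\<bar>J \<nu>2 v - J \<nu>2 v'\<bar> \<le> (A + P * K) * \<bar>v - v'\<bar>" for v v'
  proof -
    have iA: "integrable \<nu>2 (\<lambda>w. (A + P * \<bar>w\<bar>) * \<bar>v - v'\<bar>)"
      by (intro integrable_mult_left Bochner_Integration.integrable_add integrable_mult_right i2 borel_prob_integrable_bounded[OF p2, of _ "\<bar>A\<bar>"]) auto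
    have "\<bar>J \<nu>2 v - J \<nu>2 v'\<bar> = \<bar>\<integral>w. ?k v w - ?k v' w \<partial>\<nu>2\<bar>"
      unfolding J_def by (simp add: Bochner_Integration.integral_diff[OF S(2) S(2)])
    also have "\<dots> \<le> (\<integral>w. \<bar>?k v w - ?k v' w\<bar> \<partial>\<nu>2)" by (rule integral_abs_bound)
    also have "\<dots> \<le> (\<integral>w. (A + P * \<bar>w\<bar>) * \<bar>v - v'\<bar> \<partial>\<nu>2)"
    proof (rule integral_mono[OF _ iA])
      show "integrable \<nu>2 (\<lambda>w. \<bar>?k v w - ?k v' w\<bar>)"
        by (intro integrable_abs Bochner_Integration.integrable_diff S(2))
      show "\<bar>?k v w - ?k v' w\<bar> \<le> (A + P * \<bar>w\<bar>) * \<bar>v - v'\<bar>" for w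
        unfolding sym[of v w] sym[of v' w] by (rule lip)
    qed
    also have "\<dots> = (A + P * (\<integral>v. \<bar>v\<bar> \<partial>\<nu>2)) * \<bar>v - v'\<bar>"
      using i2 by (simp add: prob_space.prob_space[OF borel_probD(2)[OF p2]] prob_space.finite_measure[OF borel_probD(2)[OF p2], THEN finite_measure.integrable_const])
    also have "\<dots> \<le> (A + P * K) * \<bar>v - v'\<bar>"
      using K P0 by (intro mult_right_mono add_left_mono mult_left_mono) auto
    finally show ?thesis .
  qed
  have AK: "0 < A + P * K" using A0 P0 K0 by (simp add: add_pos_nonneg)
  note T = close_scaled[OF J2lip AK i2]
  have i1A: "integrable \<nu>1 (\<lambda>v. (A + P * \<bar>v\<bar>) * \<Gamma>)"
    by (intro integrable_mult_left Bochner_Integration.integrable_add integrable_mult_right i1 borel_prob_integrable_bounded[OF p1, of _ "\<bar>A\<bar>"]) auto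
  have iJ1: "integrable \<nu>1 (J \<nu>1)"
  proof -
    interpret P: prob_space \<nu>1 by (rule borel_probD[OF p1])
    interpret Q: pair_prob_space \<nu>1 \<nu>1 ..
    show ?thesis
      using Q.integrable_fst'[OF kinetic_bounded(1)[OF e p1 i1 cp p(2)]] by (simp add: J_def[abs_def])
  qed
  have "kinetic e p \<nu>1 = (\<integral>v. J \<nu>1 v \<partial>\<nu>1)"
    unfolding J_def by (rule kinetic_iterated[OF e p1 i1 cp p(2)])
  also have "\<dots> \<le> (\<integral>v. J \<nu>2 v + (A + P * \<bar>v\<bar>) * \<Gamma> \<partial>\<nu>1)"
  proof (rule integral_mono[OF iJ1 Bochner_Integration.integrable_add[OF T(1) i1A]])
    fix v show "J \<nu>1 v \<le> J \<nu>2 v + (A + P * \<bar>v\<bar>) * \<Gamma>" using J12[of v] by linarith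
  qed
  also have "\<dots> = (\<integral>v. J \<nu>2 v \<partial>\<nu>1) + (\<integral>v. (A + P * \<bar>v\<bar>) * \<Gamma> \<partial>\<nu>1)"
    by (rule Bochner_Integration.integral_add[OF T(1) i1A])
  also have "(\<integral>v. (A + P * \<bar>v\<bar>) * \<Gamma> \<partial>\<nu>1) = (A + P * (\<integral>v. \<bar>v\<bar> \<partial>\<nu>1)) * \<Gamma>"
    using i1 by (simp add: prob_space.prob_space[OF borel_probD(2)[OF p1]] prob_space.finite_measure[OF borel_probD(2)[OF p1], THEN finite_measure.integrable_const])
  also have "\<dots> \<le> (A + P * K) * \<Gamma>"
    using K P0 G0 by (intro mult_right_mono add_left_mono mult_left_mono) auto
  also have "(\<integral>v. J \<nu>2 v \<partial>\<nu>1) \<le> (\<integral>v. J \<nu>2 v \<partial>\<nu>2) + (A + P * K) * \<Gamma>" using T(3) by linarith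
  also have "(\<integral>v. J \<nu>2 v \<partial>\<nu>2) = kinetic e p \<nu>2"
    unfolding J_def by (rule kinetic_iterated[OF e p2 i2 cp p(2), symmetric])
  finally show ?thesis by (simp add: A_def algebra_simps)
qed

text \<open>
  A competitor whose action is \<open>b\<close> keeps all its measures at distance of order
  \<open>sqrt b\<close> from the final one, so the kinetic term may be frozen at the final time.
\<close>

lemma CE_increment_by_cost:
  assumes e: "0 \<le> e" "e < 1" and \<phi>: "C1c \<phi>" "lip1 (deriv \<phi>)"
  shows "\<exists>C\<ge>0. \<forall>f U b. (f, U) \<in> CE e 1 \<longrightarrow> integrable (f 1) (\<lambda>v. \<bar>v\<bar>) \<longrightarrow> (\<integral>v. \<bar>v\<bar> \<partial>f 1) \<le> M \<longrightarrow>
     0 \<le> b \<longrightarrow> b \<le> 1 \<longrightarrow> (\<integral>\<^sup>+t. action e (f t) (U t) \<partial>lebesgue_on {0..1}) \<le> ennreal b \<longrightarrow>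
     ((\<integral>v. \<phi> v \<partial>f 0) - (\<integral>v. \<phi> v \<partial>f 1))\<^sup>2 \<le> b * (kinetic e (deriv \<phi>) (f 1) + C * sqrt b)"
proof -
  obtain L0 where L0: "\<And>v. L0 < \<bar>v\<bar> \<Longrightarrow> \<phi> v = 0" using \<phi>(1) unfolding C1c_def by auto
  define L where "L = \<bar>L0\<bar>"
  have L: "0 \<le> L" "\<And>v. L < \<bar>v\<bar> \<Longrightarrow> deriv \<phi> v = 0"
    using deriv_eq_0_outside[of L0 \<phi>] L0 by (auto simp: L_def)
  have P: "\<bar>deriv \<phi> v\<bar> \<le> L + 1" for v
  proof (cases "L < \<bar>v\<bar>")
    case False
    have "\<bar>deriv \<phi> (L + 1) - deriv \<phi> 0\<bar> \<le> L + 1" "\<bar>deriv \<phi> v - deriv \<phi> (sgn v * (L + 1))\<bar> \<le> \<bar>v - sgn v * (L + 1)\<bar>"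
      using lip1D[OF \<phi>(2), of "L + 1" 0] lip1D[OF \<phi>(2), of v "sgn v * (L + 1)"] L by auto
    then show ?thesis using L(1) L(2)[of "L + 1"] L(2)[of "- (L + 1)"] False
      by (cases "v > 0"; cases "v < 0") (auto simp: sgn_if split: if_splits)
  qed (use L in auto)
  let ?P = "L + 1"
  define A where "A = 2 * (?P\<^sup>2 + ?P * L + 1 + ?P * (2 * \<bar>M\<bar> + 3))"
  define C where "C = A * sqrt (4 * \<bar>M\<bar> + 8)"
  have A0: "0 \<le> A" using L(1) by (simp add: A_def add_nonneg_nonneg)
  show ?thesis
  proof (intro exI[of _ C] conjI allI impI)
    show "0 \<le> C" using A0 by (simp add: C_def)
    fix f U b
    assume CE: "(f, U) \<in> CE e 1" and i: "integrable (f 1) (\<lambda>v. \<bar>v\<bar>)" and M: "(\<integral>v. \<bar>v\<bar> \<partial>f 1) \<le> M"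
      and b: "0 \<le> b" "b \<le> 1" "(\<integral>\<^sup>+t. action e (f t) (U t) \<partial>lebesgue_on {0..1}) \<le> ennreal b"
    have M0: "0 \<le> M" using abs_moment_nonneg M by (rule order_trans)
    let ?X = "kinetic e (deriv \<phi>) (f 1) + C * sqrt b"
    note mb = CE_first_moment_bound[OF e CE i M b]
    have kin: "kinetic e (deriv \<phi>) (f s) \<le> ?X" if s: "s \<in> {0..1}" for s
    proof -
      interpret close_measures "f s" "f 1" "sqrt (b * (4 * M + 8))" by (rule mb(3)[OF s])
      have "kinetic e (deriv \<phi>) (f s) \<le> kinetic e (deriv \<phi>) (f 1) + 2 * (?P\<^sup>2 + ?P * L + 1 + ?P * (2 * M + 3)) * sqrt (b * (4 * M + 8))"
        using mb(2)[OF s] mb(2)[of 1] by (intro kinetic_close[OF e i _ _ \<phi>(2) P L]) auto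
      then show ?thesis using M0 by (simp add: C_def A_def real_sqrt_mult mult.assoc mult.commute mult.left_commute)
    qed
    have X0: "0 \<le> ?X"
      using kinetic_bounded(2)[OF e CE_D(1)[OF CE] i lip1_continuous[OF \<phi>(2)] P] A0 b(1) by (simp add: C_def)
    show "((\<integral>v. \<phi> v \<partial>f 0) - (\<integral>v. \<phi> v \<partial>f 1))\<^sup>2 \<le> b * ?X"
    proof (rule field_le_epsilon)
      fix \<epsilon> :: real assume \<epsilon>: "\<epsilon> > 0"
      have "((\<integral>v. \<phi> v \<partial>f 0) - (\<integral>v. \<phi> v \<partial>f 1))\<^sup>2 \<le> b * (?X + \<epsilon>)"
        using kin X0 \<epsilon> by (intro CE_speed[OF e CE \<phi>(1) _ P mb(1) _ b(1,3)]) (auto simp: add_nonneg_pos intro: add_increasing2)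
      also have "\<dots> \<le> b * ?X + \<epsilon>" using b \<epsilon> mult_left_le_one_le[of \<epsilon> b] by (simp only: distrib_left) simp
      finally show "((\<integral>v. \<phi> v \<partial>f 0) - (\<integral>v. \<phi> v \<partial>f 1))\<^sup>2 \<le> b * ?X + \<epsilon>" .
    qed
  qed
qed

text \<open>
  Testing with one fixed function bounds the transport cost from below with a kinetic term taken
  at the final measure only, up to an error of higher order in the cost. This is what gives the
  metric derivative its lower bound.
\<close>

lemma transport_cost_lower_bound:
  assumes e: "0 \<le> e" "e < 1" and \<phi>: "C1c \<phi>" "lip1 (deriv \<phi>)"
  shows "\<exists>C\<ge>0. \<forall>\<mu>0 \<mu>1 q. integrable \<mu>1 (\<lambda>v. \<bar>v\<bar>) \<longrightarrow> (\<integral>v. \<bar>v\<bar> \<partial>\<mu>1) \<le> M \<longrightarrow>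
     0 \<le> q \<longrightarrow> q < 1 \<longrightarrow> transport_cost_sq e \<mu>0 \<mu>1 = ennreal q \<longrightarrow>
     ((\<integral>v. \<phi> v \<partial>\<mu>0) - (\<integral>v. \<phi> v \<partial>\<mu>1))\<^sup>2 \<le> q * (kinetic e (deriv \<phi>) \<mu>1 + C * sqrt q)"
proof -
  obtain C where C: "C \<ge> 0" and CE: "\<And>f U b. \<lbrakk>(f, U) \<in> CE e 1; integrable (f 1) (\<lambda>v. \<bar>v\<bar>); (\<integral>v. \<bar>v\<bar> \<partial>f 1) \<le> M;
     0 \<le> b; b \<le> 1; (\<integral>\<^sup>+t. action e (f t) (U t) \<partial>lebesgue_on {0..1}) \<le> ennreal b\<rbrakk> \<Longrightarrow>
     ((\<integral>v. \<phi> v \<partial>f 0) - (\<integral>v. \<phi> v \<partial>f 1))\<^sup>2 \<le> b * (kinetic e (deriv \<phi>) (f 1) + C * sqrt b)"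
    using CE_increment_by_cost[OF e \<phi>, of M] by blast
  show ?thesis
  proof (intro exI[of _ C] conjI allI impI)
    fix \<mu>0 \<mu>1 :: "real measure" and q :: real
    assume i: "integrable \<mu>1 (\<lambda>v. \<bar>v\<bar>)" and M: "(\<integral>v. \<bar>v\<bar> \<partial>\<mu>1) \<le> M"
      and q: "0 \<le> q" "q < 1" "transport_cost_sq e \<mu>0 \<mu>1 = ennreal q"
    let ?D = "((\<integral>v. \<phi> v \<partial>\<mu>0) - (\<integral>v. \<phi> v \<partial>\<mu>1))\<^sup>2"
    have le: "?D \<le> b * (kinetic e (deriv \<phi>) \<mu>1 + C * sqrt b)" if b: "q < b" "b < 1" for b
    proof -
      have "transport_cost_sq e \<mu>0 \<mu>1 < ennreal b" using q b by (simp add: ennreal_less_iff)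
      then obtain f U where fU: "(f, U) \<in> CE_between e 1 \<mu>0 \<mu>1"
        "(\<integral>\<^sup>+t. action e (f t) (U t) \<partial>lebesgue_on {0..1}) < ennreal b"
        unfolding transport_cost_sq_def by (auto simp: INF_less_iff)
      then have "(f, U) \<in> CE e 1" "f 0 = \<mu>0" "f 1 = \<mu>1" unfolding CE_between_def by auto
      then show ?thesis using CE[of f U b] i M b q fU(2) by (auto simp: less_imp_le)
    qed
    have "((\<lambda>b. b * (kinetic e (deriv \<phi>) \<mu>1 + C * sqrt b)) \<longlongrightarrow> q * (kinetic e (deriv \<phi>) \<mu>1 + C * sqrt q)) (at_right q)"
      by (intro tendsto_intros)
    moreover have "\<forall>\<^sub>F b in at_right q. ?D \<le> b * (kinetic e (deriv \<phi>) \<mu>1 + C * sqrt b)"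
      using eventually_at_right_real[OF q(2)] by eventually_elim (auto intro: le)
    ultimately show "?D \<le> q * (kinetic e (deriv \<phi>) \<mu>1 + C * sqrt q)"
      by (rule tendsto_lowerbound) simp
  qed (rule C)
qed

section \<open>The Lagrangian flow of the nonlinear friction\<close>

definition friction :: "real \<Rightarrow> real" where "friction z = \<bar>z\<bar> * z"

text \<open>
  Truncating the argument makes the friction globally Lipschitz, as an explicit scheme requires.
\<close>

definition friction_cut :: "real \<Rightarrow> real \<Rightarrow> real" where
  "friction_cut N z = friction (max (- N) (min z N))"

lemma friction_odd: "friction (- z) = - friction z"
  by (simp add: friction_def)

lemma friction_mono: "a \<le> b \<Longrightarrow> friction a \<le> friction b"
  unfolding friction_def
proof -
  assume ab: "a \<le> b"
  show "\<bar>a\<bar> * a \<le> \<bar>b\<bar> * b"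
  proof (cases "0 \<le> a")
    case True
    then show ?thesis using ab by (simp add: mult_mono)
  next
    case a: False
    show ?thesis
    proof (cases "0 \<le> b")
      case True
      have "\<bar>a\<bar> * a \<le> 0" using a by (intro mult_nonneg_nonpos) auto
      also have "0 \<le> \<bar>b\<bar> * b" using True by simp
      finally show ?thesis .
    next
      case False
      have "(- b) * (- b) \<le> (- a) * (- a)" using a False ab by (intro mult_mono) auto
      then show ?thesis using a False by simp
    qed
  qed
qed

lemma friction_lipschitz:
  assumes ab: "a \<le> b" and "- N \<le> a" "b \<le> N"
  shows "friction b - friction a \<le> 2 * N * (b - a)"
proof -
  have "b * b - a * a \<le> 2 * N * (b - a)" if "0 \<le> a"
  proof -
    have "b * b - a * a = (b + a) * (b - a)" by (simp add: algebra_simps)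
    also have "\<dots> \<le> (2 * N) * (b - a)" using assms that by (intro mult_right_mono) auto
    finally show ?thesis .
  qed
  moreover have "a * a - b * b \<le> 2 * N * (b - a)" if "b < 0"
  proof -
    have "a * a - b * b = (- a - b) * (b - a)" by (simp add: algebra_simps)
    also have "\<dots> \<le> (2 * N) * (b - a)" using assms that by (intro mult_right_mono) auto
    finally show ?thesis .
  qed
  moreover have "b * b + a * a \<le> 2 * N * (b - a)" if "a < 0" "0 \<le> b"
  proof -
    have "b * b \<le> N * b" "(- a) * (- a) \<le> N * (- a)"
      using assms that by (intro mult_right_mono; simp)+
    moreover have "0 \<le> N * b" "0 \<le> N * (- a)"
      using assms that by (intro mult_nonneg_nonneg; linarith)+
    ultimately show ?thesis by (simp add: algebra_simps)
  qed
  ultimately show ?thesis unfolding friction_def by (cases "0 \<le> a"; cases "0 \<le> b") (use ab in auto)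
qed

lemma friction_cut_mono: "a \<le> b \<Longrightarrow> friction_cut N a \<le> friction_cut N b"
  unfolding friction_cut_def by (intro friction_mono) auto

lemma friction_cut_lipschitz:
  assumes "a \<le> b" "0 \<le> N"
  shows "friction_cut N b - friction_cut N a \<le> 2 * N * (b - a)"
proof -
  let ?p = "\<lambda>z. max (- N) (min z N)"
  have "friction (?p b) - friction (?p a) \<le> 2 * N * (?p b - ?p a)"
    using assms by (intro friction_lipschitz) auto
  also have "\<dots> \<le> 2 * N * (b - a)" using assms by (intro mult_left_mono) (auto simp: max_def min_def)
  finally show ?thesis unfolding friction_cut_def .
qed

lemma friction_abs: "\<bar>friction z\<bar> = z\<^sup>2"
  by (simp add: friction_def abs_mult power2_eq_square)

lemma friction_cut_abs:
  assumes "0 \<le> N" shows "\<bar>friction_cut N z\<bar> \<le> z\<^sup>2" "\<bar>friction_cut N z\<bar> \<le> N\<^sup>2"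
proof -
  have "\<bar>max (- N) (min z N)\<bar> \<le> \<bar>z\<bar>" "\<bar>max (- N) (min z N)\<bar> \<le> \<bar>N\<bar>" using assms by auto
  then have "(max (- N) (min z N))\<^sup>2 \<le> z\<^sup>2" "(max (- N) (min z N))\<^sup>2 \<le> N\<^sup>2"
    by (simp_all only: abs_le_square_iff)
  then show "\<bar>friction_cut N z\<bar> \<le> z\<^sup>2" "\<bar>friction_cut N z\<bar> \<le> N\<^sup>2"
    unfolding friction_cut_def friction_abs .
qed

lemma friction_cut_eq: "\<bar>z\<bar> \<le> N \<Longrightarrow> friction_cut N z = friction z"
proof -
  assume "\<bar>z\<bar> \<le> N"
  then have "max (- N) (min z N) = z" by linarith
  then show ?thesis by (simp add: friction_cut_def)
qed

lemma continuous_friction: "continuous_on S friction"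
  unfolding friction_def by (intro continuous_intros)

lemma continuous_friction_cut: "continuous_on S (friction_cut N)"
  unfolding friction_cut_def friction_def by (intro continuous_intros)

text \<open>This monotonicity of quadratic order, uniform in the position of the pair, drives the decay of the gaps.\<close>

lemma friction_gap:
  assumes "0 \<le> g" shows "g\<^sup>2 / 2 \<le> friction (a + g) - friction a"
proof -
  consider "0 \<le> a" | "a < 0" "0 \<le> a + g" | "a + g < 0" by linarith
  then show ?thesis
  proof cases
    case 1
    have "friction (a + g) - friction a = g\<^sup>2 + 2 * (a * g)" using 1 assms
      by (simp add: friction_def power2_eq_square algebra_simps)
    moreover have "0 \<le> a * g" using 1 assms by simp
    ultimately show ?thesis by simp
  next
    case 2
    have "friction (a + g) - friction a = (a + g) * (a + g) + a * a" using 2 by (simp add: friction_def)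
    moreover have "g\<^sup>2 = (a + g) * (a + g) + a * a + 2 * ((a + g) * (- a))" by (simp add: power2_eq_square algebra_simps)
    moreover have "2 * ((a + g) * (- a)) \<le> (a + g) * (a + g) + a * a"
      using zero_le_power2[of "a + g + a"] by (simp add: power2_eq_square algebra_simps)
    ultimately show ?thesis by simp
  next
    case 3
    have "friction (a + g) - friction a = g\<^sup>2 + 2 * ((- (a + g)) * g)" using 3 assms
      by (simp add: friction_def power2_eq_square algebra_simps)
    moreover have "0 \<le> (- (a + g)) * g" using 3 assms by (intro mult_nonneg_nonneg) auto
    ultimately show ?thesis by simp
  qed
qed

text \<open>
  The law of the initial velocities. It stays fixed; time acts on the positions of the particles.
\<close>

locale centred_law =
  fixes \<mu> :: "real measure" and c :: real
  assumes bp: "\<mu> \<in> borel_prob" and sq: "integrable \<mu> (\<lambda>x. x\<^sup>2)" and mean: "(\<integral>x. x \<partial>\<mu>) = 0"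
    and c: "c > 0"
begin

sublocale prob_space \<mu> by (rule borel_probD(2)[OF bp])

lemma meas: "h \<in> borel_measurable borel \<Longrightarrow> h \<in> borel_measurable \<mu>"
  by (rule borel_prob_measurable[OF bp])

lemma meas_cont: "continuous_on UNIV h \<Longrightarrow> (h :: real \<Rightarrow> real) \<in> borel_measurable \<mu>"
  by (intro meas borel_measurable_continuous_onI)

lemma integrable_id: "integrable \<mu> (\<lambda>x. x)"
proof (rule Bochner_Integration.integrable_bound)
  show "integrable \<mu> (\<lambda>x. x\<^sup>2 + 1)" using sq by simp
  show "AE x in \<mu>. norm x \<le> norm (x\<^sup>2 + 1)"
  proof (rule AE_I2)
    fix x :: real
    have "2 * \<bar>x\<bar> \<le> x\<^sup>2 + 1" using zero_le_power2[of "\<bar>x\<bar> - 1"] by (simp add: power2_eq_square algebra_simps)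
    then show "norm x \<le> norm (x\<^sup>2 + 1)" by simp
  qed
qed (rule meas, simp)

text \<open>
  Under a contracting map the spread of a particle bounds the friction force on it.
\<close>

definition spread :: "real \<Rightarrow> real" where "spread x = (\<integral>y. (x - y)\<^sup>2 \<partial>\<mu>)"

lemma integrable_dist_sq: "integrable \<mu> (\<lambda>y. (x - y)\<^sup>2)"
proof -
  have "integrable \<mu> (\<lambda>y. x\<^sup>2 + y\<^sup>2 - 2 * x * y)" using sq integrable_id by auto
  then show ?thesis by (simp add: power2_diff)
qed

lemma spread_eq: "spread x = x\<^sup>2 + (\<integral>y. y\<^sup>2 \<partial>\<mu>)"
proof -
  have "spread x = (\<integral>y. x\<^sup>2 + y\<^sup>2 - 2 * x * y \<partial>\<mu>)" unfolding spread_def by (simp add: power2_diff)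
  also have "\<dots> = x\<^sup>2 + (\<integral>y. y\<^sup>2 \<partial>\<mu>)" using sq integrable_id by (simp add: mean prob_space)
  finally show ?thesis .
qed

lemma spread_nonneg: "0 \<le> spread x"
  unfolding spread_def by (rule integral_nonneg_AE) auto

lemma integrable_spread: "integrable \<mu> spread"
  unfolding spread_eq[abs_def] using sq by simp

subsection \<open>Explicit Euler scheme\<close>

text \<open>
  The argument \<open>x\<close> labels a particle by its initial position; \<open>N\<close> is the
  cut-off of the friction and \<open>h\<close> the time step.
\<close>

fun euler :: "real \<Rightarrow> real \<Rightarrow> nat \<Rightarrow> real \<Rightarrow> real" where
  "euler N h 0 x = x"
| "euler N h (Suc j) x = euler N h j x - 2 * c * h * (\<integral>y. friction_cut N (euler N h j x - euler N h j y) \<partial>\<mu>)"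

definition drift :: "real \<Rightarrow> real \<Rightarrow> nat \<Rightarrow> real \<Rightarrow> real" where
  "drift N h j x = (\<integral>y. friction_cut N (euler N h j x - euler N h j y) \<partial>\<mu>)"

lemma euler_Suc: "euler N h (Suc j) x = euler N h j x - 2 * c * h * drift N h j x"
  by (simp add: drift_def)

declare euler.simps(2) [simp del]

definition admissible :: "real \<Rightarrow> real \<Rightarrow> bool" where
  "admissible N h \<longleftrightarrow> 0 \<le> N \<and> 0 < h \<and> 4 * c * h * N \<le> 1"

definition contracting :: "(real \<Rightarrow> real) \<Rightarrow> bool" where
  "contracting X \<longleftrightarrow> (\<forall>x y. x \<le> y \<longrightarrow> 0 \<le> X y - X x \<and> X y - X x \<le> y - x)"

lemma contracting_abs: "contracting X \<Longrightarrow> \<bar>X x - X y\<bar> \<le> \<bar>x - y\<bar>"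
proof -
  assume X: "contracting X"
  have "0 \<le> X y - X x \<and> X y - X x \<le> y - x" if "x \<le> y" using X that by (simp add: contracting_def)
  moreover have "0 \<le> X x - X y \<and> X x - X y \<le> x - y" if "y \<le> x" using X that by (simp add: contracting_def)
  ultimately show ?thesis by linarith
qed

lemma contracting_continuous: "contracting X \<Longrightarrow> continuous_on S X"
  by (rule lip1_continuous) (simp add: lip1_def contracting_abs)

lemma integrable_friction_cut:
  assumes N: "0 \<le> N" and X: "continuous_on UNIV X"
  shows "integrable \<mu> (\<lambda>y. friction_cut N (a - X y))"
proof (rule integrable_const_bound[of _ "N\<^sup>2"])
  show "AE y in \<mu>. norm (friction_cut N (a - X y)) \<le> N\<^sup>2" using friction_cut_abs(2)[OF N] by simp
  show "(\<lambda>y. friction_cut N (a - X y)) \<in> borel_measurable \<mu>"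
    by (intro meas_cont continuous_on_compose2[OF continuous_friction_cut] continuous_on_diff continuous_on_const X) auto
qed

text \<open>
  The step restriction keeps the explicit scheme order preserving and contracting: the cut-off
  friction increases with slope at most twice the cut-off, so that one step cannot overshoot.
\<close>

lemma euler_step:
  assumes a: "admissible N h" and X: "contracting (euler N h j)" and xy: "x \<le> y"
  shows "0 \<le> euler N h (Suc j) y - euler N h (Suc j) x"
    "euler N h (Suc j) y - euler N h (Suc j) x \<le> euler N h j y - euler N h j x"
proof -
  have N: "0 \<le> N" and h: "0 < h" and st: "4 * c * h * N \<le> 1" using a by (auto simp: admissible_def)
  define d where "d = euler N h j y - euler N h j x"
  have d: "0 \<le> d" using X xy by (simp add: contracting_def d_def)
  note i = integrable_friction_cut[OF N contracting_continuous[OF X]]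
  have eq: "drift N h j y - drift N h j x
      = (\<integral>z. friction_cut N (euler N h j y - euler N h j z) - friction_cut N (euler N h j x - euler N h j z) \<partial>\<mu>)"
    unfolding drift_def by (rule Bochner_Integration.integral_diff[OF i i, symmetric])
  have "0 \<le> drift N h j y - drift N h j x"
    unfolding eq using d by (intro integral_nonneg_AE AE_I2) (simp add: d_def friction_cut_mono)
  moreover have "drift N h j y - drift N h j x \<le> 2 * N * d"
  proof -
    have "drift N h j y - drift N h j x \<le> (\<integral>z. 2 * N * d \<partial>\<mu>)"
      unfolding eq
    proof (rule integral_mono)
      show "integrable \<mu> (\<lambda>z. friction_cut N (euler N h j y - euler N h j z) - friction_cut N (euler N h j x - euler N h j z))"
        by (rule Bochner_Integration.integrable_diff[OF i i])
      fix z
      show "friction_cut N (euler N h j y - euler N h j z) - friction_cut N (euler N h j x - euler N h j z) \<le> 2 * N * d"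
        using friction_cut_lipschitz[of "euler N h j x - euler N h j z" "euler N h j y - euler N h j z" N] d N
        by (simp add: d_def)
    qed simp
    then show ?thesis by (simp add: prob_space)
  qed
  moreover have "euler N h (Suc j) y - euler N h (Suc j) x = d - 2 * c * h * (drift N h j y - drift N h j x)"
    by (simp add: euler_Suc d_def algebra_simps)
  moreover have "2 * c * h * (2 * N * d) \<le> d"
    using mult_right_mono[OF st d] by (simp add: algebra_simps)
  moreover have "2 * c * h * (drift N h j y - drift N h j x) \<le> 2 * c * h * (2 * N * d)"
    using c h calculation(2) by (intro mult_left_mono) auto
  moreover have "0 \<le> 2 * c * h * (drift N h j y - drift N h j x)"
    using c h calculation(1) by (intro mult_nonneg_nonneg) auto
  ultimately show "0 \<le> euler N h (Suc j) y - euler N h (Suc j) x"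
    "euler N h (Suc j) y - euler N h (Suc j) x \<le> euler N h j y - euler N h j x"
    unfolding d_def by linarith+
qed

lemma euler_contracting: "admissible N h \<Longrightarrow> contracting (euler N h j)"
proof (induction j)
  case 0 then show ?case by (simp add: contracting_def)
next
  case (Suc j)
  then have X: "contracting (euler N h j)" by simp
  show ?case unfolding contracting_def
  proof (intro allI impI)
    fix x y :: real assume xy: "x \<le> y"
    have "euler N h j y - euler N h j x \<le> y - x" using X xy by (simp add: contracting_def)
    then show "0 \<le> euler N h (Suc j) y - euler N h (Suc j) x \<and> euler N h (Suc j) y - euler N h (Suc j) x \<le> y - x"
      using euler_step[OF Suc.prems X xy] by linarith
  qed
qed

lemma euler_gap_decreasing:
  assumes "admissible N h" "x \<le> y" "i \<le> j"
  shows "euler N h j y - euler N h j x \<le> euler N h i y - euler N h i x"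
  using assms(3)
proof (induction rule: dec_induct)
  case (step n)
  then show ?case using euler_step(2)[OF assms(1) euler_contracting[OF assms(1)] assms(2), of n] by linarith
qed simp

lemma drift_bound: "admissible N h \<Longrightarrow> \<bar>drift N h j x\<bar> \<le> spread x"
proof -
  assume a: "admissible N h"
  then have N: "0 \<le> N" by (simp add: admissible_def)
  note X = euler_contracting[OF a, of j]
  note i = integrable_friction_cut[OF N contracting_continuous[OF X]]
  have "\<bar>drift N h j x\<bar> \<le> (\<integral>y. \<bar>friction_cut N (euler N h j x - euler N h j y)\<bar> \<partial>\<mu>)"
    unfolding drift_def by (rule integral_abs_bound)
  also have "\<dots> \<le> spread x"
    unfolding spread_def
  proof (rule integral_mono)
    show "integrable \<mu> (\<lambda>y. \<bar>friction_cut N (euler N h j x - euler N h j y)\<bar>)" by (intro integrable_abs i)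
    fix y
    have "\<bar>friction_cut N (euler N h j x - euler N h j y)\<bar> \<le> (euler N h j x - euler N h j y)\<^sup>2"
      by (rule friction_cut_abs(1)[OF N])
    also have "\<dots> \<le> (x - y)\<^sup>2" using contracting_abs[OF X, of x y] by (simp add: abs_le_square_iff)
    finally show "\<bar>friction_cut N (euler N h j x - euler N h j y)\<bar> \<le> (x - y)\<^sup>2" .
  qed (rule integrable_dist_sq)
  finally show ?thesis .
qed

lemma euler_time:
  assumes a: "admissible N h" and ij: "i \<le> j"
  shows "\<bar>euler N h j x - euler N h i x\<bar> \<le> real (j - i) * (2 * c * h * spread x)"
  using ij
proof (induction rule: dec_induct)
  case (step n)
  have "\<bar>euler N h (Suc n) x - euler N h n x\<bar> = 2 * c * h * \<bar>drift N h n x\<bar>"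
    using c a by (simp add: euler_Suc abs_mult admissible_def)
  also have "\<dots> \<le> 2 * c * h * spread x"
    using c a drift_bound[OF a] by (intro mult_left_mono) (auto simp: admissible_def)
  finally have "\<bar>euler N h (Suc n) x - euler N h i x\<bar> \<le> 2 * c * h * spread x + real (n - i) * (2 * c * h * spread x)"
    using step.IH by linarith
  also have "\<dots> = real (Suc n - i) * (2 * c * h * spread x)" using step.hyps by (simp add: Suc_diff_le algebra_simps)
  finally show ?case .
qed simp

text \<open>
  The number of completed time steps; the scheme is interpolated piecewise constantly in time.
\<close>

definition slot :: "real \<Rightarrow> real \<Rightarrow> nat" where "slot h t = nat \<lfloor>t / h\<rfloor>"

lemma slot_bounds: "0 < h \<Longrightarrow> 0 \<le> t \<Longrightarrow> h * real (slot h t) \<le> t \<and> t < h * real (slot h t) + h"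
proof -
  assume h: "0 < h" and t: "0 \<le> t"
  have "0 \<le> \<lfloor>t / h\<rfloor>" using h t by simp
  then have "real (slot h t) = of_int \<lfloor>t / h\<rfloor>" by (simp add: slot_def)
  then have "real (slot h t) \<le> t / h" "t / h < real (slot h t) + 1" by linarith+
  then show ?thesis using h by (simp add: field_simps)
qed

lemma slot_mono: "0 < h \<Longrightarrow> s \<le> t \<Longrightarrow> slot h s \<le> slot h t"
  unfolding slot_def by (intro nat_mono floor_mono divide_right_mono) auto

lemma slot_eq: "0 < h \<Longrightarrow> h * real m \<le> s \<Longrightarrow> s < h * real (Suc m) \<Longrightarrow> slot h s = m"
proof -
  assume h: "0 < h" and "h * real m \<le> s" "s < h * real (Suc m)"
  then have "\<lfloor>s / h\<rfloor> = int m" by (intro floor_unique) (auto simp: field_simps)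
  then show ?thesis by (simp add: slot_def)
qed

lemma has_integral_step:
  fixes g :: "nat \<Rightarrow> real"
  assumes h: "0 < h"
  shows "((\<lambda>s. g (slot h s)) has_integral h * (\<Sum>j<m. g j)) {0..h * real m}"
proof (induction m)
  case 0
  have "((\<lambda>s. g (slot h s)) has_integral 0) {0}" by (rule has_integral_refl(2))
  then show ?case by (simp only: lessThan_0 sum.empty mult_zero_right of_nat_0 atLeastAtMost_singleton)
next
  case (Suc m)
  have "((\<lambda>s. g m) has_integral (h * real (Suc m) - h * real m) *\<^sub>R g m) {h * real m..h * real (Suc m)}"
  proof -
    have "h * real m \<le> h * real (Suc m)" using h by (intro mult_left_mono) auto
    from content_real[OF this] show ?thesis
      using has_integral_const_real[of "g m" "h * real m" "h * real (Suc m)"] by (simp only:)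
  qed
  then have "((\<lambda>s. g (slot h s)) has_integral (h * real (Suc m) - h * real m) *\<^sub>R g m) {h * real m..h * real (Suc m)}"
    by (rule has_integral_spike_finite[of "{h * real (Suc m)}", rotated 2]) (auto simp: slot_eq[OF h] simp del: of_nat_Suc)
  from has_integral_combine[OF _ _ Suc this]
  have "((\<lambda>s. g (slot h s)) has_integral h * (\<Sum>j<m. g j) + (h * real (Suc m) - h * real m) *\<^sub>R g m) {0..h * real (Suc m)}"
    using h by simp
  then show ?case by (simp add: algebra_simps)
qed

lemma euler_sum: "euler N h m x = x - 2 * c * (h * (\<Sum>j<m. drift N h j x))"
  by (induction m) (simp_all add: euler_Suc algebra_simps)

definition interp :: "real \<Rightarrow> real \<Rightarrow> real \<Rightarrow> real \<Rightarrow> real" where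
  "interp N h t x = euler N h (slot h t) x"

lemma interp_time:
  assumes a: "admissible N h" and st: "0 \<le> s" "0 \<le> t"
  shows "\<bar>interp N h t x - interp N h s x\<bar> \<le> 2 * c * (\<bar>t - s\<bar> + h) * spread x"
proof -
  have h: "0 < h" using a by (simp add: admissible_def)
  have main: "\<bar>interp N h t x - interp N h s x\<bar> \<le> 2 * c * (\<bar>t - s\<bar> + h) * spread x" if st: "0 \<le> s" "s \<le> t" for s t
  proof -
    have m: "slot h s \<le> slot h t" by (rule slot_mono[OF h st(2)])
    have "\<bar>interp N h t x - interp N h s x\<bar> \<le> real (slot h t - slot h s) * (2 * c * h * spread x)"
      unfolding interp_def by (rule euler_time[OF a m])
    also have "\<dots> = (h * real (slot h t) - h * real (slot h s)) * (2 * c * spread x)"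
      using m by (simp add: of_nat_diff algebra_simps)
    also have "\<dots> \<le> (\<bar>t - s\<bar> + h) * (2 * c * spread x)"
      using slot_bounds[OF h, of s] slot_bounds[OF h, of t] st c spread_nonneg[of x]
      by (intro mult_right_mono) auto
    finally show ?thesis by (simp add: algebra_simps)
  qed
  show ?thesis
    using main[of s t] main[of t s] st by (cases "s \<le> t") (auto simp: abs_minus_commute)
qed

lemma interp_integral:
  assumes a: "admissible N h" and t: "0 \<le> t"
  shows "(\<lambda>s. drift N h (slot h s) x) integrable_on {0..t}"
    "\<bar>interp N h t x - (x - 2 * c * integral {0..t} (\<lambda>s. drift N h (slot h s) x))\<bar> \<le> 2 * c * h * spread x"
proof -
  have h: "0 < h" using a by (simp add: admissible_def)
  let ?m = "slot h t" and ?g = "\<lambda>s. drift N h (slot h s) x"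
  note sb = slot_bounds[OF h t]
  have "(?g has_integral h * (\<Sum>j<Suc ?m. drift N h j x)) {0..h * real (Suc ?m)}" by (rule has_integral_step[OF h])
  then have "?g integrable_on {0..h * real (Suc ?m)}" by blast
  then show i: "?g integrable_on {0..t}"
    by (rule integrable_on_subinterval) (use sb in \<open>auto simp: algebra_simps\<close>)
  have I0: "integral {0..h * real ?m} ?g = h * (\<Sum>j<?m. drift N h j x)"
    by (rule integral_unique[OF has_integral_step[OF h]])
  have I: "integral {0..h * real ?m} ?g + integral {h * real ?m..t} ?g = integral {0..t} ?g"
    by (rule Henstock_Kurzweil_Integration.integral_combine[OF _ _ i]) (use sb h in auto)
  have alg: "(x - 2 * c * p) - (x - 2 * c * (p + q)) = 2 * c * q" for p q by (simp add: algebra_simps)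
  have "interp N h t x - (x - 2 * c * integral {0..t} ?g) = 2 * c * integral {h * real ?m..t} ?g"
    unfolding interp_def euler_sum[of N h ?m x] I0[symmetric] I[symmetric] by (rule alg)
  moreover have "norm (integral {h * real ?m..t} ?g) \<le> spread x * (t - h * real ?m)"
  proof -
    have "norm (integral {h * real ?m..t} ?g) \<le> integral {h * real ?m..t} (\<lambda>_. spread x)"
    proof (rule integral_norm_bound_integral)
      show "?g integrable_on {h * real ?m..t}"
        by (rule integrable_on_subinterval[OF i]) (use sb h in auto)
    qed (use drift_bound[OF a] in auto)
    also have "\<dots> = spread x * (t - h * real ?m)" using sb by simp
    finally show ?thesis .
  qed
  moreover have "spread x * (t - h * real ?m) \<le> spread x * h" using sb spread_nonneg by (intro mult_left_mono) auto
  ultimately have "\<bar>interp N h t x - (x - 2 * c * integral {0..t} ?g)\<bar> \<le> 2 * c * (spread x * h)"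
    using c by (simp add: abs_mult)
  then show "\<bar>interp N h t x - (x - 2 * c * integral {0..t} ?g)\<bar> \<le> 2 * c * h * spread x"
    by (simp add: ac_simps)
qed

subsection \<open>Passage to the limit\<close>

definition velocity :: "(real \<Rightarrow> real) \<Rightarrow> real \<Rightarrow> real" where
  "velocity X x = - 2 * c * (\<integral>y. friction (X x - X y) \<partial>\<mu>)"

text \<open>
  The equation is required in integral form, which survives pointwise limits of the scheme. The second
  condition combines conservation of the order of particles with the decrease of their gaps, and the
  third one is Lipschitz continuity in time with a constant that is integrable over the particles.
\<close>

definition flow :: "(real \<Rightarrow> real \<Rightarrow> real) \<Rightarrow> bool" where
  "flow X \<longleftrightarrow> (\<forall>x. X 0 x = x) \<and>
     (\<forall>s t x y. 0 \<le> s \<longrightarrow> s \<le> t \<longrightarrow> x \<le> y \<longrightarrow> 0 \<le> X t y - X t x \<and> X t y - X t x \<le> X s y - X s x) \<and>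
     (\<forall>s t x. 0 \<le> s \<longrightarrow> 0 \<le> t \<longrightarrow> \<bar>X t x - X s x\<bar> \<le> 2 * c * \<bar>t - s\<bar> * spread x) \<and>
     (\<forall>t x. 0 \<le> t \<longrightarrow> ((\<lambda>s. velocity (X s) x) has_integral X t x - x) {0..t})"

lemma convergent_by_approximation:
  fixes a :: "nat \<Rightarrow> real"
  assumes "\<And>\<epsilon>. \<epsilon> > 0 \<Longrightarrow> \<exists>b. convergent b \<and> (\<forall>\<^sub>F n in sequentially. \<bar>a n - b n\<bar> \<le> \<epsilon>)"
  shows "convergent a"
proof -
  have "Cauchy a"
    unfolding Cauchy_def
  proof (intro allI impI)
    fix \<epsilon> :: real assume "\<epsilon> > 0"
    then have e4: "\<epsilon> / 4 > 0" by simp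
    obtain b where b: "convergent b" "\<forall>\<^sub>F n in sequentially. \<bar>a n - b n\<bar> \<le> \<epsilon> / 4" using assms[OF e4] by blast
    obtain N where N: "\<And>n. n \<ge> N \<Longrightarrow> \<bar>a n - b n\<bar> \<le> \<epsilon> / 4" using b(2) by (auto simp: eventually_sequentially)
    obtain K where K: "\<And>m n. m \<ge> K \<Longrightarrow> n \<ge> K \<Longrightarrow> dist (b m) (b n) < \<epsilon> / 4"
      using convergent_Cauchy[OF b(1)] e4 unfolding Cauchy_def by meson
    show "\<exists>M. \<forall>m\<ge>M. \<forall>n\<ge>M. dist (a m) (a n) < \<epsilon>"
    proof (intro exI[of _ "max N K"] allI impI)
      fix m n assume "max N K \<le> m" "max N K \<le> n"
      then have "\<bar>a m - b m\<bar> \<le> \<epsilon> / 4" "\<bar>a n - b n\<bar> \<le> \<epsilon> / 4" "\<bar>b m - b n\<bar> < \<epsilon> / 4"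
        using N K[of m n] by (auto simp: dist_real_def)
      then show "dist (a m) (a n) < \<epsilon>" using \<open>\<epsilon> > 0\<close> unfolding dist_real_def by linarith
    qed
  qed
  then show ?thesis by (rule Cauchy_convergent)
qed

text \<open>
  The schemes are equicontinuous in both variables, so a subsequence that converges at rational
  points converges everywhere. Dominated convergence, with the squared initial distance as
  majorant, passes to the limit in the drift and in its time integral.
\<close>

theorem flow_exists: "\<exists>X. flow X"
proof -
  define N where "N n = real n + 1" for n :: nat
  define h where "h n = 1 / (4 * c * N n)" for n :: nat
  have adm: "admissible (N n) (h n)" for n
    using c by (auto simp: admissible_def N_def h_def field_simps add_pos_nonneg)
  have hpos: "0 < h n" for n using adm by (simp add: admissible_def)
  have hlim: "h \<longlonglongrightarrow> 0"
  proof -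
    have "(\<lambda>n. inverse (real (Suc n)) * (1 / (4 * c))) \<longlonglongrightarrow> 0 * (1 / (4 * c))"
      by (rule tendsto_mult[OF LIMSEQ_inverse_real_of_nat tendsto_const])
    then show ?thesis by (simp add: h_def[abs_def] N_def field_simps)
  qed
  \<comment> \<open>dividing by the common growth bound makes the diagonal argument for bounded sequences applicable\<close>
  define F where "F n p = interp (N n) (h n) (fst p) (snd p) / (1 + \<bar>snd p\<bar> + 2 * c * fst p * spread (snd p))" for n p
  define S where "S = {p \<in> \<rat> \<times> \<rat>. 0 \<le> fst (p :: real \<times> real)}"
  have cS: "countable S"
    unfolding S_def by (rule countable_subset[of _ "\<rat> \<times> \<rat>"]) (auto intro: countable_SIGMA countable_rat)
  have start: "interp M k 0 x = x" for M k x by (simp add: interp_def slot_def)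
  have interp_near: "\<bar>interp (N n) (h n) t x - x\<bar> \<le> 2 * c * t * spread x" if "0 \<le> t" for n t x
  proof -
    have s: "h n * real (slot (h n) t) \<le> t" using slot_bounds[OF hpos that] by blast
    have "\<bar>euler (N n) (h n) (slot (h n) t) x - euler (N n) (h n) 0 x\<bar> \<le> real (slot (h n) t - 0) * (2 * c * h n * spread x)"
      by (rule euler_time[OF adm]) simp
    also have "\<dots> = (h n * real (slot (h n) t)) * (2 * c * spread x)" by simp
    also have "\<dots> \<le> t * (2 * c * spread x)" using s c spread_nonneg by (intro mult_right_mono) auto
    finally show ?thesis by (simp add: interp_def ac_simps)
  qed
  have pos: "0 < 1 + \<bar>x\<bar> + 2 * c * t * spread x" if "0 \<le> t" for t x
    using c that spread_nonneg[of x] by (intro add_pos_nonneg mult_nonneg_nonneg) auto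
  have bF: "norm (F n p) \<le> 1" if "p \<in> S" for n p
  proof -
    have t: "0 \<le> fst p" using that by (simp add: S_def)
    have "\<bar>interp (N n) (h n) (fst p) (snd p)\<bar> \<le> 1 + \<bar>snd p\<bar> + 2 * c * fst p * spread (snd p)"
      using interp_near[OF t, of n "snd p"] by linarith
    then show ?thesis unfolding F_def using pos[OF t, of "snd p"] by (simp add: abs_divide)
  qed
  obtain r :: "nat \<Rightarrow> nat" where r: "strict_mono r" and rl: "\<And>p. p \<in> S \<Longrightarrow> \<exists>l. (\<lambda>n. F (r n) p) \<longlonglongrightarrow> l"
    using function_convergent_subsequence[OF cS, of F 1] bF by metis
  define Y where "Y n t x = interp (N (r n)) (h (r n)) t x" for n t x
  have hr: "(\<lambda>n. h (r n)) \<longlonglongrightarrow> 0" using LIMSEQ_subseq_LIMSEQ[OF hlim r] by (simp add: comp_def)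
  have Yc: "contracting (Y n t)" for n t
    unfolding Y_def interp_def[abs_def] by (rule euler_contracting[OF adm])
  have Yt: "\<bar>Y n t x - Y n s x\<bar> \<le> 2 * c * (\<bar>t - s\<bar> + h (r n)) * spread x" if "0 \<le> s" "0 \<le> t" for n s t x
    unfolding Y_def by (rule interp_time[OF adm that])
  have convS: "convergent (\<lambda>n. Y n (fst p) (snd p))" if p: "p \<in> S" for p
  proof -
    obtain l where l: "(\<lambda>n. F (r n) p) \<longlonglongrightarrow> l" using rl[OF p] by blast
    have d: "1 + \<bar>snd p\<bar> + 2 * c * fst p * spread (snd p) \<noteq> 0" using pos[of "fst p" "snd p"] p by (auto simp: S_def)
    have "(\<lambda>n. F (r n) p * (1 + \<bar>snd p\<bar> + 2 * c * fst p * spread (snd p))) \<longlonglongrightarrow> l * (1 + \<bar>snd p\<bar> + 2 * c * fst p * spread (snd p))"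
      by (rule tendsto_mult[OF l tendsto_const])
    then have "(\<lambda>n. Y n (fst p) (snd p)) \<longlonglongrightarrow> l * (1 + \<bar>snd p\<bar> + 2 * c * fst p * spread (snd p))"
      using d by (simp add: F_def Y_def)
    then show ?thesis by (rule convergentI)
  qed
  have conv: "convergent (\<lambda>n. Y n t x)" if t: "0 \<le> t" for t x
  proof (rule convergent_by_approximation)
    fix \<epsilon> :: real assume e: "\<epsilon> > 0"
    obtain x' where x': "x' \<in> \<rat>" "x < x'" "x' < x + \<epsilon> / 2" using Rats_dense_in_real[of x "x + \<epsilon> / 2"] e by auto
    define D where "D = 2 * c * spread x' + 1"
    have D: "0 < D" "2 * c * spread x' \<le> D" unfolding D_def using c spread_nonneg[of x'] by (auto simp: add_nonneg_pos)
    obtain t' where t': "t' \<in> \<rat>" "t < t'" "t' < t + \<epsilon> / (4 * D)"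
      using Rats_dense_in_real[of t "t + \<epsilon> / (4 * D)"] e D by auto
    have "convergent (\<lambda>n. Y n t' x')" using convS[of "(t', x')"] x' t' t by (simp add: S_def)
    moreover have "\<forall>\<^sub>F n in sequentially. h (r n) < \<epsilon> / (4 * D)"
      using hr e D by (intro order_tendstoD) auto
    then have "\<forall>\<^sub>F n in sequentially. \<bar>Y n t x - Y n t' x'\<bar> \<le> \<epsilon>"
    proof eventually_elim
      case (elim n)
      have "\<bar>Y n t x - Y n t x'\<bar> \<le> \<epsilon> / 2" using contracting_abs[OF Yc, of n t x x'] x' by linarith
      moreover have "\<bar>Y n t x' - Y n t' x'\<bar> \<le> 2 * c * (\<bar>t - t'\<bar> + h (r n)) * spread x'"
        using t t' by (intro Yt) auto
      moreover have "2 * c * (\<bar>t - t'\<bar> + h (r n)) * spread x' \<le> \<epsilon> / 2"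
      proof -
        have "\<bar>t - t'\<bar> + h (r n) \<le> \<epsilon> / (4 * D) + \<epsilon> / (4 * D)" using t' elim by linarith
        also have "\<dots> = \<epsilon> / (2 * D)" using D by (simp add: field_simps)
        finally have "(2 * c * spread x') * (\<bar>t - t'\<bar> + h (r n)) \<le> D * (\<epsilon> / (2 * D))"
          using D hpos[of "r n"] c spread_nonneg[of x'] by (intro mult_mono) auto
        also have "D * (\<epsilon> / (2 * D)) = \<epsilon> / 2" using D by simp
        finally show ?thesis by (simp only: mult.assoc mult.commute mult.left_commute)
      qed
      ultimately show ?case by linarith
    qed
    ultimately show "\<exists>b. convergent b \<and> (\<forall>\<^sub>F n in sequentially. \<bar>Y n t x - b n\<bar> \<le> \<epsilon>)" by blast
  qed
  define X where "X t x = lim (\<lambda>n. Y n t x)" for t x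
  have X: "(\<lambda>n. Y n t x) \<longlonglongrightarrow> X t x" if "0 \<le> t" for t x
    using conv[OF that] unfolding X_def by (simp add: convergent_LIMSEQ_iff)
  have X0: "X 0 x = x" for x
    using X[of 0 x] by (simp add: Y_def start LIMSEQ_const_iff)
  have gap: "0 \<le> X t y - X t x \<and> X t y - X t x \<le> X s y - X s x" if "0 \<le> s" "s \<le> t" "x \<le> y" for s t x y
  proof
    have t: "0 \<le> t" using that by simp
    have l: "(\<lambda>n. Y n t y - Y n t x) \<longlonglongrightarrow> X t y - X t x" "(\<lambda>n. Y n s y - Y n s x) \<longlonglongrightarrow> X s y - X s x"
      by (intro tendsto_diff X t that)+
    show "0 \<le> X t y - X t x"
      by (rule LIMSEQ_le_const[OF l(1)]) (use Yc that in \<open>auto simp: contracting_def\<close>)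
    have "Y n t y - Y n t x \<le> Y n s y - Y n s x" for n
      unfolding Y_def interp_def by (rule euler_gap_decreasing[OF adm that(3) slot_mono[OF hpos that(2)]])
    then show "X t y - X t x \<le> X s y - X s x"
      by (intro LIMSEQ_le[OF l]) auto
  qed
  have time: "\<bar>X t x - X s x\<bar> \<le> 2 * c * \<bar>t - s\<bar> * spread x" if "0 \<le> s" "0 \<le> t" for s t x
  proof (rule LIMSEQ_le)
    show "(\<lambda>n. \<bar>Y n t x - Y n s x\<bar>) \<longlonglongrightarrow> \<bar>X t x - X s x\<bar>" by (intro tendsto_rabs tendsto_diff X that)
    have "(\<lambda>n. 2 * c * (\<bar>t - s\<bar> + h (r n)) * spread x) \<longlonglongrightarrow> 2 * c * (\<bar>t - s\<bar> + 0) * spread x"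
      by (intro tendsto_mult tendsto_add tendsto_const hr)
    then show "(\<lambda>n. 2 * c * (\<bar>t - s\<bar> + h (r n)) * spread x) \<longlonglongrightarrow> 2 * c * \<bar>t - s\<bar> * spread x" by simp
    show "\<exists>N. \<forall>n\<ge>N. \<bar>Y n t x - Y n s x\<bar> \<le> 2 * c * (\<bar>t - s\<bar> + h (r n)) * spread x" using Yt[OF that] by blast
  qed
  have Xc: "contracting (X t)" if "0 \<le> t" for t
    unfolding contracting_def using gap[of 0 t] that X0 by fastforce
  define W where "W n s x = drift (N (r n)) (h (r n)) (slot (h (r n)) s) x" for n s x
  have W: "W n s x = (\<integral>y. friction_cut (N (r n)) (Y n s x - Y n s y) \<partial>\<mu>)" for n s x
    unfolding W_def drift_def Y_def interp_def ..
  have Wlim: "(\<lambda>n. W n s x) \<longlonglongrightarrow> (\<integral>y. friction (X s x - X s y) \<partial>\<mu>)" if s: "0 \<le> s" for s x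
    unfolding W
  proof (rule integral_dominated_convergence[OF _ _ integrable_dist_sq[of x]])
    show "(\<lambda>y. friction (X s x - X s y)) \<in> borel_measurable \<mu>"
      by (intro meas_cont continuous_on_compose2[OF continuous_friction] continuous_on_diff continuous_on_const
          contracting_continuous[OF Xc[OF s]]) auto
    show "(\<lambda>y. friction_cut (N (r n)) (Y n s x - Y n s y)) \<in> borel_measurable \<mu>" for n
      by (intro meas_cont continuous_on_compose2[OF continuous_friction_cut] continuous_on_diff continuous_on_const
          contracting_continuous[OF Yc]) auto
    show "AE y in \<mu>. (\<lambda>n. friction_cut (N (r n)) (Y n s x - Y n s y)) \<longlonglongrightarrow> friction (X s x - X s y)"
    proof (rule AE_I2)
      fix y
      have "(\<lambda>n. friction (Y n s x - Y n s y)) \<longlonglongrightarrow> friction (X s x - X s y)"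
        unfolding friction_def by (intro tendsto_mult tendsto_rabs tendsto_diff X s)
      moreover have "\<forall>\<^sub>F n in sequentially. friction (Y n s x - Y n s y) = friction_cut (N (r n)) (Y n s x - Y n s y)"
        using eventually_ge_at_top[of "nat \<lceil>\<bar>x - y\<bar>\<rceil>"]
      proof eventually_elim
        case (elim n)
        have "\<bar>Y n s x - Y n s y\<bar> \<le> \<bar>x - y\<bar>" by (rule contracting_abs[OF Yc])
        also have "\<dots> \<le> real n" using elim by (simp add: nat_ceiling_le_eq)
        also have "\<dots> \<le> N (r n)" using seq_suble[OF r, of n] by (simp add: N_def)
        finally show ?case by (simp add: friction_cut_eq)
      qed
      ultimately show "(\<lambda>n. friction_cut (N (r n)) (Y n s x - Y n s y)) \<longlonglongrightarrow> friction (X s x - X s y)"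
        by (rule Lim_transform_eventually)
    qed
    show "AE y in \<mu>. norm (friction_cut (N (r n)) (Y n s x - Y n s y)) \<le> (x - y)\<^sup>2" for n
    proof (rule AE_I2)
      fix y
      have "\<bar>friction_cut (N (r n)) (Y n s x - Y n s y)\<bar> \<le> (Y n s x - Y n s y)\<^sup>2"
        by (rule friction_cut_abs(1)) (simp add: N_def)
      also have "\<dots> \<le> (x - y)\<^sup>2" using contracting_abs[OF Yc, of n s x y] by (simp add: abs_le_square_iff)
      finally show "norm (friction_cut (N (r n)) (Y n s x - Y n s y)) \<le> (x - y)\<^sup>2" by simp
    qed
  qed
  have int: "((\<lambda>s. velocity (X s) x) has_integral X t x - x) {0..t}" if t: "0 \<le> t" for t x
  proof -
    let ?g = "\<lambda>s. \<integral>y. friction (X s x - X s y) \<partial>\<mu>"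
    have iW: "(\<lambda>s. W n s x) integrable_on {0..t}" for n
      unfolding W_def by (rule interp_integral(1)[OF adm t])
    have bW: "norm (W n s x) \<le> spread x" for n s
      unfolding W_def using drift_bound[OF adm] by simp
    have ig: "?g integrable_on {0..t}" and lg: "(\<lambda>n. integral {0..t} (\<lambda>s. W n s x)) \<longlonglongrightarrow> integral {0..t} ?g"
      using dominated_convergence[of "\<lambda>n s. W n s x" "{0..t}" "\<lambda>_. spread x" ?g, OF iW integrable_const_ivl bW Wlim] by auto
    have "(\<lambda>n. Y n t x - (x - 2 * c * integral {0..t} (\<lambda>s. W n s x))) \<longlonglongrightarrow> X t x - (x - 2 * c * integral {0..t} ?g)"
      by (intro tendsto_diff tendsto_mult tendsto_const X t lg)
    moreover have "(\<lambda>n. Y n t x - (x - 2 * c * integral {0..t} (\<lambda>s. W n s x))) \<longlonglongrightarrow> 0"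
    proof (rule Lim_null_comparison)
      show "\<forall>\<^sub>F n in sequentially. norm (Y n t x - (x - 2 * c * integral {0..t} (\<lambda>s. W n s x))) \<le> 2 * c * h (r n) * spread x"
        unfolding Y_def W_def using interp_integral(2)[OF adm t] by simp
      have "(\<lambda>n. 2 * c * h (r n) * spread x) \<longlonglongrightarrow> 2 * c * 0 * spread x"
        by (intro tendsto_mult tendsto_const hr)
      then show "(\<lambda>n. 2 * c * h (r n) * spread x) \<longlonglongrightarrow> 0" by simp
    qed
    ultimately have "X t x - (x - 2 * c * integral {0..t} ?g) = 0" by (rule LIMSEQ_unique)
    then have "X t x - x = - 2 * c * integral {0..t} ?g" by simp
    then show ?thesis
      unfolding velocity_def using has_integral_mult_right[OF integrable_integral[OF ig], of "- 2 * c"] by simp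
  qed
  have "flow X" unfolding flow_def using X0 gap time int by blast
  then show ?thesis by blast
qed

end

section \<open>Integrals depending on time\<close>

lemma continuous_on_integral_dominated:
  fixes G :: "real \<Rightarrow> 'a \<Rightarrow> real"
  assumes c: "\<And>x. x \<in> space M \<Longrightarrow> continuous_on S (\<lambda>s. G s x)" and m: "\<And>s. s \<in> S \<Longrightarrow> G s \<in> borel_measurable M"
    and b: "\<And>s x. s \<in> S \<Longrightarrow> x \<in> space M \<Longrightarrow> \<bar>G s x\<bar> \<le> w x" and w: "integrable M w"
  shows "continuous_on S (\<lambda>s. \<integral>x. G s x \<partial>M)"
  unfolding continuous_on_sequentially
proof (intro allI ballI impI)
  fix r s assume s: "s \<in> S" and "(\<forall>n. r n \<in> S) \<and> r \<longlonglongrightarrow> s"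
  then have r: "\<And>n. r n \<in> S" "r \<longlonglongrightarrow> s" by auto
  show "((\<lambda>s. \<integral>x. G s x \<partial>M) \<circ> r) \<longlonglongrightarrow> (\<integral>x. G s x \<partial>M)"
    unfolding comp_def
  proof (rule integral_dominated_convergence[OF m[OF s] m[OF r(1)] w])
    show "AE x in M. (\<lambda>n. G (r n) x) \<longlonglongrightarrow> G s x"
    proof (rule AE_I2)
      fix x assume x: "x \<in> space M"
      show "(\<lambda>n. G (r n) x) \<longlonglongrightarrow> G s x"
        by (rule continuous_on_tendsto_compose[OF c[OF x] r(2) s]) (use r(1) in simp)
    qed
    show "AE x in M. norm (G (r n) x) \<le> w x" for n using b[OF r(1)] by simp
  qed
qed

lemma DERIV_integral_dominated:
  fixes G :: "real \<Rightarrow> 'a \<Rightarrow> real"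
  assumes S: "open S" "t \<in> S"
    and d: "\<And>x. x \<in> space M \<Longrightarrow> ((\<lambda>s. G s x) has_real_derivative G' x) (at t)"
    and i: "\<And>s. s \<in> S \<Longrightarrow> integrable M (G s)"
    and b: "\<And>s x. s \<in> S \<Longrightarrow> x \<in> space M \<Longrightarrow> \<bar>G s x - G t x\<bar> \<le> w x * \<bar>s - t\<bar>" and w: "integrable M w"
    and m: "G' \<in> borel_measurable M"
  shows "((\<lambda>s. \<integral>x. G s x \<partial>M) has_real_derivative (\<integral>x. G' x \<partial>M)) (at t)"
proof -
  have "((\<lambda>s. ((\<integral>x. G s x \<partial>M) - (\<integral>x. G t x \<partial>M)) / (s - t)) \<longlongrightarrow> (\<integral>x. G' x \<partial>M)) (at t within S)"
    unfolding tendsto_at_iff_sequentially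
  proof (intro allI impI)
    fix r assume r: "\<forall>n. r n \<in> S - {t}" "r \<longlonglongrightarrow> t"
    have lim: "(\<lambda>n. \<integral>x. (G (r n) x - G t x) / (r n - t) \<partial>M) \<longlonglongrightarrow> (\<integral>x. G' x \<partial>M)"
    proof (rule integral_dominated_convergence[OF m _ w])
      show "(\<lambda>x. (G (r n) x - G t x) / (r n - t)) \<in> borel_measurable M" for n
        using i[of "r n"] i[OF S(2)] r by auto
      show "AE x in M. (\<lambda>n. (G (r n) x - G t x) / (r n - t)) \<longlonglongrightarrow> G' x"
      proof (rule AE_I2)
        fix x assume "x \<in> space M"
        from d[OF this] have "((\<lambda>s. (G s x - G t x) / (s - t)) \<longlongrightarrow> G' x) (at t)"
          by (simp add: has_field_derivative_iff)
        from this[unfolded tendsto_at_iff_sequentially, rule_format, of r] r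
        show "(\<lambda>n. (G (r n) x - G t x) / (r n - t)) \<longlonglongrightarrow> G' x" by (auto simp: comp_def)
      qed
      show "AE x in M. norm ((G (r n) x - G t x) / (r n - t)) \<le> w x" for n
      proof (rule AE_I2)
        fix x assume x: "x \<in> space M"
        have "\<bar>r n - t\<bar> > 0" "r n \<in> S" using r by auto
        then show "norm ((G (r n) x - G t x) / (r n - t)) \<le> w x"
          using b[OF _ x, of "r n"] by (simp add: abs_divide pos_divide_le_eq)
      qed
    qed
    have eq: "(\<integral>x. (G (r n) x - G t x) / (r n - t) \<partial>M) = ((\<integral>x. G (r n) x \<partial>M) - (\<integral>x. G t x \<partial>M)) / (r n - t)" for n
    proof -
      have "r n \<in> S" using r by auto
      from Bochner_Integration.integral_diff[OF i[OF this] i[OF S(2)]] show ?thesis by simp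
    qed
    show "((\<lambda>s. ((\<integral>x. G s x \<partial>M) - (\<integral>x. G t x \<partial>M)) / (s - t)) \<circ> r) \<longlonglongrightarrow> (\<integral>x. G' x \<partial>M)"
      using lim unfolding eq comp_def .
  qed
  then show ?thesis unfolding has_field_derivative_iff at_within_open[OF S(2,1)] .
qed

text \<open>
  Along a moving particle both variables of a test function change, which calls for its total
  derivative; one continuous partial derivative suffices for that.
\<close>

lemma has_derivative_two_variables:
  fixes \<phi> :: "real \<Rightarrow> real \<Rightarrow> real"
  assumes d1: "\<And>t v. ((\<lambda>s. \<phi> s v) has_real_derivative \<phi>1 t v) (at t)"
    and d2: "\<And>t v. (\<phi> t has_real_derivative \<phi>2 t v) (at v)"
    and c2: "continuous_on UNIV (\<lambda>(t, v). \<phi>2 t v)"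
  shows "((\<lambda>(x, y). \<phi> x y) has_derivative (\<lambda>p. \<phi>1 t v * fst p + \<phi>2 t v * snd p)) (at (t, v))"
proof -
  have "((\<lambda>(x, y). \<phi> x y) has_derivative (\<lambda>(tx, ty). \<phi>1 t v * tx + blinfun_mult_right (\<phi>2 t v) ty))
      (at (t, v) within UNIV \<times> UNIV)"
  proof (rule has_derivative_partialsI)
    show "((\<lambda>x. \<phi> x v) has_derivative (*) (\<phi>1 t v)) (at t)"
      using d1[of v t] by (simp add: has_field_derivative_def)
    show "(\<phi> x has_derivative blinfun_apply (blinfun_mult_right (\<phi>2 x y))) (at y)" for x y
      using d2[of x y] by (simp add: has_field_derivative_def)
    have "continuous_on UNIV (\<lambda>p. blinfun_mult_right (case p of (t, v) \<Rightarrow> \<phi>2 t v))"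
      by (rule bounded_linear.continuous_on[OF bounded_linear_blinfun_mult_right c2])
    moreover have "(\<lambda>p. blinfun_mult_right (case p of (t, v) \<Rightarrow> \<phi>2 t v)) = (\<lambda>(x, y). blinfun_mult_right (\<phi>2 x y))"
      by auto
    ultimately show "continuous (at (t, v) within UNIV \<times> UNIV) (\<lambda>(x, y). blinfun_mult_right (\<phi>2 x y))"
      by (simp only: continuous_on_eq_continuous_at open_UNIV UNIV_Times_UNIV) simp
  qed auto
  then show ?thesis by (simp add: case_prod_beta')
qed

lemma DERIV_two_variables:
  fixes \<phi> :: "real \<Rightarrow> real \<Rightarrow> real"
  assumes d1: "\<And>t v. ((\<lambda>s. \<phi> s v) has_real_derivative \<phi>1 t v) (at t)"
    and d2: "\<And>t v. (\<phi> t has_real_derivative \<phi>2 t v) (at v)"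
    and c2: "continuous_on UNIV (\<lambda>(t, v). \<phi>2 t v)"
    and Y: "(Y has_real_derivative y') (at s)"
  shows "((\<lambda>s. \<phi> s (Y s)) has_real_derivative \<phi>1 s (Y s) + \<phi>2 s (Y s) * y') (at s)"
proof -
  have "((\<lambda>s. (s, Y s)) has_derivative (\<lambda>h. (h, y' * h))) (at s)"
    by (intro has_derivative_Pair has_derivative_ident Y[unfolded has_field_derivative_def])
  from has_derivative_compose[OF this has_derivative_two_variables[OF d1 d2 c2, of s "Y s"]]
  have "((\<lambda>s. \<phi> s (Y s)) has_derivative (\<lambda>h. \<phi>1 s (Y s) * h + \<phi>2 s (Y s) * (y' * h))) (at s)" by simp
  moreover have "(\<lambda>h. \<phi>1 s (Y s) * h + \<phi>2 s (Y s) * (y' * h)) = (*) (\<phi>1 s (Y s) + \<phi>2 s (Y s) * y')"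
    by (auto simp: algebra_simps)
  ultimately show ?thesis by (simp add: has_field_derivative_def)
qed

section \<open>Properties of the flow\<close>

text \<open>
  The friction constant is linked to the coefficient of restitution here, so that the friction is the
  drift that the weight \<open>sigma_e\<close> produces.
\<close>

locale friction_flow = centred_law +
  fixes X :: "real \<Rightarrow> real \<Rightarrow> real" and e :: real
  assumes flow: "flow X" and e: "0 \<le> e" "e < 1" and c_eq: "c = (1 - e) / 4"
begin

lemma X0: "X 0 x = x" using flow by (simp add: flow_def)

lemma X_gap: "0 \<le> s \<Longrightarrow> s \<le> t \<Longrightarrow> x \<le> y \<Longrightarrow> 0 \<le> X t y - X t x \<and> X t y - X t x \<le> X s y - X s x"
  using flow by (simp add: flow_def)

lemma X_dist_mono: "0 \<le> s \<Longrightarrow> s \<le> t \<Longrightarrow> \<bar>X t x - X t y\<bar> \<le> \<bar>X s x - X s y\<bar>"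
proof -
  assume "0 \<le> s" "s \<le> t"
  then have "x \<le> y \<Longrightarrow> ?thesis" "y \<le> x \<Longrightarrow> ?thesis" using X_gap[of s t x y] X_gap[of s t y x] by linarith+
  then show ?thesis by linarith
qed

lemma X_dist: "0 \<le> t \<Longrightarrow> \<bar>X t x - X t y\<bar> \<le> \<bar>x - y\<bar>"
  using X_dist_mono[of 0 t x y] by (simp add: X0)

lemma X_time: "0 \<le> s \<Longrightarrow> 0 \<le> t \<Longrightarrow> \<bar>X t x - X s x\<bar> \<le> 2 * c * \<bar>t - s\<bar> * spread x"
  using flow by (simp add: flow_def)

lemma X_integral: "0 \<le> t \<Longrightarrow> ((\<lambda>s. velocity (X s) x) has_integral X t x - x) {0..t}"
  using flow by (simp add: flow_def)

lemma X_cont: "0 \<le> t \<Longrightarrow> continuous_on S (X t)"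
  by (rule lip1_continuous) (simp add: lip1_def X_dist)

lemma X_meas: "0 \<le> t \<Longrightarrow> X t \<in> borel_measurable \<mu>"
  by (intro meas_cont X_cont)

lemma X_cont_time: "continuous_on {0..} (\<lambda>t. X t x)"
proof -
  have "(2 * c * spread x)-lipschitz_on {0..} (\<lambda>t. X t x)"
  proof (rule lipschitz_onI)
    fix t s :: real assume "t \<in> {0..}" "s \<in> {0..}"
    then show "dist (X t x) (X s x) \<le> 2 * c * spread x * dist t s"
      using X_time[of s t x] by (simp add: dist_real_def ac_simps)
  qed (use c spread_nonneg in simp)
  then show ?thesis by (rule lipschitz_on_continuous_on)
qed

lemma friction_X_bound: "0 \<le> t \<Longrightarrow> \<bar>friction (X t x - X t y)\<bar> \<le> (x - y)\<^sup>2"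
  unfolding friction_abs using X_dist[of t x y] by (simp add: abs_le_square_iff)

lemma integrable_friction_X: "0 \<le> t \<Longrightarrow> integrable \<mu> (\<lambda>y. friction (X t x - X t y))"
proof (rule Bochner_Integration.integrable_bound[OF integrable_dist_sq[of x]])
  assume t: "0 \<le> t"
  show "(\<lambda>y. friction (X t x - X t y)) \<in> borel_measurable \<mu>"
    by (intro meas_cont continuous_on_compose2[OF continuous_friction] continuous_on_diff continuous_on_const X_cont t) auto
  show "AE y in \<mu>. norm (friction (X t x - X t y)) \<le> norm ((x - y)\<^sup>2)"
    using friction_X_bound[OF t] by simp
qed

lemma velocity_bound: "0 \<le> t \<Longrightarrow> \<bar>velocity (X t) x\<bar> \<le> 2 * c * spread x"
proof -
  assume t: "0 \<le> t"
  have "\<bar>\<integral>y. friction (X t x - X t y) \<partial>\<mu>\<bar> \<le> (\<integral>y. \<bar>friction (X t x - X t y)\<bar> \<partial>\<mu>)" by (rule integral_abs_bound)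
  also have "\<dots> \<le> spread x" unfolding spread_def
    by (intro integral_mono integrable_abs integrable_friction_X integrable_dist_sq friction_X_bound t)
  finally show ?thesis using c by (simp add: velocity_def abs_mult)
qed

lemma velocity_cont_time: "continuous_on {0..} (\<lambda>t. velocity (X t) x)"
  unfolding velocity_def
proof (intro continuous_on_mult continuous_on_const continuous_on_integral_dominated[OF _ _ _ integrable_dist_sq[of x]])
  show "continuous_on {0..} (\<lambda>s. friction (X s x - X s y))" for y
    by (intro continuous_on_compose2[OF continuous_friction] continuous_on_diff X_cont_time) auto
  show "(\<lambda>y. friction (X s x - X s y)) \<in> borel_measurable \<mu>" if "s \<in> {0..}" for s
    using integrable_friction_X[of s x] that by auto
  show "\<bar>friction (X s x - X s y)\<bar> \<le> (x - y)\<^sup>2" if "s \<in> {0..}" for s y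
    using friction_X_bound[of s x y] that by simp
qed

lemma velocity_cont: "0 \<le> t \<Longrightarrow> continuous_on UNIV (velocity (X t))"
proof -
  assume t: "0 \<le> t"
  have "continuous_on {-L<..<L} (velocity (X t))" for L
    unfolding velocity_def
  proof (intro continuous_on_mult continuous_on_const continuous_on_integral_dominated)
    show "continuous_on {-L<..<L} (\<lambda>x. friction (X t x - X t y))" for y
      by (intro continuous_on_compose2[OF continuous_friction] continuous_on_diff X_cont t continuous_on_const) auto
    show "(\<lambda>y. friction (X t x - X t y)) \<in> borel_measurable \<mu>" for x
      using integrable_friction_X[OF t, of x] by auto
    show "integrable \<mu> (\<lambda>y. 2 * L\<^sup>2 + 2 * y\<^sup>2)" using sq by auto
    fix x y assume x: "x \<in> {-L<..<L}"
    have "\<bar>friction (X t x - X t y)\<bar> \<le> (x - y)\<^sup>2" by (rule friction_X_bound[OF t])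
    also have "\<dots> \<le> 2 * x\<^sup>2 + 2 * y\<^sup>2" using zero_le_power2[of "x + y"] by (simp add: power2_eq_square algebra_simps)
    also have "x\<^sup>2 \<le> L\<^sup>2" using x by (intro abs_le_square_iff[THEN iffD1]) auto
    finally show "\<bar>friction (X t x - X t y)\<bar> \<le> 2 * L\<^sup>2 + 2 * y\<^sup>2" by simp
  qed
  then have "continuous_on (\<Union>L. {-L<..<L}) (velocity (X t))"
    by (intro continuous_on_open_UN) auto
  moreover have "(\<Union>L. {-L<..<L}) = (UNIV :: real set)"
  proof -
    have "x \<in> {- (\<bar>x\<bar> + 1)<..<\<bar>x\<bar> + 1}" for x :: real by auto
    then show ?thesis by blast
  qed
  ultimately show ?thesis by simp
qed

lemma X_deriv: "0 < t \<Longrightarrow> ((\<lambda>t. X t x) has_real_derivative velocity (X t) x) (at t)"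
proof -
  assume t: "0 < t"
  have "((\<lambda>u. integral {0..u} (\<lambda>s. velocity (X s) x)) has_real_derivative velocity (X t) x) (at t within {0..t + 1})"
    using t by (intro integral_has_real_derivative continuous_on_subset[OF velocity_cont_time]) auto
  then have "((\<lambda>u. integral {0..u} (\<lambda>s. velocity (X s) x)) has_real_derivative velocity (X t) x) (at t)"
    using t at_within_interior[of t "{0..t + 1}"] by (simp add: interior_atLeastAtMost_real)
  then have "((\<lambda>u. x + integral {0..u} (\<lambda>s. velocity (X s) x)) has_real_derivative velocity (X t) x) (at t)"
    using DERIV_add[OF DERIV_const[of x]] by fastforce
  then show ?thesis
  proof (rule has_field_derivative_transform_within_open[of _ _ _ "{0<..}"])
    fix u :: real assume "u \<in> {0<..}"
    then have "integral {0..u} (\<lambda>s. velocity (X s) x) = X u x - x"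
      by (intro integral_unique X_integral) simp
    then show "x + integral {0..u} (\<lambda>s. velocity (X s) x) = X u x" by simp
  qed (use t in auto)
qed

lemma integrable_dist_sq2: "integrable (\<mu> \<Otimes>\<^sub>M \<mu>) (\<lambda>z. (fst z - snd z)\<^sup>2)"
proof -
  have "integrable (\<mu> \<Otimes>\<^sub>M \<mu>) (\<lambda>z. 2 * (fst z)\<^sup>2 + 2 * (snd z)\<^sup>2)"
    using integrable_prod_fst_snd(1,2)[OF bp sq] by auto
  then show ?thesis
  proof (rule Bochner_Integration.integrable_bound)
    show "(\<lambda>z. (fst z - snd z)\<^sup>2) \<in> borel_measurable (\<mu> \<Otimes>\<^sub>M \<mu>)"
      by (intro borel_measurable_prod_borel_prob[OF bp] borel_measurable_continuous_onI continuous_intros)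
    show "AE z in \<mu> \<Otimes>\<^sub>M \<mu>. norm ((fst z - snd z)\<^sup>2) \<le> norm (2 * (fst z)\<^sup>2 + 2 * (snd z)\<^sup>2)"
    proof (rule AE_I2)
      fix z :: "real \<times> real"
      have "(fst z - snd z)\<^sup>2 \<le> 2 * (fst z)\<^sup>2 + 2 * (snd z)\<^sup>2"
        using zero_le_power2[of "fst z + snd z"] by (simp add: power2_eq_square algebra_simps)
      then show "norm ((fst z - snd z)\<^sup>2) \<le> norm (2 * (fst z)\<^sup>2 + 2 * (snd z)\<^sup>2)" by simp
    qed
  qed
qed

sublocale sq: pair_prob_space \<mu> \<mu> ..

lemma meas2_cont: "continuous_on UNIV h \<Longrightarrow> (h :: real \<times> real \<Rightarrow> real) \<in> borel_measurable (\<mu> \<Otimes>\<^sub>M \<mu>)"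
  by (intro borel_measurable_prod_borel_prob[OF bp] borel_measurable_continuous_onI)

lemma X_cont_fst: "0 \<le> t \<Longrightarrow> continuous_on UNIV (\<lambda>z::real \<times> real. X t (fst z))"
  and X_cont_snd: "0 \<le> t \<Longrightarrow> continuous_on UNIV (\<lambda>z::real \<times> real. X t (snd z))"
  by (auto intro!: continuous_on_compose2[OF X_cont[of t UNIV]] continuous_intros)

text \<open>
  Exchanging the two particles turns the friction force tested with one particle into the
  friction tested with the difference of both.
\<close>

lemma friction_pairing:
  assumes t: "0 \<le> t" and Q: "continuous_on UNIV Q" "\<And>x. \<bar>Q x\<bar> \<le> P"
  shows "integrable (\<mu> \<Otimes>\<^sub>M \<mu>) (\<lambda>z. friction (X t (fst z) - X t (snd z)) * (Q (snd z) - Q (fst z)))"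
    "c * (\<integral>z. friction (X t (fst z) - X t (snd z)) * (Q (snd z) - Q (fst z)) \<partial>(\<mu> \<Otimes>\<^sub>M \<mu>)) = (\<integral>x. Q x * velocity (X t) x \<partial>\<mu>)"
proof -
  let ?F = "\<lambda>z. friction (X t (fst z) - X t (snd z))"
  have P0: "0 \<le> P" using Q(2)[of 0] by linarith
  have cQ: "continuous_on UNIV (\<lambda>z::real \<times> real. Q (fst z))" "continuous_on UNIV (\<lambda>z::real \<times> real. Q (snd z))"
    by (auto intro!: continuous_on_compose2[OF Q(1)] continuous_intros)
  have cF: "continuous_on UNIV ?F"
    by (intro continuous_on_compose2[OF continuous_friction] continuous_on_diff X_cont_fst X_cont_snd t) auto
  have iG: "integrable (\<mu> \<Otimes>\<^sub>M \<mu>) (\<lambda>z. ?F z * q z)"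
    if q: "continuous_on UNIV q" "\<And>z. \<bar>q z\<bar> \<le> P" for q
  proof (rule Bochner_Integration.integrable_bound)
    show "integrable (\<mu> \<Otimes>\<^sub>M \<mu>) (\<lambda>z. (fst z - snd z)\<^sup>2 * P)" using integrable_dist_sq2 by simp
    show "(\<lambda>z. ?F z * q z) \<in> borel_measurable (\<mu> \<Otimes>\<^sub>M \<mu>)"
      by (intro meas2_cont continuous_on_mult cF q)
    show "AE z in \<mu> \<Otimes>\<^sub>M \<mu>. norm (?F z * q z) \<le> norm ((fst z - snd z)\<^sup>2 * P)"
      using friction_X_bound[OF t] q(2) P0 by (intro AE_I2) (auto simp: abs_mult intro!: mult_mono)
  qed
  have i1: "integrable (\<mu> \<Otimes>\<^sub>M \<mu>) (\<lambda>z. ?F z * Q (fst z))" and i2: "integrable (\<mu> \<Otimes>\<^sub>M \<mu>) (\<lambda>z. ?F z * Q (snd z))"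
    by (rule iG[OF cQ(1)], rule Q) (rule iG[OF cQ(2)], rule Q)
  show "integrable (\<mu> \<Otimes>\<^sub>M \<mu>) (\<lambda>z. ?F z * (Q (snd z) - Q (fst z)))"
    unfolding right_diff_distrib by (rule Bochner_Integration.integrable_diff[OF i2 i1])
  have "(\<integral>z. ?F z * Q (snd z) \<partial>(\<mu> \<Otimes>\<^sub>M \<mu>)) = (\<integral>z. - (?F z * Q (fst z)) \<partial>(\<mu> \<Otimes>\<^sub>M \<mu>))"
  proof -
    have "(\<integral>z. ?F z * Q (snd z) \<partial>(\<mu> \<Otimes>\<^sub>M \<mu>)) = (\<integral>(x, y). ?F (y, x) * Q (snd (y, x)) \<partial>(\<mu> \<Otimes>\<^sub>M \<mu>))"
      using i2 by (subst sq.integral_product_swap[symmetric]) auto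
    also have "\<dots> = (\<integral>z. - (?F z * Q (fst z)) \<partial>(\<mu> \<Otimes>\<^sub>M \<mu>))"
    proof (rule Bochner_Integration.integral_cong[OF refl])
      fix z :: "real \<times> real"
      show "(case z of (x, y) \<Rightarrow> ?F (y, x) * Q (snd (y, x))) = - (?F z * Q (fst z))"
        using friction_odd[of "X t (fst z) - X t (snd z)"] by (simp add: split_beta)
    qed
    finally show ?thesis .
  qed
  then have "(\<integral>z. ?F z * (Q (snd z) - Q (fst z)) \<partial>(\<mu> \<Otimes>\<^sub>M \<mu>)) = - 2 * (\<integral>z. ?F z * Q (fst z) \<partial>(\<mu> \<Otimes>\<^sub>M \<mu>))"
    unfolding right_diff_distrib by (simp add: Bochner_Integration.integral_diff[OF i2 i1])
  also have "(\<integral>z. ?F z * Q (fst z) \<partial>(\<mu> \<Otimes>\<^sub>M \<mu>)) = (\<integral>x. (\<integral>y. friction (X t x - X t y) * Q x \<partial>\<mu>) \<partial>\<mu>)"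
    using sq.integral_fst'[OF i1] by simp
  also have "\<dots> = (\<integral>x. (\<integral>y. friction (X t x - X t y) \<partial>\<mu>) * Q x \<partial>\<mu>)" by simp
  finally have "c * (\<integral>z. ?F z * (Q (snd z) - Q (fst z)) \<partial>(\<mu> \<Otimes>\<^sub>M \<mu>))
      = - 2 * c * (\<integral>x. (\<integral>y. friction (X t x - X t y) \<partial>\<mu>) * Q x \<partial>\<mu>)" by simp
  also have "\<dots> = (\<integral>x. - 2 * c * ((\<integral>y. friction (X t x - X t y) \<partial>\<mu>) * Q x) \<partial>\<mu>)" by (rule integral_mult_right_zero[symmetric])
  also have "\<dots> = (\<integral>x. Q x * velocity (X t) x \<partial>\<mu>)"
    unfolding velocity_def by (intro Bochner_Integration.integral_cong) auto
  finally show "c * (\<integral>z. ?F z * (Q (snd z) - Q (fst z)) \<partial>(\<mu> \<Otimes>\<^sub>M \<mu>)) = (\<integral>x. Q x * velocity (X t) x \<partial>\<mu>)" .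
qed

lemma velocity_meas: "0 \<le> t \<Longrightarrow> velocity (X t) \<in> borel_measurable \<mu>"
  by (intro meas_cont velocity_cont)

lemma X_near: "0 \<le> t \<Longrightarrow> \<bar>X t x\<bar> \<le> \<bar>x\<bar> + 2 * c * t * spread x"
  using X_time[of 0 t x] by (simp add: X0)

lemma integrable_X: "0 \<le> t \<Longrightarrow> integrable \<mu> (X t)"
proof -
  assume t: "0 \<le> t"
  have "integrable \<mu> (\<lambda>x. \<bar>x\<bar> + 2 * c * t * spread x)" using integrable_id integrable_spread by auto
  then show ?thesis
  proof (rule Bochner_Integration.integrable_bound[OF _ X_meas[OF t]], intro AE_I2)
    show "norm (X t x) \<le> norm (\<bar>x\<bar> + 2 * c * t * spread x)" for x
      using X_near[OF t, of x] by simp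
  qed
qed

text \<open>
  The friction force is odd in the exchange of two particles, so total momentum is conserved.
\<close>

lemma X_mean: "0 \<le> t \<Longrightarrow> (\<integral>x. X t x \<partial>\<mu>) = 0"
proof -
  assume t: "0 \<le> t"
  define m where "m t = (\<integral>x. X t x \<partial>\<mu>)" for t
  have v0: "(\<integral>x. velocity (X s) x \<partial>\<mu>) = 0" if "0 \<le> s" for s
    using friction_pairing(2)[OF that, of "\<lambda>_. 1" 1] by simp
  have d: "(m has_real_derivative 0) (at s)" if s: "0 < s" for s
  proof -
    have "(m has_real_derivative (\<integral>x. velocity (X s) x \<partial>\<mu>)) (at s)"
      unfolding m_def
    proof (rule DERIV_integral_dominated[of "{0<..}"])
      show "((\<lambda>s. X s x) has_real_derivative velocity (X s) x) (at s)" for x by (rule X_deriv[OF s])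
      show "integrable \<mu> (X r)" if "r \<in> {0<..}" for r using integrable_X that by simp
      show "\<bar>X r x - X s x\<bar> \<le> 2 * c * spread x * \<bar>r - s\<bar>" if "r \<in> {0<..}" for r x
        using X_time[of s r x] s that by (simp add: ac_simps)
      show "integrable \<mu> (\<lambda>x. 2 * c * spread x)" using integrable_spread by simp
    qed (use s velocity_meas in auto)
    then show ?thesis using v0 s by simp
  qed
  have cm: "continuous_on {0..t} m"
    unfolding m_def
  proof (rule continuous_on_integral_dominated)
    show "continuous_on {0..t} (\<lambda>s. X s x)" for x by (rule continuous_on_subset[OF X_cont_time]) auto
    show "X s \<in> borel_measurable \<mu>" if "s \<in> {0..t}" for s using X_meas that by simp
    show "\<bar>X s x\<bar> \<le> \<bar>x\<bar> + 2 * c * t * spread x" if "s \<in> {0..t}" for s x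
    proof -
      have "2 * c * s * spread x \<le> 2 * c * t * spread x"
        using that c spread_nonneg[of x] by (intro mult_right_mono mult_left_mono) auto
      then show ?thesis using X_near[of s x] that by simp
    qed
    show "integrable \<mu> (\<lambda>x. \<bar>x\<bar> + 2 * c * t * spread x)" using integrable_id integrable_spread by auto
  qed
  have "m t = m 0"
  proof (cases "t = 0")
    case False
    then show ?thesis using DERIV_isconst_end[of 0 t m] cm d t by auto
  qed simp
  then show ?thesis using mean by (simp add: m_def X0)
qed

text \<open>
  The gap between two particles solves a Riccati inequality, so it is bounded at positive times
  independently of the initial law.
\<close>

lemma gap_decay: "0 < t \<Longrightarrow> \<bar>X t x - X t y\<bar> \<le> 1 / (c * t)"
proof -
  assume t: "0 < t"
  have main: "X t y - X t x \<le> 1 / (c * t)" if xy: "x \<le> y" for x y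
  proof (rule ccontr)
    assume n: "\<not> ?thesis"
    define g where "g s = X s y - X s x" for s
    have gt: "1 / (c * t) < g t" using n by (simp add: g_def)
    then have gp: "0 < g s" if "0 \<le> s" "s \<le> t" for s
    proof -
      have "0 < 1 / (c * t)" using c t by simp
      moreover have "g t \<le> g s" using X_gap[OF that xy] by (simp add: g_def)
      ultimately show ?thesis using gt by linarith
    qed
    have gd: "(g has_real_derivative (velocity (X s) y - velocity (X s) x)) (at s)" if "0 < s" for s
      unfolding g_def by (intro DERIV_diff X_deriv that)
    have Riccati: "velocity (X s) y - velocity (X s) x \<le> - c * (g s)\<^sup>2" if s: "0 \<le> s" for s
    proof -
      have g0: "0 \<le> g s" using X_gap[of s s x y] s xy by (simp add: g_def)
      have "(g s)\<^sup>2 / 2 = (\<integral>z. (g s)\<^sup>2 / 2 \<partial>\<mu>)" by (simp add: prob_space)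
      also have "\<dots> \<le> (\<integral>z. friction (X s y - X s z) - friction (X s x - X s z) \<partial>\<mu>)"
      proof (rule integral_mono)
        show "integrable \<mu> (\<lambda>z. friction (X s y - X s z) - friction (X s x - X s z))"
          by (intro Bochner_Integration.integrable_diff integrable_friction_X s)
        show "(g s)\<^sup>2 / 2 \<le> friction (X s y - X s z) - friction (X s x - X s z)" for z
          using friction_gap[OF g0, of "X s x - X s z"] by (simp add: g_def)
      qed simp
      also have "\<dots> = (\<integral>z. friction (X s y - X s z) \<partial>\<mu>) - (\<integral>z. friction (X s x - X s z) \<partial>\<mu>)"
        by (rule Bochner_Integration.integral_diff[OF integrable_friction_X[OF s] integrable_friction_X[OF s]])
      finally have "2 * c * ((g s)\<^sup>2 / 2) \<le> 2 * c * ((\<integral>z. friction (X s y - X s z) \<partial>\<mu>) - (\<integral>z. friction (X s x - X s z) \<partial>\<mu>))"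
        using c by (intro mult_left_mono) auto
      then show ?thesis by (simp add: velocity_def algebra_simps)
    qed
    \<comment> \<open>the reciprocal of the gap grows at least linearly, with slope c\<close>
    have "inverse (g 0) - c * 0 \<le> inverse (g t) - c * t"
    proof (rule DERIV_nonneg_imp_increasing_open[of 0 t "\<lambda>s. inverse (g s) - c * s"])
      show "0 \<le> t" using t by simp
      have "continuous_on {0..t} g" unfolding g_def
        by (intro continuous_on_diff continuous_on_subset[OF X_cont_time]) auto
      moreover have "\<And>s. s \<in> {0..t} \<Longrightarrow> g s \<noteq> 0" using gp by force
      ultimately show "continuous_on {0..t} (\<lambda>s. inverse (g s) - c * s)"
        by (intro continuous_on_diff continuous_on_inverse continuous_on_mult continuous_on_const continuous_on_id) auto
      fix s assume s: "0 < s" "s < t"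
      have g: "0 < g s" using gp s by simp
      have "((\<lambda>s. inverse (g s) - c * s) has_real_derivative
          - (inverse (g s) * (velocity (X s) y - velocity (X s) x) * inverse (g s)) - c * 1) (at s)"
        using g by (intro DERIV_diff DERIV_inverse' gd s DERIV_cmult DERIV_ident) auto
      moreover have "0 \<le> - (inverse (g s) * (velocity (X s) y - velocity (X s) x) * inverse (g s)) - c * 1"
      proof -
        have "c = inverse (g s) * (c * (g s)\<^sup>2) * inverse (g s)" using g by (simp add: power2_eq_square field_simps)
        also have "\<dots> \<le> inverse (g s) * (- (velocity (X s) y - velocity (X s) x)) * inverse (g s)"
          using Riccati[of s] s g by (intro mult_right_mono mult_left_mono) auto
        also have "\<dots> = - (inverse (g s) * (velocity (X s) y - velocity (X s) x) * inverse (g s))"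
          by (simp only: mult_minus_left mult_minus_right)
        finally show ?thesis by simp
      qed
      ultimately show "\<exists>d. ((\<lambda>s. inverse (g s) - c * s) has_real_derivative d) (at s) \<and> 0 \<le> d" by blast
    qed
    moreover have "0 < inverse (g 0)" using gp[of 0] t by simp
    ultimately have "c * t < inverse (g t)" by linarith
    moreover have "inverse (g t) < c * t"
    proof -
      have "inverse (g t) < inverse (1 / (c * t))" using gt c t by (intro less_imp_inverse_less) auto
      then show ?thesis by simp
    qed
    ultimately show False by simp
  qed
  show ?thesis using main[of x y] main[of y x] X_gap[of t t x y] X_gap[of t t y x] t by (cases "x \<le> y") auto
qed

text \<open>
  As the mean is zero, the position of a particle is its average distance to all others, with sign.
  Bounds for gaps therefore are bounds for positions.
\<close>

lemma X_centre: "0 \<le> t \<Longrightarrow> X t x = (\<integral>y. X t x - X t y \<partial>\<mu>)"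
proof -
  assume t: "0 \<le> t"
  have "(\<integral>y. X t x - X t y \<partial>\<mu>) = (\<integral>y. X t x \<partial>\<mu>) - (\<integral>y. X t y \<partial>\<mu>)"
    by (rule Bochner_Integration.integral_diff[OF integrable_const integrable_X[OF t]])
  then show ?thesis by (simp add: prob_space X_mean[OF t])
qed

lemma X_decay: "0 < t \<Longrightarrow> \<bar>X t x\<bar> \<le> 1 / (c * t)"
proof -
  assume t: "0 < t"
  have "\<bar>X t x\<bar> \<le> (\<integral>y. \<bar>X t x - X t y\<bar> \<partial>\<mu>)"
  proof -
    have "\<bar>\<integral>y. X t x - X t y \<partial>\<mu>\<bar> \<le> (\<integral>y. \<bar>X t x - X t y\<bar> \<partial>\<mu>)" by (rule integral_abs_bound)
    then show ?thesis using X_centre[of t x] t by simp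
  qed
  also have "\<dots> \<le> (\<integral>y. 1 / (c * t) \<partial>\<mu>)"
    using integrable_X[of t] t gap_decay[OF t] by (intro integral_mono) auto
  finally show ?thesis by (simp add: prob_space)
qed

lemma X_growth: "0 \<le> t \<Longrightarrow> \<bar>X t x\<bar> \<le> \<bar>x\<bar> + (\<integral>y. \<bar>y\<bar> \<partial>\<mu>)"
proof -
  assume t: "0 \<le> t"
  have "\<bar>X t x\<bar> \<le> (\<integral>y. \<bar>X t x - X t y\<bar> \<partial>\<mu>)"
  proof -
    have "\<bar>\<integral>y. X t x - X t y \<partial>\<mu>\<bar> \<le> (\<integral>y. \<bar>X t x - X t y\<bar> \<partial>\<mu>)" by (rule integral_abs_bound)
    then show ?thesis using X_centre[of t x] t by simp
  qed
  also have "\<dots> \<le> (\<integral>y. \<bar>x\<bar> + \<bar>y\<bar> \<partial>\<mu>)"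
  proof (rule integral_mono)
    show "\<bar>X t x - X t y\<bar> \<le> \<bar>x\<bar> + \<bar>y\<bar>" for y using X_dist[OF t, of x y] abs_triangle_ineq4[of x y] by linarith
  qed (use integrable_X[OF t] integrable_id in auto)
  also have "\<dots> = \<bar>x\<bar> + (\<integral>y. \<bar>y\<bar> \<partial>\<mu>)" using integrable_id by (simp add: prob_space)
  finally show ?thesis .
qed

end

section \<open>The curve of laws and its fluxes\<close>

lemma integral_tensor:
  fixes h :: "real \<times> real \<Rightarrow> real"
  assumes f: "f \<in> borel_prob" and d: "\<And>z. z \<notin> offdiag \<Longrightarrow> h z = 0"
  shows "integrable (tensor f) h \<longleftrightarrow> integrable (f \<Otimes>\<^sub>M f) h"
    "(\<integral>z. h z \<partial>tensor f) = (\<integral>z. h z \<partial>(f \<Otimes>\<^sub>M f))"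
proof -
  have m: "offdiag \<inter> space (f \<Otimes>\<^sub>M f) \<in> sets (f \<Otimes>\<^sub>M f)"
    using offdiag_sets sets_prod_borel_prob[OF f] by (metis sets.Int sets.top)
  have eq: "(\<lambda>z. indicator offdiag z *\<^sub>R h z) = h"
  proof
    fix z show "indicator offdiag z *\<^sub>R h z = h z" by (cases "z \<in> offdiag") (simp_all add: d)
  qed
  show "integrable (tensor f) h \<longleftrightarrow> integrable (f \<Otimes>\<^sub>M f) h"
    unfolding tensor_def integrable_restrict_space[OF m] eq ..
  show "(\<integral>z. h z \<partial>tensor f) = (\<integral>z. h z \<partial>(f \<Otimes>\<^sub>M f))"
    unfolding tensor_def integral_restrict_space[OF m] eq ..
qed

lemma continuous_two_variables:
  fixes \<phi> :: "real \<Rightarrow> real \<Rightarrow> real"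
  assumes d1: "\<And>t v. ((\<lambda>s. \<phi> s v) has_real_derivative \<phi>1 t v) (at t)"
    and d2: "\<And>t v. (\<phi> t has_real_derivative \<phi>2 t v) (at v)"
    and c2: "continuous_on UNIV (\<lambda>(t, v). \<phi>2 t v)"
  shows "continuous_on UNIV (\<lambda>(t, v). \<phi> t v)"
proof (rule continuous_at_imp_continuous_on, intro ballI)
  fix p :: "real \<times> real"
  obtain t v where p: "p = (t, v)" by (cases p)
  show "isCont (\<lambda>(t, v). \<phi> t v) p"
    unfolding p using has_derivative_continuous[OF has_derivative_two_variables[OF d1 d2 c2, of t v]] .
qed

lemma continuous_interval_bounded:
  fixes k :: "real \<Rightarrow> real"
  assumes "continuous_on {a..b} k" shows "\<exists>K. \<forall>s\<in>{a..b}. \<bar>k s\<bar> \<le> K"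
proof -
  have "compact (k ` {a..b})" using assms by (intro compact_continuous_image) auto
  then have "bounded (k ` {a..b})" by (rule compact_imp_bounded)
  then show ?thesis by (auto simp: bounded_iff)
qed

lemma compact_support_bounded:
  fixes g :: "'a::t2_space \<Rightarrow> real"
  assumes "continuous_on K g" "compact K" "\<And>x. x \<notin> K \<Longrightarrow> g x = 0"
  shows "\<exists>B. \<forall>x. \<bar>g x\<bar> \<le> B"
proof -
  have "compact (g ` K)" using assms by (intro compact_continuous_image)
  then have "bounded (g ` K)" by (rule compact_imp_bounded)
  then obtain B where B: "\<And>x. x \<in> K \<Longrightarrow> \<bar>g x\<bar> \<le> B" by (auto simp: bounded_iff)
  have "\<bar>g x\<bar> \<le> \<bar>B\<bar>" for x
    using B[of x] assms(3)[of x] by (cases "x \<in> K") auto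
  then show ?thesis by blast
qed

context friction_flow
begin

definition law :: "real \<Rightarrow> real measure" where "law t = distr \<mu> borel (X t)"

text \<open>
  For \<open>k = 1\<close> this is the flux of the flow in its own time; a change of time multiplies
  the flux by its speed \<open>k\<close>.
\<close>

definition flux :: "real \<Rightarrow> real \<Rightarrow> (real \<times> real) set \<Rightarrow> real" where
  "flux k t = density_flux (tensor (law t)) (\<lambda>p. k * (fst p - snd p))"

definition pair_at :: "real \<Rightarrow> real \<times> real \<Rightarrow> real \<times> real" where
  "pair_at t z = (X t (fst z), X t (snd z))"

lemma law_borel_prob: "0 \<le> t \<Longrightarrow> law t \<in> borel_prob"
  unfolding borel_prob_def law_def using X_meas by (auto intro: prob_space_distr)

lemma law_0: "law 0 = \<mu>"
proof -
  have "X 0 = (\<lambda>x. x)" using X0 by auto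
  then show ?thesis unfolding law_def using distr_id2[of borel \<mu>] borel_probD(1)[OF bp] by simp
qed

lemma integral_law:
  fixes h :: "real \<Rightarrow> real"
  assumes "0 \<le> t" "h \<in> borel_measurable borel"
  shows "(\<integral>v. h v \<partial>law t) = (\<integral>x. h (X t x) \<partial>\<mu>)" "integrable (law t) h \<longleftrightarrow> integrable \<mu> (\<lambda>x. h (X t x))"
  unfolding law_def using assms X_meas by (simp_all add: integral_distr integrable_distr_eq)

lemma pair_at_cont: "0 \<le> t \<Longrightarrow> continuous_on S (pair_at t)"
  unfolding pair_at_def
  by (intro continuous_on_Pair continuous_on_subset[OF X_cont_fst] continuous_on_subset[OF X_cont_snd]) auto

lemma pair_at_meas: "0 \<le> t \<Longrightarrow> pair_at t \<in> measurable (\<mu> \<Otimes>\<^sub>M \<mu>) borel"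
  using borel_measurable_continuous_onI[OF pair_at_cont] sets_prod_borel_prob[OF bp]
  by (simp cong: measurable_cong_sets)

lemma law_prod: "0 \<le> t \<Longrightarrow> law t \<Otimes>\<^sub>M law t = distr (\<mu> \<Otimes>\<^sub>M \<mu>) borel (pair_at t)"
proof -
  assume t: "0 \<le> t"
  interpret L: prob_space "law t" by (rule borel_probD(2)[OF law_borel_prob[OF t]])
  have "law t \<Otimes>\<^sub>M law t = distr (\<mu> \<Otimes>\<^sub>M \<mu>) (borel \<Otimes>\<^sub>M borel) (\<lambda>(x, y). (X t x, X t y))"
    unfolding law_def
    by (rule pair_measure_distr[OF X_meas[OF t] X_meas[OF t]]) (use L.sigma_finite_measure_axioms in \<open>simp add: law_def\<close>)
  also have "(\<lambda>(x, y). (X t x, X t y)) = pair_at t" by (auto simp: pair_at_def)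
  finally show ?thesis by (simp add: borel_prod)
qed

lemma nn_integral_tensor_law:
  assumes t: "0 \<le> t" and h: "h \<in> borel_measurable borel" and d: "\<And>z. z \<notin> offdiag \<Longrightarrow> h z = 0"
  shows "(\<integral>\<^sup>+z. h z \<partial>tensor (law t)) = (\<integral>\<^sup>+z. h (pair_at t z) \<partial>(\<mu> \<Otimes>\<^sub>M \<mu>))"
proof -
  have "(\<integral>\<^sup>+z. h z \<partial>tensor (law t)) = (\<integral>\<^sup>+z. h z \<partial>(law t \<Otimes>\<^sub>M law t))"
    by (rule nn_integral_tensor[OF law_borel_prob[OF t] d])
  then show ?thesis unfolding law_prod[OF t] by (subst (asm) nn_integral_distr[OF pair_at_meas[OF t]]) (use h in auto)
qed

lemma integral_tensor_law:
  fixes h :: "real \<times> real \<Rightarrow> real"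
  assumes t: "0 \<le> t" and h: "h \<in> borel_measurable borel" and d: "\<And>z. z \<notin> offdiag \<Longrightarrow> h z = 0"
  shows "(\<integral>z. h z \<partial>tensor (law t)) = (\<integral>z. h (pair_at t z) \<partial>(\<mu> \<Otimes>\<^sub>M \<mu>))"
    "integrable (tensor (law t)) h \<longleftrightarrow> integrable (\<mu> \<Otimes>\<^sub>M \<mu>) (\<lambda>z. h (pair_at t z))"
proof -
  note T = integral_tensor[of "law t" h, OF law_borel_prob[OF t] d, unfolded law_prod[OF t]]
  show "(\<integral>z. h z \<partial>tensor (law t)) = (\<integral>z. h (pair_at t z) \<partial>(\<mu> \<Otimes>\<^sub>M \<mu>))"
    using T(2) integral_distr[OF pair_at_meas[OF t] h] by simp
  show "integrable (tensor (law t)) h \<longleftrightarrow> integrable (\<mu> \<Otimes>\<^sub>M \<mu>) (\<lambda>z. h (pair_at t z))"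
    using T(1) integrable_distr_eq[OF pair_at_meas[OF t] h] by simp
qed

lemma cont_borel: "continuous_on UNIV h \<Longrightarrow> (h :: real \<times> real \<Rightarrow> real) \<in> borel_measurable borel"
  by (rule borel_measurable_continuous_onI)

lemma diff_cont: "continuous_on S (\<lambda>p::real\<times>real. fst p - snd p)"
  by (intro continuous_intros)

lemma off_diag_diff: "z \<notin> offdiag \<Longrightarrow> fst z - snd z = 0"
  by (auto simp: offdiag_def)

lemma pair_at_diff: "0 \<le> t \<Longrightarrow> \<bar>fst (pair_at t z) - snd (pair_at t z)\<bar> \<le> \<bar>fst z - snd z\<bar>"
  by (simp add: pair_at_def X_dist)

lemma integrable_dist: "integrable (\<mu> \<Otimes>\<^sub>M \<mu>) (\<lambda>z. \<bar>fst z - snd z\<bar>)"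
  using integrable_prod_fst_snd(1,2)[OF bp integrable_id] by (intro integrable_abs Bochner_Integration.integrable_diff)

lemma integrable_flux_density: "0 \<le> t \<Longrightarrow> integrable (tensor (law t)) (\<lambda>p. k * (fst p - snd p))"
proof -
  assume t: "0 \<le> t"
  have m: "(\<lambda>p::real\<times>real. k * (fst p - snd p)) \<in> borel_measurable borel"
    by (intro cont_borel continuous_intros)
  have "integrable (\<mu> \<Otimes>\<^sub>M \<mu>) (\<lambda>z. k * (fst (pair_at t z) - snd (pair_at t z)))"
  proof (intro integrable_mult_right Bochner_Integration.integrable_bound[OF integrable_dist])
    show "(\<lambda>z. fst (pair_at t z) - snd (pair_at t z)) \<in> borel_measurable (\<mu> \<Otimes>\<^sub>M \<mu>)"
      by (intro meas2_cont continuous_on_compose2[OF diff_cont pair_at_cont] t) auto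
    show "AE z in \<mu> \<Otimes>\<^sub>M \<mu>. norm (fst (pair_at t z) - snd (pair_at t z)) \<le> norm \<bar>fst z - snd z\<bar>"
      using pair_at_diff[OF t] by simp
  qed
  then show ?thesis by (subst integral_tensor_law(2)[OF t m]) (auto simp: offdiag_def)
qed

lemma signed_measure_flux: "0 \<le> t \<Longrightarrow> signed_measure offdiag_borel (flux k t)"
  unfolding flux_def
  by (intro signed_measure_density_flux integrable_flux_density sets_tensor law_borel_prob)

lemma sigma_c: "sigma_e e r = c * r" by (simp add: sigma_e_def c_eq)

text \<open>
  For this flux the action density is the integrand of the dissipation, up to the factor
  \<open>k\<^sup>2\<close>.
\<close>

lemma action_flux: "0 \<le> t \<Longrightarrow> action e (law t) (flux k t) = ennreal (k\<^sup>2) * dissipation e (law t)"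
proof -
  assume t: "0 \<le> t"
  have m: "(\<lambda>p. ennreal (\<bar>fst p - snd p\<bar>\<^sup>2 * sigma_e e \<bar>fst p - snd p\<bar>)) \<in> borel_measurable (tensor (law t))"
  proof -
    have "(\<lambda>p::real\<times>real. ennreal (\<bar>fst p - snd p\<bar>\<^sup>2 * sigma_e e \<bar>fst p - snd p\<bar>)) \<in> borel_measurable borel"
      unfolding sigma_e_def by (intro measurable_compose[OF cont_borel measurable_ennreal] continuous_intros)
    then have "(\<lambda>p::real\<times>real. ennreal (\<bar>fst p - snd p\<bar>\<^sup>2 * sigma_e e \<bar>fst p - snd p\<bar>)) \<in> borel_measurable offdiag_borel"
      unfolding offdiag_borel_def by (rule measurable_restrict_space1)
    then show ?thesis using sets_tensor[OF law_borel_prob[OF t]] by (simp cong: measurable_cong_sets)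
  qed
  have "action e (law t) (flux k t) = (\<integral>\<^sup>+p. ennreal (sigma_e e \<bar>fst p - snd p\<bar> * (k * (fst p - snd p))\<^sup>2) \<partial>tensor (law t))"
    unfolding flux_def by (rule action_density_flux[OF e(2) law_borel_prob[OF t] integrable_flux_density[OF t]])
  also have "\<dots> = (\<integral>\<^sup>+p. ennreal (k\<^sup>2) * ennreal (\<bar>fst p - snd p\<bar>\<^sup>2 * sigma_e e \<bar>fst p - snd p\<bar>) \<partial>tensor (law t))"
  proof (intro nn_integral_cong)
    fix p :: "real \<times> real"
    have "sigma_e e \<bar>fst p - snd p\<bar> * (k * (fst p - snd p))\<^sup>2 = k\<^sup>2 * (\<bar>fst p - snd p\<bar>\<^sup>2 * sigma_e e \<bar>fst p - snd p\<bar>)"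
      by (simp add: power_mult_distrib)
    then show "ennreal (sigma_e e \<bar>fst p - snd p\<bar> * (k * (fst p - snd p))\<^sup>2)
        = ennreal (k\<^sup>2) * ennreal (\<bar>fst p - snd p\<bar>\<^sup>2 * sigma_e e \<bar>fst p - snd p\<bar>)"
      by (simp only: ennreal_mult'[symmetric, OF zero_le_power2])
  qed
  also have "\<dots> = ennreal (k\<^sup>2) * dissipation e (law t)"
    unfolding dissipation_def by (rule nn_integral_cmult[OF m])
  finally show ?thesis .
qed

lemma nn_integral_flux:
  assumes t: "0 \<le> t" and k: "\<bar>k\<bar> \<le> K"
  shows "(\<integral>\<^sup>+p. ennreal (sigma_e e \<bar>fst p - snd p\<bar>) \<partial>tot_variation offdiag_borel (flux k t))
     \<le> ennreal (K * c * (\<integral>z. (fst z - snd z)\<^sup>2 \<partial>(\<mu> \<Otimes>\<^sub>M \<mu>)))"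
proof -
  let ?h = "\<lambda>p::real\<times>real. ennreal (\<bar>k * (fst p - snd p)\<bar>) * ennreal (sigma_e e \<bar>fst p - snd p\<bar>)"
  have mh: "?h \<in> borel_measurable borel"
    unfolding sigma_e_def by (intro borel_measurable_times_ennreal measurable_compose[OF cont_borel measurable_ennreal] continuous_intros)
  have ms: "(\<lambda>p::real\<times>real. ennreal (sigma_e e \<bar>fst p - snd p\<bar>)) \<in> borel_measurable (tensor (law t))"
  proof -
    have "(\<lambda>p::real\<times>real. ennreal (sigma_e e \<bar>fst p - snd p\<bar>)) \<in> borel_measurable offdiag_borel"
      unfolding offdiag_borel_def sigma_e_def
      by (intro measurable_restrict_space1 measurable_compose[OF cont_borel measurable_ennreal] continuous_intros)
    then show ?thesis using sets_tensor[OF law_borel_prob[OF t]] by (simp cong: measurable_cong_sets)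
  qed
  note iu = integrable_flux_density[OF t, of k]
  have K0: "0 \<le> K" using k by linarith
  have "(\<integral>\<^sup>+p. ennreal (sigma_e e \<bar>fst p - snd p\<bar>) \<partial>tot_variation offdiag_borel (flux k t)) = (\<integral>\<^sup>+p. ?h p \<partial>tensor (law t))"
    unfolding flux_def tot_variation_density_flux[OF iu sets_tensor[OF law_borel_prob[OF t]]]
    using ms borel_measurable_integrable[OF iu] by (subst nn_integral_density) auto
  also have "\<dots> = (\<integral>\<^sup>+z. ?h (pair_at t z) \<partial>(\<mu> \<Otimes>\<^sub>M \<mu>))"
    by (rule nn_integral_tensor_law[OF t mh]) (simp add: off_diag_diff)
  also have "\<dots> \<le> (\<integral>\<^sup>+z. ennreal (K * c * (fst z - snd z)\<^sup>2) \<partial>(\<mu> \<Otimes>\<^sub>M \<mu>))"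
  proof (rule nn_integral_mono)
    fix z :: "real \<times> real"
    define d where "d = \<bar>fst (pair_at t z) - snd (pair_at t z)\<bar>"
    have d: "0 \<le> d" "d \<le> \<bar>fst z - snd z\<bar>" using pair_at_diff[OF t, of z] by (auto simp: d_def)
    have "?h (pair_at t z) = ennreal ((\<bar>k\<bar> * d) * (c * d))"
      using c by (simp add: sigma_c abs_mult d_def[symmetric] ennreal_mult[symmetric] d(1))
    also have "(\<bar>k\<bar> * d) * (c * d) = \<bar>k\<bar> * c * d\<^sup>2" by (simp add: power2_eq_square)
    also have "\<dots> \<le> K * c * \<bar>fst z - snd z\<bar>\<^sup>2"
      using k K0 c d by (intro mult_mono power_mono) auto
    finally show "?h (pair_at t z) \<le> ennreal (K * c * (fst z - snd z)\<^sup>2)" by (simp add: ennreal_leI)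
  qed
  also have "\<dots> = ennreal (\<integral>z. K * c * (fst z - snd z)\<^sup>2 \<partial>(\<mu> \<Otimes>\<^sub>M \<mu>))"
    using integrable_dist_sq2 K0 c by (intro nn_integral_eq_integral) auto
  finally show ?thesis by simp
qed

lemma signed_integral_flux:
  assumes t: "0 \<le> t" and g: "g \<in> borel_measurable borel"
    and i: "integrable (\<mu> \<Otimes>\<^sub>M \<mu>) (\<lambda>z. k * (fst (pair_at t z) - snd (pair_at t z)) * g (pair_at t z))"
  shows "signed_integral offdiag_borel (flux k t) g
     = (\<integral>z. k * (fst (pair_at t z) - snd (pair_at t z)) * g (pair_at t z) \<partial>(\<mu> \<Otimes>\<^sub>M \<mu>))"
proof -
  note S = sets_tensor[OF law_borel_prob[OF t]]
  have gT: "g \<in> borel_measurable (tensor (law t))"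
    using borel_measurable_offdiag_borel[OF g] S by (simp cong: measurable_cong_sets)
  have m: "(\<lambda>p. k * (fst p - snd p) * g p) \<in> borel_measurable borel"
    by (intro borel_measurable_times g cont_borel continuous_intros)
  have d: "z \<notin> offdiag \<Longrightarrow> k * (fst z - snd z) * g z = 0" for z by (simp add: off_diag_diff)
  note T = integral_tensor_law[OF t m d]
  have "signed_integral offdiag_borel (flux k t) g = (\<integral>p. k * (fst p - snd p) * g p \<partial>tensor (law t))"
    unfolding flux_def
    by (rule signed_integral_density_flux[OF integrable_flux_density[OF t] S gT]) (use i T(2) in simp)
  then show ?thesis using T(1) by simp
qed

lemma signed_integral_cong_offdiag:
  "(\<And>z. z \<in> offdiag \<Longrightarrow> g z = h z) \<Longrightarrow> signed_integral offdiag_borel U g = signed_integral offdiag_borel U h"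
  unfolding signed_integral_def by (intro arg_cong2[where f="(-)"] Bochner_Integration.integral_cong refl) auto

text \<open>
  Changes of time along which the flow remains a solution. They may start at time zero, where the
  trajectories need not be differentiable; hence positivity and differentiability are required
  in the interior only.
\<close>

definition admissible_time :: "real \<Rightarrow> (real \<Rightarrow> real) \<Rightarrow> (real \<Rightarrow> real) \<Rightarrow> bool" where
  "admissible_time S \<theta> k \<longleftrightarrow> 0 < S \<and> continuous_on {0..S} \<theta> \<and> continuous_on {0..S} k \<and>
     (\<forall>s\<in>{0..S}. 0 \<le> \<theta> s) \<and> (\<forall>s\<in>{0<..<S}. 0 < \<theta> s \<and> (\<theta> has_real_derivative k s) (at s))"

lemma time_cont: "admissible_time S \<theta> k \<Longrightarrow> continuous_on {0..S} (\<lambda>s. X (\<theta> s) x)"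
  unfolding admissible_time_def by (intro continuous_on_compose2[OF X_cont_time]) auto

lemma law_narrow:
  assumes a: "admissible_time S \<theta> k" and g: "continuous_on UNIV (g::real\<Rightarrow>real)" "\<And>v. \<bar>g v\<bar> \<le> B"
  shows "continuous_on {0..S} (\<lambda>s. \<integral>v. g v \<partial>law (\<theta> s))"
proof -
  have pos: "s \<in> {0..S} \<Longrightarrow> 0 \<le> \<theta> s" for s using a by (simp add: admissible_time_def)
  have "continuous_on {0..S} (\<lambda>s. \<integral>x. g (X (\<theta> s) x) \<partial>\<mu>)"
  proof (rule continuous_on_integral_dominated)
    show "continuous_on {0..S} (\<lambda>s. g (X (\<theta> s) x))" for x
      by (rule continuous_on_compose2[OF g(1) time_cont[OF a]]) auto
    show "(\<lambda>x. g (X (\<theta> s) x)) \<in> borel_measurable \<mu>" if "s \<in> {0..S}" for s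
      by (intro meas_cont continuous_on_compose2[OF g(1)] X_cont pos that) auto
    show "\<bar>g (X (\<theta> s) x)\<bar> \<le> B" for s x by (rule g)
  qed simp
  then show ?thesis
    by (rule continuous_on_eq) (use pos in \<open>auto intro!: integral_law(1)[symmetric] borel_measurable_continuous_onI g\<close>)
qed

text \<open>
  The signed integral is an integral over pairs of particles whose integrand is continuous in time
  and dominated by their initial distance, so it depends even continuously on time.
\<close>

lemma flux_weak_star:
  assumes a: "admissible_time S \<theta> k" and g: "g \<in> Cc_on offdiag"
  shows "continuous_on {0..S} (\<lambda>s. signed_integral offdiag_borel (flux (k s) (\<theta> s)) g)"
proof -
  have pos: "s \<in> {0..S} \<Longrightarrow> 0 \<le> \<theta> s" for s using a by (simp add: admissible_time_def)
  obtain K where K: "continuous_on offdiag g" "compact K" "K \<subseteq> offdiag" "\<And>x. x \<in> offdiag - K \<Longrightarrow> g x = 0"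
    using g unfolding Cc_on_def by auto
  define h where "h z = (if z \<in> K then g z else 0)" for z
  have hg: "z \<in> offdiag \<Longrightarrow> g z = h z" for z using K(4) by (auto simp: h_def)
  have off: "open offdiag"
  proof -
    have "open {p :: real \<times> real. fst p \<noteq> snd p}" by (intro open_Collect_neq continuous_intros)
    moreover have "offdiag = {p. fst p \<noteq> snd p}" by (auto simp: offdiag_def)
    ultimately show ?thesis by simp
  qed
  have ch: "continuous_on UNIV h"
  proof -
    have "continuous_on offdiag h" using K(1) by (rule continuous_on_eq) (simp add: hg)
    moreover have "continuous_on (- K) h" by (rule continuous_on_eq[of _ "\<lambda>_. 0"]) (auto simp: h_def)
    moreover have "open (- K)" using compact_imp_closed[OF K(2)] by auto
    moreover have "offdiag \<union> - K = UNIV" using K(3) by auto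
    ultimately show ?thesis using continuous_on_open_Un[OF off, of "- K" h] by simp
  qed
  obtain B where B: "\<And>z. \<bar>h z\<bar> \<le> B"
    using compact_support_bounded[OF continuous_on_subset[OF ch] K(2)] by (auto simp: h_def)
  have B0: "0 \<le> B" using B[of undefined] by linarith
  obtain Kk where Kk: "\<And>s. s \<in> {0..S} \<Longrightarrow> \<bar>k s\<bar> \<le> Kk"
    using continuous_interval_bounded[of 0 S k] a unfolding admissible_time_def by blast
  let ?G = "\<lambda>s z. k s * (fst (pair_at (\<theta> s) z) - snd (pair_at (\<theta> s) z)) * h (pair_at (\<theta> s) z)"
  have cG: "continuous_on UNIV (?G s)" if "s \<in> {0..S}" for s
    by (intro continuous_on_mult continuous_on_const continuous_on_compose2[OF diff_cont pair_at_cont]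
        continuous_on_compose2[OF ch pair_at_cont] pos that) auto
  have bG: "\<bar>?G s z\<bar> \<le> Kk * \<bar>fst z - snd z\<bar> * B" if "s \<in> {0..S}" for s z
    unfolding abs_mult using Kk[OF that] pair_at_diff[OF pos[OF that], of z] B B0 by (intro mult_mono) auto
  have iw: "integrable (\<mu> \<Otimes>\<^sub>M \<mu>) (\<lambda>z. Kk * \<bar>fst z - snd z\<bar> * B)"
    using integrable_dist by (intro integrable_mult_left integrable_mult_right)
  have iG: "integrable (\<mu> \<Otimes>\<^sub>M \<mu>) (?G s)" if "s \<in> {0..S}" for s
  proof (rule Bochner_Integration.integrable_bound[OF iw meas2_cont[OF cG[OF that]]], rule AE_I2)
    fix z show "norm (?G s z) \<le> norm (Kk * \<bar>fst z - snd z\<bar> * B)" using bG[OF that, of z] by simp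
  qed
  have "continuous_on {0..S} (\<lambda>s. \<integral>z. ?G s z \<partial>(\<mu> \<Otimes>\<^sub>M \<mu>))"
  proof (rule continuous_on_integral_dominated[OF _ _ bG iw])
    have cp: "continuous_on {0..S} (\<lambda>s. pair_at (\<theta> s) z)" for z
      unfolding pair_at_def by (intro continuous_on_Pair time_cont[OF a])
    show "continuous_on {0..S} (\<lambda>s. ?G s z)" for z
      using a unfolding admissible_time_def
      by (intro continuous_on_mult continuous_on_compose2[OF diff_cont cp] continuous_on_compose2[OF ch cp]) auto
    show "?G s \<in> borel_measurable (\<mu> \<Otimes>\<^sub>M \<mu>)" if "s \<in> {0..S}" for s by (rule meas2_cont[OF cG[OF that]])
  qed
  then show ?thesis
  proof (rule continuous_on_eq)
    fix s assume s: "s \<in> {0..S}"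
    have "signed_integral offdiag_borel (flux (k s) (\<theta> s)) g = signed_integral offdiag_borel (flux (k s) (\<theta> s)) h"
      by (rule signed_integral_cong_offdiag) (rule hg)
    also have "\<dots> = (\<integral>z. ?G s z \<partial>(\<mu> \<Otimes>\<^sub>M \<mu>))"
      by (rule signed_integral_flux[OF pos[OF s] cont_borel[OF ch] iG[OF s]])
    finally show "(\<integral>z. ?G s z \<partial>(\<mu> \<Otimes>\<^sub>M \<mu>)) = signed_integral offdiag_borel (flux (k s) (\<theta> s)) g" by simp
  qed
qed

text \<open>
  The integral of the test function along the trajectories has a derivative whose two parts are the
  two integrands of the weak equation, the second one by the exchange of particles in
  \<open>friction_pairing\<close>. It vanishes at both ends because of the compact support in time.
\<close>

lemma flux_weak_equation:
  assumes a: "admissible_time S \<theta> k" and \<phi>: "\<phi> \<in> C1c_strip S"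
  shows "(\<integral>t. (\<integral>v. deriv (\<lambda>s. \<phi> s v) t \<partial>law (\<theta> t)) \<partial>lebesgue_on {0..S}) +
        (\<integral>t. signed_integral offdiag_borel (flux (k t) (\<theta> t))
               (\<lambda>p. sigma_e e \<bar>fst p - snd p\<bar> * nonlocal_grad (\<phi> t) p) \<partial>lebesgue_on {0..S}) = 0"
proof -
  have S: "0 < S" and pos: "\<And>s. s \<in> {0..S} \<Longrightarrow> 0 \<le> \<theta> s" and kc: "continuous_on {0..S} k"
    and \<theta>d: "\<And>s. s \<in> {0<..<S} \<Longrightarrow> 0 < \<theta> s" "\<And>s. s \<in> {0<..<S} \<Longrightarrow> (\<theta> has_real_derivative k s) (at s)"
    using a by (auto simp: admissible_time_def)
  define \<phi>1 where "\<phi>1 t v = deriv (\<lambda>s. \<phi> s v) t" for t v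
  define \<phi>2 where "\<phi>2 t v = deriv (\<phi> t) v" for t v
  have c1: "continuous_on UNIV (\<lambda>(t, v). \<phi>1 t v)" and c2: "continuous_on UNIV (\<lambda>(t, v). \<phi>2 t v)"
    using \<phi> unfolding C1c_strip_def \<phi>1_def \<phi>2_def by auto
  have d1: "((\<lambda>s. \<phi> s v) has_real_derivative \<phi>1 t v) (at t)" for t v
    using \<phi> unfolding C1c_strip_def \<phi>1_def by (auto simp: DERIV_deriv_iff_real_differentiable)
  have d2: "(\<phi> t has_real_derivative \<phi>2 t v) (at v)" for t v
    using \<phi> unfolding C1c_strip_def \<phi>2_def by (auto simp: DERIV_deriv_iff_real_differentiable)
  obtain K where K: "compact K" "K \<subseteq> {0<..<S} \<times> UNIV" "\<And>t v. (t, v) \<notin> K \<Longrightarrow> \<phi> t v = 0"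
    using \<phi> unfolding C1c_strip_def by blast
  have oK: "open (- K)" using compact_imp_closed[OF K(1)] by auto
  have z1: "\<phi>1 t v = 0" if "(t, v) \<notin> K" for t v
  proof -
    have "open {s. (s, v) \<in> - K}"
      using open_vimage[OF oK, of "\<lambda>s. (s, v)"] by (simp add: vimage_def continuous_on_Pair)
    then have "((\<lambda>s. \<phi> s v) has_real_derivative 0) (at t)"
      by (rule has_field_derivative_transform_within_open[of "\<lambda>_. 0", OF DERIV_const]) (use that K(3) in auto)
    then show ?thesis using d1[of v t] by (rule DERIV_unique[rotated])
  qed
  have z2: "\<phi>2 t v = 0" if "(t, v) \<notin> K" for t v
  proof -
    have "open {w. (t, w) \<in> - K}"
      using open_vimage[OF oK, of "\<lambda>w. (t, w)"] by (simp add: vimage_def continuous_on_Pair)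
    then have "(\<phi> t has_real_derivative 0) (at v)"
      by (rule has_field_derivative_transform_within_open[of "\<lambda>_. 0", OF DERIV_const]) (use that K(3) in auto)
    then show ?thesis using d2[of t v] by (rule DERIV_unique[rotated])
  qed
  obtain A1 where A1: "\<And>t v. \<bar>\<phi>1 t v\<bar> \<le> A1"
    using compact_support_bounded[OF continuous_on_subset[OF c1] K(1)] z1 by fastforce
  obtain A2 where A2: "\<And>t v. \<bar>\<phi>2 t v\<bar> \<le> A2"
    using compact_support_bounded[OF continuous_on_subset[OF c2] K(1)] z2 by fastforce
  have A0: "0 \<le> A1" "0 \<le> A2" using A1[of 0 0] A2[of 0 0] by linarith+
  obtain Kk where Kk: "\<And>s. s \<in> {0..S} \<Longrightarrow> \<bar>k s\<bar> \<le> Kk"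
    using continuous_interval_bounded[OF kc] by blast
  have Kk0: "0 \<le> Kk" using Kk[of 0] S by auto
  have c\<phi>1: "continuous_on UNIV (\<phi>1 s)" and c\<phi>2: "continuous_on UNIV (\<phi>2 s)" for s
  proof -
    have "continuous_on UNIV (\<lambda>v::real. (s, v))" by (intro continuous_on_Pair continuous_on_const continuous_on_id)
    from continuous_on_compose2[OF c1 this] continuous_on_compose2[OF c2 this]
    show "continuous_on UNIV (\<phi>1 s)" "continuous_on UNIV (\<phi>2 s)" by simp_all
  qed
  have graph: "continuous_on {0..S} (\<lambda>s. (s, X (\<theta> s) x))" for x
    by (intro continuous_on_Pair continuous_on_id time_cont[OF a])
  have cs1: "continuous_on {0..S} (\<lambda>s. \<phi>1 s (X (\<theta> s) x))" and cs2: "continuous_on {0..S} (\<lambda>s. \<phi>2 s (X (\<theta> s) x))" for x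
    using continuous_on_compose2[OF c1 graph] continuous_on_compose2[OF c2 graph] by simp_all
  have cX1: "continuous_on UNIV (\<lambda>x. \<phi>1 s (X (\<theta> s) x))" and cX2: "continuous_on UNIV (\<lambda>x. \<phi>2 s (X (\<theta> s) x))" if "s \<in> {0..S}" for s
    using continuous_on_compose2[OF c\<phi>1 X_cont[OF pos[OF that]]] continuous_on_compose2[OF c\<phi>2 X_cont[OF pos[OF that]]] by auto
  define f1 where "f1 s = (\<integral>x. \<phi>1 s (X (\<theta> s) x) \<partial>\<mu>)" for s
  define f2 where "f2 s = (\<integral>x. \<phi>2 s (X (\<theta> s) x) * (velocity (X (\<theta> s)) x * k s) \<partial>\<mu>)" for s
  let ?w = "\<lambda>x. A1 + A2 * (2 * c * spread x * Kk)"
  have iw: "integrable \<mu> ?w" using integrable_spread by simp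
  have vb: "\<bar>\<phi>2 s (X (\<theta> s) x) * (velocity (X (\<theta> s)) x * k s)\<bar> \<le> A2 * (2 * c * spread x * Kk)" if "s \<in> {0..S}" for s x
    unfolding abs_mult using A2 A0 velocity_bound[OF pos[OF that], of x] Kk[OF that] c spread_nonneg[of x]
    by (intro mult_mono) auto
  have cf1: "continuous_on {0..S} f1"
    unfolding f1_def
  proof (rule continuous_on_integral_dominated[OF cs1])
    show "(\<lambda>x. \<phi>1 s (X (\<theta> s) x)) \<in> borel_measurable \<mu>" if "s \<in> {0..S}" for s by (rule meas_cont[OF cX1[OF that]])
    show "\<bar>\<phi>1 s (X (\<theta> s) x)\<bar> \<le> A1" for s x by (rule A1)
  qed simp
  have cf2: "continuous_on {0..S} f2"
    unfolding f2_def
  proof (rule continuous_on_integral_dominated[OF _ _ vb])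
    show "continuous_on {0..S} (\<lambda>s. \<phi>2 s (X (\<theta> s) x) * (velocity (X (\<theta> s)) x * k s))" for x
      using a unfolding admissible_time_def
      by (intro continuous_on_mult cs2 continuous_on_compose2[OF velocity_cont_time]) auto
    show "(\<lambda>x. \<phi>2 s (X (\<theta> s) x) * (velocity (X (\<theta> s)) x * k s)) \<in> borel_measurable \<mu>" if "s \<in> {0..S}" for s
      by (intro meas_cont continuous_on_mult cX2 that velocity_cont pos continuous_on_const)
    show "integrable \<mu> (\<lambda>x. A2 * (2 * c * spread x * Kk))" using integrable_spread by simp
  qed
  define G where "G s = (\<integral>x. \<phi> s (X (\<theta> s) x) \<partial>\<mu>)" for s
  have pd: "((\<lambda>s. \<phi> s (X (\<theta> s) x)) has_real_derivative \<phi>1 s (X (\<theta> s) x) + \<phi>2 s (X (\<theta> s) x) * (velocity (X (\<theta> s)) x * k s)) (at s)"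
    if s: "s \<in> {0<..<S}" for s x
    by (rule DERIV_two_variables[OF d1 d2 c2 DERIV_chain2[OF X_deriv[OF \<theta>d(1)[OF s]] \<theta>d(2)[OF s]]])
  have pb: "\<bar>\<phi>1 s (X (\<theta> s) x) + \<phi>2 s (X (\<theta> s) x) * (velocity (X (\<theta> s)) x * k s)\<bar> \<le> ?w x" if s: "s \<in> {0..S}" for s x
    using A1[of s "X (\<theta> s) x"] vb[OF s, of x] by linarith
  have c\<phi>: "continuous_on UNIV (\<phi> s)" for s
    using d2 DERIV_isCont continuous_at_imp_continuous_on by blast
  have \<phi>0: "\<phi> 0 v = 0" "\<phi> S v = 0" for v
    using K(2) by (auto intro!: K(3))
  have lip: "\<bar>\<phi> r (X (\<theta> r) x) - \<phi> s (X (\<theta> s) x)\<bar> \<le> ?w x * \<bar>r - s\<bar>" if "r \<in> {0<..<S}" "s \<in> {0<..<S}" for r s x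
  proof -
    have "norm (\<phi> r (X (\<theta> r) x) - \<phi> s (X (\<theta> s) x)) \<le> ?w x * norm (r - s)"
    proof (rule field_differentiable_bound[of "{0<..<S}"])
      show "((\<lambda>s. \<phi> s (X (\<theta> s) x)) has_real_derivative \<phi>1 u (X (\<theta> u) x) + \<phi>2 u (X (\<theta> u) x) * (velocity (X (\<theta> u)) x * k u)) (at u within {0<..<S})"
        if "u \<in> {0<..<S}" for u by (rule has_field_derivative_at_within[OF pd[OF that]])
      show "norm (\<phi>1 u (X (\<theta> u) x) + \<phi>2 u (X (\<theta> u) x) * (velocity (X (\<theta> u)) x * k u)) \<le> ?w x" if "u \<in> {0<..<S}" for u
        using pb[of u x] that by simp
    qed (use that in auto)
    then show ?thesis by simp
  qed
  have cc: "continuous_on UNIV (\<lambda>(t, v). \<phi> t v)" by (rule continuous_two_variables[OF d1 d2 c2])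
  obtain A3 where A3: "\<And>t v. \<bar>\<phi> t v\<bar> \<le> A3"
    using compact_support_bounded[OF continuous_on_subset[OF cc] K(1)] K(3) by fastforce
  have GI: "integrable \<mu> (\<lambda>x. \<phi> s (X (\<theta> s) x))" if "s \<in> {0..S}" for s
  proof (rule integrable_const_bound[of _ A3])
    show "(\<lambda>x. \<phi> s (X (\<theta> s) x)) \<in> borel_measurable \<mu>"
      by (intro meas_cont continuous_on_compose2[OF c\<phi> X_cont[OF pos[OF that]]]) auto
    show "AE x in \<mu>. norm (\<phi> s (X (\<theta> s) x)) \<le> A3" using A3 by simp
  qed
  have dG: "(G has_real_derivative f1 s + f2 s) (at s)" if s: "s \<in> {0<..<S}" for s
  proof -
    have s': "s \<in> {0..S}" using s by auto
    have i1: "integrable \<mu> (\<lambda>x. \<phi>1 s (X (\<theta> s) x))"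
      by (rule integrable_const_bound[of _ A1]) (use A1 meas_cont[OF cX1[OF s']] in auto)
    have i2: "integrable \<mu> (\<lambda>x. \<phi>2 s (X (\<theta> s) x) * (velocity (X (\<theta> s)) x * k s))"
    proof (rule Bochner_Integration.integrable_bound[of _ "\<lambda>x. A2 * (2 * c * spread x * Kk)"])
      show "integrable \<mu> (\<lambda>x. A2 * (2 * c * spread x * Kk))" using integrable_spread by simp
      show "(\<lambda>x. \<phi>2 s (X (\<theta> s) x) * (velocity (X (\<theta> s)) x * k s)) \<in> borel_measurable \<mu>"
        by (intro meas_cont continuous_on_mult cX2 s' velocity_cont pos continuous_on_const)
      show "AE x in \<mu>. norm (\<phi>2 s (X (\<theta> s) x) * (velocity (X (\<theta> s)) x * k s)) \<le> norm (A2 * (2 * c * spread x * Kk))"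
      proof (rule AE_I2)
        fix x show "norm (\<phi>2 s (X (\<theta> s) x) * (velocity (X (\<theta> s)) x * k s)) \<le> norm (A2 * (2 * c * spread x * Kk))"
          using vb[OF s', of x] by simp
      qed
    qed
    have "(G has_real_derivative (\<integral>x. \<phi>1 s (X (\<theta> s) x) + \<phi>2 s (X (\<theta> s) x) * (velocity (X (\<theta> s)) x * k s) \<partial>\<mu>)) (at s)"
      unfolding G_def
    proof (rule DERIV_integral_dominated[of "{0<..<S}", OF _ s pd[OF s] _ lip[OF _ s] iw])
      show "integrable \<mu> (\<lambda>x. \<phi> r (X (\<theta> r) x))" if "r \<in> {0<..<S}" for r using GI that by simp
    qed (use i1 i2 in auto)
    then show ?thesis unfolding f1_def f2_def by (simp add: Bochner_Integration.integral_add[OF i1 i2])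
  qed
  have cG: "continuous_on {0..S} G"
    unfolding G_def
  proof (rule continuous_on_integral_dominated)
    show "continuous_on {0..S} (\<lambda>s. \<phi> s (X (\<theta> s) x))" for x
      using continuous_on_compose2[OF cc graph] by simp
    show "(\<lambda>x. \<phi> s (X (\<theta> s) x)) \<in> borel_measurable \<mu>" if "s \<in> {0..S}" for s
      using GI[OF that] by simp
    show "\<bar>\<phi> s (X (\<theta> s) x)\<bar> \<le> A3" for s x by (rule A3)
  qed simp
  have "((\<lambda>s. f1 s + f2 s) has_integral G S - G 0) {0..S}"
    using S dG by (intro fundamental_theorem_of_calculus_interior cG) (auto simp flip: has_real_derivative_iff_has_vector_derivative)
  moreover have "G S = 0" "G 0 = 0" unfolding G_def by (simp_all add: \<phi>0)
  ultimately have "integral {0..S} (\<lambda>s. f1 s + f2 s) = 0" by (simp add: integral_unique)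
  then have "integral {0..S} f1 + integral {0..S} f2 = 0"
    by (simp add: Henstock_Kurzweil_Integration.integral_add integrable_continuous_interval cf1 cf2)
  then have zero: "(\<integral>t. f1 t \<partial>lebesgue_on {0..S}) + (\<integral>t. f2 t \<partial>lebesgue_on {0..S}) = 0"
    unfolding integral_lebesgue_on_continuous(2)[OF cf1] integral_lebesgue_on_continuous(2)[OF cf2] .
  have sp: "space (lebesgue_on {0..S}) = {0..S}" by (simp add: space_restrict_space)
  have e1: "(\<integral>v. deriv (\<lambda>s. \<phi> s v) t \<partial>law (\<theta> t)) = f1 t" if "t \<in> {0..S}" for t
    unfolding f1_def \<phi>1_def[symmetric]
    by (rule integral_law(1)[OF pos[OF that] borel_measurable_continuous_onI[OF c\<phi>1]])
  have e2: "signed_integral offdiag_borel (flux (k t) (\<theta> t)) (\<lambda>p. sigma_e e \<bar>fst p - snd p\<bar> * nonlocal_grad (\<phi> t) p) = f2 t"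
    if t: "t \<in> {0..S}" for t
  proof -
    let ?g = "\<lambda>p. sigma_e e \<bar>fst p - snd p\<bar> * nonlocal_grad (\<phi> t) p"
    let ?Q = "\<lambda>x. \<phi>2 t (X (\<theta> t) x)"
    let ?F = "\<lambda>z. friction (X (\<theta> t) (fst z) - X (\<theta> t) (snd z)) * (?Q (snd z) - ?Q (fst z))"
    have gm: "?g \<in> borel_measurable borel"
      unfolding nonlocal_grad_def \<phi>2_def[symmetric] sigma_e_def split_beta
      by (intro cont_borel continuous_intros continuous_on_compose2[OF c\<phi>2]) auto
    have eq: "k t * (fst (pair_at (\<theta> t) z) - snd (pair_at (\<theta> t) z)) * ?g (pair_at (\<theta> t) z) = (k t * c) * ?F z" for z
      unfolding nonlocal_grad_def \<phi>2_def[symmetric] sigma_c by (simp add: pair_at_def friction_def)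
    note fp = friction_pairing[OF pos[OF t] cX2[OF t] A2]
    have "signed_integral offdiag_borel (flux (k t) (\<theta> t)) ?g
       = (\<integral>z. k t * (fst (pair_at (\<theta> t) z) - snd (pair_at (\<theta> t) z)) * ?g (pair_at (\<theta> t) z) \<partial>(\<mu> \<Otimes>\<^sub>M \<mu>))"
    proof (rule signed_integral_flux[OF pos[OF t] gm])
      show "integrable (\<mu> \<Otimes>\<^sub>M \<mu>) (\<lambda>z. k t * (fst (pair_at (\<theta> t) z) - snd (pair_at (\<theta> t) z)) * ?g (pair_at (\<theta> t) z))"
        unfolding eq by (intro integrable_mult_right fp(1))
    qed
    also have "\<dots> = k t * (c * (\<integral>z. ?F z \<partial>(\<mu> \<Otimes>\<^sub>M \<mu>)))"
      unfolding eq by simp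
    also have "\<dots> = k t * (\<integral>x. ?Q x * velocity (X (\<theta> t)) x \<partial>\<mu>)" unfolding fp(2) ..
    also have "\<dots> = (\<integral>x. k t * (?Q x * velocity (X (\<theta> t)) x) \<partial>\<mu>)" by (rule integral_mult_right_zero[symmetric])
    also have "\<dots> = f2 t" unfolding f2_def by (simp only: ac_simps)
    finally show ?thesis .
  qed
  have "(\<integral>t. (\<integral>v. deriv (\<lambda>s. \<phi> s v) t \<partial>law (\<theta> t)) \<partial>lebesgue_on {0..S}) = (\<integral>t. f1 t \<partial>lebesgue_on {0..S})"
    by (rule Bochner_Integration.integral_cong[OF refl]) (use e1 sp in auto)
  moreover have "(\<integral>t. signed_integral offdiag_borel (flux (k t) (\<theta> t))
               (\<lambda>p. sigma_e e \<bar>fst p - snd p\<bar> * nonlocal_grad (\<phi> t) p) \<partial>lebesgue_on {0..S}) = (\<integral>t. f2 t \<partial>lebesgue_on {0..S})"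
    by (rule Bochner_Integration.integral_cong[OF refl]) (use e2 sp in auto)
  ultimately show ?thesis using zero by simp
qed

lemma curve_in_CE:
  assumes a: "admissible_time S \<theta> k"
  shows "(\<lambda>s. law (\<theta> s), \<lambda>s. flux (k s) (\<theta> s)) \<in> CE e S"
  unfolding CE_def
proof (clarify, intro conjI ballI)
  have S: "0 < S" and pos: "\<And>s. s \<in> {0..S} \<Longrightarrow> 0 \<le> \<theta> s" and kc: "continuous_on {0..S} k"
    using a by (auto simp: admissible_time_def)
  show "law (\<theta> t) \<in> borel_prob" if "t \<in> {0..S}" for t by (rule law_borel_prob[OF pos[OF that]])
  show "signed_measure offdiag_borel (flux (k t) (\<theta> t))" if "t \<in> {0..S}" for t
    by (rule signed_measure_flux[OF pos[OF that]])
  have cm: "h \<in> borel_measurable (lebesgue_on {0..S})" if "continuous_on {0..S} h" for h :: "real \<Rightarrow> real"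
    using that by (rule continuous_imp_measurable_on_sets_lebesgue) simp
  show "weak_star_measurable S (\<lambda>s. law (\<theta> s))"
    unfolding weak_star_measurable_def
  proof
    fix g :: "real \<Rightarrow> real" assume "g \<in> Cc_on UNIV"
    then obtain K where K: "continuous_on UNIV g" "compact K" "\<And>x. x \<notin> K \<Longrightarrow> g x = 0" by (auto simp: Cc_on_def)
    obtain B where "\<And>x. \<bar>g x\<bar> \<le> B"
      using compact_support_bounded[OF continuous_on_subset[OF K(1)] K(2,3)] by auto
    then show "(\<lambda>t. \<integral>v. g v \<partial>law (\<theta> t)) \<in> borel_measurable (lebesgue_on {0..S})"
      by (intro cm law_narrow[OF a K(1)])
  qed
  show "weak_star_measurable_signed S (\<lambda>s. flux (k s) (\<theta> s))"
    unfolding weak_star_measurable_signed_def by (intro ballI cm flux_weak_star[OF a])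
  show "narrowly_continuous S (\<lambda>s. law (\<theta> s))"
    unfolding narrowly_continuous_def
  proof (intro allI impI)
    fix g :: "real \<Rightarrow> real" assume g: "continuous_on UNIV g" "bounded (range g)"
    then obtain B where "\<And>x. \<bar>g x\<bar> \<le> B" by (auto simp: bounded_iff)
    then show "continuous_on {0..S} (\<lambda>t. \<integral>v. g v \<partial>law (\<theta> t))" by (intro law_narrow[OF a g(1)])
  qed
  obtain K where K: "\<And>s. s \<in> {0..S} \<Longrightarrow> \<bar>k s\<bar> \<le> K"
    using continuous_interval_bounded[OF kc] by blast
  let ?B = "ennreal (K * c * (\<integral>z. (fst z - snd z)\<^sup>2 \<partial>(\<mu> \<Otimes>\<^sub>M \<mu>)))"
  have "(\<integral>\<^sup>+t. (\<integral>\<^sup>+p. ennreal (sigma_e e \<bar>fst p - snd p\<bar>) \<partial>tot_variation offdiag_borel (flux (k t) (\<theta> t))) \<partial>lebesgue_on {0..S})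
      \<le> (\<integral>\<^sup>+t. ?B \<partial>lebesgue_on {0..S})"
    by (rule nn_integral_mono) (simp add: space_restrict_space nn_integral_flux pos K)
  also have "\<dots> < \<infinity>" using S by (simp add: emeasure_restrict_space space_restrict_space ennreal_mult_less_top)
  finally show "(\<integral>\<^sup>+t. (\<integral>\<^sup>+p. ennreal (sigma_e e \<bar>fst p - snd p\<bar>) \<partial>tot_variation offdiag_borel (flux (k t) (\<theta> t))) \<partial>lebesgue_on {0..S}) < \<infinity>" .
  fix \<phi> assume "\<phi> \<in> C1c_strip S"
  then show "(\<integral>t. (\<integral>v. deriv (\<lambda>s. \<phi> s v) t \<partial>law (\<theta> t)) \<partial>lebesgue_on {0..S}) +
        (\<integral>t. signed_integral offdiag_borel (flux (k t) (\<theta> t))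
               (\<lambda>p. sigma_e e \<bar>fst p - snd p\<bar> * nonlocal_grad (\<phi> t) p) \<partial>lebesgue_on {0..S}) = 0"
    by (rule flux_weak_equation[OF a])
qed

end

section \<open>Energy dissipation\<close>

context friction_flow
begin

text \<open>
  The dissipation as a real number. It is meaningful at positive times, where the third powers of the
  gaps are bounded; at time zero the integral may diverge and then has the default value zero.
\<close>

definition diss :: "real \<Rightarrow> real" where
  "diss t = (\<integral>z. c * \<bar>X t (fst z) - X t (snd z)\<bar> ^ 3 \<partial>(\<mu> \<Otimes>\<^sub>M \<mu>))"

lemma diss_nonneg: "0 \<le> diss t"
  unfolding diss_def using c by (intro integral_nonneg_AE) auto

lemma diss_kernel_cont: "0 \<le> t \<Longrightarrow> continuous_on UNIV (\<lambda>z::real\<times>real. c * \<bar>X t (fst z) - X t (snd z)\<bar> ^ 3)"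
  by (intro continuous_on_mult continuous_on_const continuous_on_power continuous_on_rabs continuous_on_diff X_cont_fst X_cont_snd)

lemma diss_kernel_bound:
  assumes "0 < a" "a \<le> t" shows "\<bar>c * \<bar>X t x - X t y\<bar> ^ 3\<bar> \<le> c * (1 / (c * a)) ^ 3"
proof -
  have "\<bar>X t x - X t y\<bar> \<le> 1 / (c * t)" using assms by (intro gap_decay) auto
  also have "\<dots> \<le> 1 / (c * a)" using assms c by (intro divide_left_mono mult_left_mono mult_pos_pos) auto
  finally have "\<bar>X t x - X t y\<bar> ^ 3 \<le> (1 / (c * a)) ^ 3" by (intro power_mono) auto
  then show ?thesis using c by (simp add: abs_mult)
qed

lemma diss_integrable: "0 < t \<Longrightarrow> integrable (\<mu> \<Otimes>\<^sub>M \<mu>) (\<lambda>z. c * \<bar>X t (fst z) - X t (snd z)\<bar> ^ 3)"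
  using diss_kernel_bound[of t t] meas2_cont[OF diss_kernel_cont[of t]]
  by (intro sq.integrable_const_bound[of _ "c * (1 / (c * t)) ^ 3"]) auto

lemma dissipation_law: "0 < t \<Longrightarrow> dissipation e (law t) = ennreal (diss t)"
proof -
  assume t: "0 < t"
  have m: "(\<lambda>p::real\<times>real. ennreal (\<bar>fst p - snd p\<bar>\<^sup>2 * sigma_e e \<bar>fst p - snd p\<bar>)) \<in> borel_measurable borel"
    unfolding sigma_e_def by (intro measurable_compose[OF cont_borel measurable_ennreal] continuous_intros)
  have "dissipation e (law t) = (\<integral>\<^sup>+z. ennreal (\<bar>fst (pair_at t z) - snd (pair_at t z)\<bar>\<^sup>2
      * sigma_e e \<bar>fst (pair_at t z) - snd (pair_at t z)\<bar>) \<partial>(\<mu> \<Otimes>\<^sub>M \<mu>))"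
    unfolding dissipation_def using t by (intro nn_integral_tensor_law m) (auto simp: off_diag_diff)
  also have "\<dots> = (\<integral>\<^sup>+z. ennreal (c * \<bar>X t (fst z) - X t (snd z)\<bar> ^ 3) \<partial>(\<mu> \<Otimes>\<^sub>M \<mu>))"
  proof (intro nn_integral_cong arg_cong[where f=ennreal])
    fix z :: "real \<times> real"
    have "r\<^sup>2 * (c * r) = c * r ^ 3" for r :: real by (simp add: power2_eq_square power3_eq_cube)
    then show "\<bar>fst (pair_at t z) - snd (pair_at t z)\<bar>\<^sup>2 * sigma_e e \<bar>fst (pair_at t z) - snd (pair_at t z)\<bar>
        = c * \<bar>X t (fst z) - X t (snd z)\<bar> ^ 3"
      unfolding sigma_c by (simp only: pair_at_def fst_conv snd_conv)
  qed
  also have "\<dots> = ennreal (diss t)"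
    unfolding diss_def using c by (intro nn_integral_eq_integral diss_integrable t) auto
  finally show ?thesis .
qed

lemma diss_cont: "continuous_on {0<..} diss"
proof -
  have "continuous_on {a<..} diss" if a: "0 < a" for a
    unfolding diss_def
  proof (rule continuous_on_integral_dominated)
    show "continuous_on {a<..} (\<lambda>s. c * \<bar>X s (fst z) - X s (snd z)\<bar> ^ 3)" for z
      using a by (intro continuous_on_mult continuous_on_const continuous_on_power continuous_on_rabs continuous_on_diff
          continuous_on_subset[OF X_cont_time]) auto
    show "(\<lambda>z. c * \<bar>X s (fst z) - X s (snd z)\<bar> ^ 3) \<in> borel_measurable (\<mu> \<Otimes>\<^sub>M \<mu>)" if "s \<in> {a<..}" for s
      using that a by (intro meas2_cont diss_kernel_cont) auto
    show "\<bar>c * \<bar>X s (fst z) - X s (snd z)\<bar> ^ 3\<bar> \<le> c * (1 / (c * a)) ^ 3" if "s \<in> {a<..}" for s z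
      using that a by (intro diss_kernel_bound) auto
  qed simp
  then have "continuous_on (\<Union>a\<in>{0<..}. {a<..}) diss" by (intro continuous_on_open_UN) auto
  moreover have "(\<Union>a\<in>{0<..}. {a<..}) = ({0<..} :: real set)"
  proof (intro equalityI subsetI)
    fix x :: real assume "x \<in> {0<..}"
    then show "x \<in> (\<Union>a\<in>{0<..}. {a<..})" by (intro UN_I[of "x / 2"]) auto
  qed auto
  ultimately show ?thesis by simp
qed

definition En :: "real \<Rightarrow> real" where "En t = (\<integral>x. (X t x)\<^sup>2 / 2 \<partial>\<mu>)"

lemma X_sq_bound: "0 \<le> t \<Longrightarrow> (X t x)\<^sup>2 \<le> 2 * x\<^sup>2 + 2 * (\<integral>y. \<bar>y\<bar> \<partial>\<mu>)\<^sup>2"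
proof -
  assume t: "0 \<le> t"
  let ?m = "\<integral>y. \<bar>y\<bar> \<partial>\<mu>"
  have "\<bar>X t x\<bar>\<^sup>2 \<le> (\<bar>x\<bar> + ?m)\<^sup>2" by (intro power_mono X_growth[OF t]) auto
  also have "\<dots> \<le> 2 * \<bar>x\<bar>\<^sup>2 + 2 * ?m\<^sup>2"
    using zero_le_power2[of "\<bar>x\<bar> - ?m"] by (simp only: power2_sum power2_diff)
  finally show ?thesis by simp
qed

lemma integrable_X_sq: "0 \<le> t \<Longrightarrow> integrable \<mu> (\<lambda>x. (X t x)\<^sup>2)"
proof -
  assume t: "0 \<le> t"
  show ?thesis
  proof (rule Bochner_Integration.integrable_bound)
    show "integrable \<mu> (\<lambda>x. 2 * x\<^sup>2 + 2 * (\<integral>y. \<bar>y\<bar> \<partial>\<mu>)\<^sup>2)" using sq by simp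
    show "(\<lambda>x. (X t x)\<^sup>2) \<in> borel_measurable \<mu>" using X_meas[OF t] by simp
    show "AE x in \<mu>. norm ((X t x)\<^sup>2) \<le> norm (2 * x\<^sup>2 + 2 * (\<integral>y. \<bar>y\<bar> \<partial>\<mu>)\<^sup>2)"
    proof (rule AE_I2)
      fix x
      have "norm ((X t x)\<^sup>2) = (X t x)\<^sup>2" by simp
      also have "\<dots> \<le> 2 * x\<^sup>2 + 2 * (\<integral>y. \<bar>y\<bar> \<partial>\<mu>)\<^sup>2" by (rule X_sq_bound[OF t])
      also have "\<dots> \<le> norm (2 * x\<^sup>2 + 2 * (\<integral>y. \<bar>y\<bar> \<partial>\<mu>)\<^sup>2)" unfolding real_norm_def by (rule abs_ge_self)
      finally show "norm ((X t x)\<^sup>2) \<le> norm (2 * x\<^sup>2 + 2 * (\<integral>y. \<bar>y\<bar> \<partial>\<mu>)\<^sup>2)" .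
    qed
  qed
qed

lemma law_P2cm: "0 \<le> t \<Longrightarrow> law t \<in> P2cm"
proof -
  assume t: "0 \<le> t"
  have "integrable (law t) (\<lambda>v. v\<^sup>2)" using integral_law(2)[OF t, of "\<lambda>v. v\<^sup>2"] integrable_X_sq[OF t] by simp
  moreover have "(\<integral>v. v \<partial>law t) = 0" using integral_law(1)[OF t, of "\<lambda>v. v"] X_mean[OF t] by simp
  ultimately show ?thesis using law_borel_prob[OF t] by (simp add: P2cm_def)
qed

lemma energy_law: "0 \<le> t \<Longrightarrow> energy (law t) = En t"
  using integral_law(1)[of t "\<lambda>v. v\<^sup>2"] unfolding energy_def En_def by simp

lemma En_cont: "continuous_on {0..} En"
  unfolding En_def
proof (rule continuous_on_integral_dominated)
  show "continuous_on {0..} (\<lambda>s. (X s x)\<^sup>2 / 2)" for x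
    by (intro continuous_on_divide continuous_on_power X_cont_time continuous_on_const) auto
  show "(\<lambda>x. (X s x)\<^sup>2 / 2) \<in> borel_measurable \<mu>" if "s \<in> {0..}" for s using integrable_X_sq[of s] that by auto
  show "\<bar>(X s x)\<^sup>2 / 2\<bar> \<le> 2 * x\<^sup>2 + 2 * (\<integral>y. \<bar>y\<bar> \<partial>\<mu>)\<^sup>2" if "s \<in> {0..}" for s x
  proof -
    have "\<bar>(X s x)\<^sup>2 / 2\<bar> \<le> (X s x)\<^sup>2" by simp
    also have "\<dots> \<le> 2 * x\<^sup>2 + 2 * (\<integral>y. \<bar>y\<bar> \<partial>\<mu>)\<^sup>2" using that by (intro X_sq_bound) simp
    finally show ?thesis .
  qed
  show "integrable \<mu> (\<lambda>x. 2 * x\<^sup>2 + 2 * (\<integral>y. \<bar>y\<bar> \<partial>\<mu>)\<^sup>2)" using sq by simp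
qed

text \<open>Testing the friction force with the velocity itself produces the cubic dissipation.\<close>

lemma velocity_work: "0 < t \<Longrightarrow> (\<integral>x. X t x * velocity (X t) x \<partial>\<mu>) = - diss t"
proof -
  assume t: "0 < t"
  have "(\<integral>x. X t x * velocity (X t) x \<partial>\<mu>) = c * (\<integral>z. friction (X t (fst z) - X t (snd z)) * (X t (snd z) - X t (fst z)) \<partial>(\<mu> \<Otimes>\<^sub>M \<mu>))"
    using t by (intro friction_pairing(2)[symmetric, of t "X t" "1 / (c * t)"] X_cont X_decay) auto
  also have "\<dots> = (\<integral>z. - (c * \<bar>X t (fst z) - X t (snd z)\<bar> ^ 3) \<partial>(\<mu> \<Otimes>\<^sub>M \<mu>))"
    unfolding integral_mult_right_zero[symmetric]
  proof (rule Bochner_Integration.integral_cong[OF refl])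
    fix z :: "real \<times> real"
    have "friction r * (- r) = - (\<bar>r\<bar> ^ 3)" for r :: real
      by (simp add: friction_def power3_eq_cube abs_if)
    from this[of "X t (fst z) - X t (snd z)"]
    show "c * (friction (X t (fst z) - X t (snd z)) * (X t (snd z) - X t (fst z))) = - (c * \<bar>X t (fst z) - X t (snd z)\<bar> ^ 3)"
      by simp
  qed
  also have "\<dots> = - diss t" unfolding diss_def by simp
  finally show ?thesis .
qed

lemma En_deriv: "0 < t \<Longrightarrow> (En has_real_derivative - diss t) (at t)"
proof -
  assume t: "0 < t"
  define R where "R = 1 / (c * (t / 2))"
  have R: "\<bar>X s x\<bar> \<le> R" if "s \<in> {t/2<..}" for s x
  proof -
    have "\<bar>X s x\<bar> \<le> 1 / (c * s)" using that t by (intro X_decay) auto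
    also have "\<dots> \<le> R" unfolding R_def using that t c by (intro divide_left_mono mult_left_mono mult_pos_pos) auto
    finally show ?thesis .
  qed
  have R0: "0 \<le> R" using t c by (simp add: R_def)
  have "(En has_real_derivative (\<integral>x. X t x * velocity (X t) x \<partial>\<mu>)) (at t)"
    unfolding En_def
  proof (rule DERIV_integral_dominated[of "{t/2<..}"])
    show "((\<lambda>s. (X s x)\<^sup>2 / 2) has_real_derivative X t x * velocity (X t) x) (at t)" for x
      using X_deriv[OF t, of x] by (auto intro!: derivative_eq_intros)
    show "integrable \<mu> (\<lambda>x. (X s x)\<^sup>2 / 2)" if "s \<in> {t/2<..}" for s
      using integrable_X_sq[of s] that t by simp
    show "\<bar>(X s x)\<^sup>2 / 2 - (X t x)\<^sup>2 / 2\<bar> \<le> (R * (2 * c * spread x)) * \<bar>s - t\<bar>" if s: "s \<in> {t/2<..}" for s x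
    proof -
      have "(X s x)\<^sup>2 / 2 - (X t x)\<^sup>2 / 2 = ((X s x + X t x) / 2) * (X s x - X t x)"
        by (simp add: power2_eq_square field_simps)
      then have "\<bar>(X s x)\<^sup>2 / 2 - (X t x)\<^sup>2 / 2\<bar> = \<bar>(X s x + X t x) / 2\<bar> * \<bar>X s x - X t x\<bar>"
        by (simp only: abs_mult)
      also have "\<dots> \<le> R * (2 * c * \<bar>s - t\<bar> * spread x)"
      proof (rule mult_mono)
        show "\<bar>(X s x + X t x) / 2\<bar> \<le> R" using R[OF s, of x] R[of t x] t by (simp add: abs_le_iff)
        show "\<bar>X s x - X t x\<bar> \<le> 2 * c * \<bar>s - t\<bar> * spread x" using X_time[of t s x] s t by simp
      qed (use R0 in auto)
      finally show ?thesis by (simp only: ac_simps)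
    qed
    show "integrable \<mu> (\<lambda>x. R * (2 * c * spread x))" using integrable_spread by simp
    show "(\<lambda>x. X t x * velocity (X t) x) \<in> borel_measurable \<mu>"
      using X_meas[of t] velocity_meas[of t] t by simp
  qed (use t in auto)
  then show ?thesis unfolding velocity_work[OF t] .
qed

lemma diss_integral:
  assumes "0 < a" "a \<le> b" shows "(\<integral>\<^sup>+t. ennreal (diss t) \<partial>lebesgue_on {a..b}) = ennreal (En a - En b)"
proof -
  have cd: "continuous_on {a..b} diss" by (rule continuous_on_subset[OF diss_cont]) (use assms in auto)
  have "((\<lambda>t. - diss t) has_integral En b - En a) {a..b}"
  proof (rule fundamental_theorem_of_calculus)
    fix x assume x: "x \<in> {a..b}"
    have "(En has_real_derivative - diss x) (at x within {a..b})"
      by (rule has_field_derivative_at_within[OF En_deriv]) (use x assms in auto)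
    then show "(En has_vector_derivative - diss x) (at x within {a..b})"
      by (simp add: has_real_derivative_iff_has_vector_derivative)
  qed (rule assms)
  from has_integral_neg[OF this] have "integral {a..b} diss = En a - En b" by (simp add: integral_unique)
  moreover have "(\<integral>\<^sup>+t. ennreal (diss t) \<partial>lebesgue_on {a..b}) = ennreal (\<integral>t. diss t \<partial>lebesgue_on {a..b})"
    by (rule nn_integral_eq_integral[OF integral_lebesgue_on_continuous(1)[OF cd]]) (simp add: diss_nonneg)
  ultimately show ?thesis using integral_lebesgue_on_continuous(2)[OF cd] by simp
qed

text \<open>
  At the initial time the dissipation may be infinite. The identity is obtained on intervals away
  from zero, and monotone convergence together with the continuity of the energy extends it.
\<close>

lemma energy_identity:
  assumes T: "0 < T"
  shows "(\<integral>\<^sup>+t. dissipation e (law t) \<partial>lebesgue_on {0..T}) = ennreal (En 0 - En T)" "En T \<le> En 0"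
proof -
  define a where "a n = T * inverse (real (Suc n))" for n
  have a: "0 < a n" "a n \<le> T" for n
    unfolding a_def using T by (auto intro!: mult_left_le simp: inverse_le_1_iff)
  have a_dec: "a n \<le> a m" if "m \<le> n" for m n
    unfolding a_def using T that by (intro mult_left_mono le_imp_inverse_le) auto
  have a_lim: "a \<longlonglongrightarrow> 0"
    unfolding a_def using tendsto_mult[OF tendsto_const LIMSEQ_inverse_real_of_nat, of T] by simp
  define F where "F n t = ennreal (diss t) * indicator {a n..T} t" for n t
  have Fm: "F n \<in> borel_measurable lebesgue" for n
  proof -
    have "(\<lambda>t. indicator {a n..T} t *\<^sub>R diss t) \<in> borel_measurable borel"
      by (rule borel_measurable_continuous_on_indicator) (use a[of n] in \<open>auto intro: continuous_on_subset[OF diss_cont]\<close>)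
    then have "(\<lambda>t. ennreal (indicator {a n..T} t *\<^sub>R diss t)) \<in> borel_measurable lborel" by simp
    then have "(\<lambda>t. ennreal (indicator {a n..T} t *\<^sub>R diss t)) \<in> borel_measurable lebesgue" by (rule measurable_completion)
    moreover have "(\<lambda>t. ennreal (indicator {a n..T} t *\<^sub>R diss t)) = F n"
      by (auto simp: F_def indicator_def)
    ultimately show ?thesis by simp
  qed
  have Fi: "(\<integral>\<^sup>+t. F n t \<partial>lebesgue) = ennreal (En (a n) - En T)" for n
    unfolding F_def using diss_integral[OF a] by (simp add: nn_integral_restrict_space)
  have "(\<lambda>n. \<integral>\<^sup>+t. F n t \<partial>lebesgue) \<longlonglongrightarrow> (\<integral>\<^sup>+t. ennreal (diss t) * indicator {0<..T} t \<partial>lebesgue)"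
  proof (rule nn_integral_LIMSEQ)
    show "incseq F"
      unfolding incseq_def le_fun_def F_def
    proof (intro allI impI mult_left_mono)
      fix m n t assume "(m::nat) \<le> n"
      then show "indicator {a m..T} t \<le> (indicator {a n..T} t :: ennreal)"
        using a_dec[of m n] by (auto simp: indicator_def)
    qed simp
    show "(\<lambda>n. F n t) \<longlonglongrightarrow> ennreal (diss t) * indicator {0<..T} t" for t
    proof (cases "0 < t")
      case True
      have "\<forall>\<^sub>F n in sequentially. a n < t" by (rule order_tendstoD(2)[OF a_lim True])
      then have "\<forall>\<^sub>F n in sequentially. F n t = ennreal (diss t) * indicator {0<..T} t"
        by eventually_elim (use True in \<open>auto simp: F_def indicator_def\<close>)
      then show ?thesis by (rule tendsto_eventually)
    next
      case False
      then have "F n t = 0" for n using a(1)[of n] by (auto simp: F_def indicator_def)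
      then show ?thesis using False by simp
    qed
  qed (rule Fm)
  moreover have "(\<lambda>n. En (a n) - En T) \<longlonglongrightarrow> En 0 - En T"
    using a(1) by (intro tendsto_diff tendsto_const continuous_on_tendsto_compose[OF En_cont a_lim]) (auto intro!: always_eventually less_imp_le)
  then have "(\<lambda>n. \<integral>\<^sup>+t. F n t \<partial>lebesgue) \<longlonglongrightarrow> ennreal (En 0 - En T)"
    unfolding Fi by (rule tendsto_ennrealI)
  ultimately have eq: "(\<integral>\<^sup>+t. ennreal (diss t) * indicator {0<..T} t \<partial>lebesgue) = ennreal (En 0 - En T)"
    by (rule LIMSEQ_unique)
  have ne0: "AE t in lebesgue. t \<noteq> (0::real)"
    using AE_lborel_singleton[of 0] by (rule AE_completion)
  have "(\<integral>\<^sup>+t. dissipation e (law t) \<partial>lebesgue_on {0..T}) = (\<integral>\<^sup>+t. dissipation e (law t) * indicator {0..T} t \<partial>lebesgue)"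
    by (simp add: nn_integral_restrict_space)
  also have "\<dots> = (\<integral>\<^sup>+t. ennreal (diss t) * indicator {0<..T} t \<partial>lebesgue)"
  proof (rule nn_integral_cong_AE, use ne0 in eventually_elim)
    case (elim t)
    show ?case
    proof (cases "0 < t")
      case True then show ?thesis by (auto simp: dissipation_law indicator_def)
    next
      case False then show ?thesis using elim by (auto simp: indicator_def)
    qed
  qed
  finally show "(\<integral>\<^sup>+t. dissipation e (law t) \<partial>lebesgue_on {0..T}) = ennreal (En 0 - En T)" unfolding eq .
  have "0 \<le> En (a n) - En T" for n
  proof -
    have "En T \<le> En (a n)"
    proof (rule DERIV_nonpos_imp_nonincreasing[OF a(2)])
      fix x assume "a n \<le> x" "x \<le> T"
      then have "0 < x" using a(1)[of n] by linarith
      then show "\<exists>y. (En has_real_derivative y) (at x) \<and> y \<le> 0" using En_deriv diss_nonneg by (metis neg_le_0_iff_le)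
    qed
    then show ?thesis by simp
  qed
  then have "0 \<le> En 0 - En T"
    using \<open>(\<lambda>n. En (a n) - En T) \<longlonglongrightarrow> En 0 - En T\<close> by (intro LIMSEQ_le_const) auto
  then show "En T \<le> En 0" by simp
qed

section \<open>Transport cost along the curve\<close>

text \<open>
  The reparametrized piece of the curve is one of the competitors in the infimum.
\<close>

lemma cost_le_reparametrized:
  assumes a: "admissible_time 1 \<theta> k" and pos: "\<And>s. s \<in> {0..1} \<Longrightarrow> 0 < \<theta> s"
    and M: "\<And>s. s \<in> {0..1} \<Longrightarrow> (k s)\<^sup>2 * diss (\<theta> s) \<le> M"
  shows "transport_cost_sq e (law (\<theta> 0)) (law (\<theta> 1)) \<le> ennreal M"
proof -
  let ?p = "(\<lambda>s. law (\<theta> s), \<lambda>s. flux (k s) (\<theta> s))"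
  have "?p \<in> CE_between e 1 (law (\<theta> 0)) (law (\<theta> 1))"
    unfolding CE_between_def using curve_in_CE[OF a] by simp
  then have "transport_cost_sq e (law (\<theta> 0)) (law (\<theta> 1))
      \<le> (case ?p of (f, U) \<Rightarrow> \<integral>\<^sup>+t. action e (f t) (U t) \<partial>lebesgue_on {0..1})"
    unfolding transport_cost_sq_def by (rule INF_lower)
  also have "\<dots> = (\<integral>\<^sup>+s. action e (law (\<theta> s)) (flux (k s) (\<theta> s)) \<partial>lebesgue_on {0..1})" by simp
  also have "\<dots> \<le> (\<integral>\<^sup>+s. ennreal M \<partial>lebesgue_on {0..1::real})"
  proof (rule nn_integral_mono)
    fix s assume "s \<in> space (lebesgue_on {0..1::real})"
    then have s: "s \<in> {0..1}" by (simp add: space_restrict_space)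
    have "action e (law (\<theta> s)) (flux (k s) (\<theta> s)) = ennreal ((k s)\<^sup>2 * diss (\<theta> s))"
      using pos[OF s] diss_nonneg by (simp add: action_flux dissipation_law ennreal_mult)
    also have "\<dots> \<le> ennreal M" by (rule ennreal_leI[OF M[OF s]])
    finally show "action e (law (\<theta> s)) (flux (k s) (\<theta> s)) \<le> ennreal M" .
  qed
  also have "\<dots> = ennreal M" by (simp only: nn_integral_const emeasure_lebesgue_unit mult_1_right)
  finally show ?thesis .
qed

lemma cost_le_linear:
  assumes t: "0 < t" "0 < u" and M: "\<And>r. r \<in> closed_segment t u \<Longrightarrow> diss r \<le> M"
  shows "transport_cost_sq e (law t) (law u) \<le> ennreal ((u - t)\<^sup>2 * M)"
proof -
  let ?\<theta> = "\<lambda>s. (1 - s) * t + s * u"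
  have pos: "0 < ?\<theta> s" if "s \<in> {0..1}" for s
  proof (cases "s = 0")
    case False
    then have "0 < s * u" "0 \<le> (1 - s) * t" using that t by auto
    then show ?thesis by linarith
  qed (use t in simp)
  have seg: "?\<theta> s \<in> closed_segment t u" if "s \<in> {0..1}" for s
    using that unfolding closed_segment_def by auto
  have d: "(?\<theta> has_real_derivative (u - t)) (at s)" for s
    by (auto intro!: derivative_eq_intros)
  have "admissible_time 1 ?\<theta> (\<lambda>_. u - t)"
    unfolding admissible_time_def using pos d
    by (auto intro!: continuous_intros less_imp_le)
  from cost_le_reparametrized[OF this pos, of "(u - t)\<^sup>2 * M"]
  show ?thesis using M seg by (simp add: mult_left_mono)
qed

end

text \<open>
  An odd, compactly supported derivative integrates to an even function that is constant, with the
  same constant, on both sides of the support. Subtracting the constant leaves a compactly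
  supported function, and the derivative may be chosen as the identity near the origin.
\<close>

lemma quadratic_cutoff:
  assumes L: "0 < L"
  obtains \<phi> where "C1c \<phi>" "lip1 (deriv \<phi>)" "\<And>v. \<bar>deriv \<phi> v\<bar> \<le> L" "\<And>v. \<bar>v\<bar> \<le> L \<Longrightarrow> deriv \<phi> v = v"
proof -
  define p where "p v = max (- tent L v) (min v (tent L v))" for v
  have lp: "lip1 p"
    unfolding p_def by (intro lip1_max lip1_min lip1_uminus lip1_tent) (simp add: lip1_def)
  have tb: "0 \<le> tent L v" "tent L v \<le> L" for v using tent_facts(1,5)[of L v] L by auto
  have pb: "\<bar>p v\<bar> \<le> L" for v unfolding p_def using tb[of v] by linarith
  have pid: "p v = v" if "\<bar>v\<bar> \<le> L" for v
    unfolding p_def tent_facts(3)[OF that] by linarith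
  have tev: "tent L (- v) = tent L v" for v by (simp add: tent_def)
  have odd: "p (- v) = - p v" for v unfolding p_def tev using tb(1)[of v] by linarith
  have p0: "p v = 0" if "2 * L < \<bar>v\<bar>" for v unfolding p_def tent_facts(4)[OF that] by simp
  obtain \<Psi> where \<Psi>: "\<And>x. (\<Psi> has_real_derivative p x) (at x)"
    using antiderivative_exists[OF lip1_continuous[OF lp]] by blast
  have "((\<lambda>v. \<Psi> v - \<Psi> (- v)) has_real_derivative 0) (at v)" for v
  proof -
    have "((\<lambda>v. \<Psi> (- v)) has_real_derivative p (- v) * (- 1)) (at v)"
      by (rule DERIV_chain2[OF \<Psi>]) (auto intro!: derivative_eq_intros)
    from DERIV_diff[OF \<Psi>[of v] this] show ?thesis by (simp add: odd)
  qed
  then have "\<Psi> v - \<Psi> (- v) = \<Psi> 0 - \<Psi> (- 0)" for v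
    using DERIV_isconst_all[of "\<lambda>v. \<Psi> v - \<Psi> (- v)" v 0] by blast
  then have even: "\<Psi> (- v) = \<Psi> v" for v by simp
  define \<phi> where "\<phi> v = \<Psi> v - \<Psi> (2 * L)" for v
  have d: "(\<phi> has_real_derivative p v) (at v)" for v
    unfolding \<phi>_def[abs_def] using DERIV_diff[OF \<Psi>[of v] DERIV_const[of "\<Psi> (2 * L)"]] by simp
  have right: "\<phi> v = 0" if "2 * L < v" for v
  proof -
    have "\<Psi> v = \<Psi> (2 * L)"
    proof (rule DERIV_isconst_end[OF that])
      show "continuous_on {2 * L..v} \<Psi>"
        using \<Psi> DERIV_isCont continuous_at_imp_continuous_on by blast
      show "(\<Psi> has_real_derivative 0) (at x)" if "2 * L < x" "x < v" for x
        using \<Psi>[of x] p0[of x] that L by simp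
    qed
    then show ?thesis by (simp add: \<phi>_def)
  qed
  have z: "\<phi> v = 0" if "2 * L < \<bar>v\<bar>" for v
    using right[of v] right[of "- v"] that even[of v] by (cases "0 \<le> v") (auto simp: \<phi>_def)
  have C: "C1c \<phi>" "deriv \<phi> = p" using C1cI[of \<phi> p "2 * L"] d lip1_continuous[OF lp] z by blast+
  show thesis by (rule that[of \<phi>]) (use C lp pb pid in auto)
qed

context friction_flow
begin

definition speed_bound :: "real \<Rightarrow> real" where "speed_bound t = sqrt (diss t) + 1"

lemma speed_bound_cont: "continuous_on {0<..} speed_bound"
  unfolding speed_bound_def by (intro continuous_on_add continuous_on_const continuous_on_real_sqrt diss_cont)

text \<open>
  Running through the curve with speed inversely proportional to a continuous positive majorant of
  the metric speed makes the action at most the squared integral of the majorant. Adding one to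
  the metric speed keeps the majorant away from zero.
\<close>

lemma cost_le_length:
  assumes t: "0 < t0" "t0 < t1"
  shows "transport_cost_sq e (law t0) (law t1) \<le> ennreal ((integral {t0..t1} speed_bound)\<^sup>2)"
proof -
  \<comment> \<open>freezing the speed before t0 gives a function on the whole line, so that its antiderivative is onto\<close>
  define r where "r t = speed_bound (max t0 t)" for t
  have r1: "1 \<le> r t" for t unfolding r_def speed_bound_def using diss_nonneg by simp
  have cr: "continuous_on S r" for S
    unfolding r_def using t
    by (intro continuous_on_compose2[OF speed_bound_cont] continuous_on_max continuous_on_const continuous_on_id) auto
  obtain R where R: "\<And>x. (R has_real_derivative r x) (at x)" using antiderivative_exists[OF cr] by blast
  have expand: "y - x \<le> R y - R x" if "x \<le> y" for x y
  proof -
    have "R x - x \<le> R y - y"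
    proof (rule DERIV_nonneg_imp_nondecreasing[OF that])
      fix z
      have "((\<lambda>x. R x - x) has_real_derivative r z - 1) (at z)" by (intro DERIV_diff R DERIV_ident)
      then show "\<exists>y. ((\<lambda>x. R x - x) has_real_derivative y) (at z) \<and> 0 \<le> y" using r1[of z] by (auto intro!: exI[of _ "r z - 1"])
    qed
    then show ?thesis by simp
  qed
  have Rc: "continuous_on S R" for S using R DERIV_isCont continuous_at_imp_continuous_on by blast
  have surj: "\<exists>x. R x = y" for y
  proof -
    define b where "b = \<bar>y - R 0\<bar>"
    have b0: "0 \<le> b" by (simp add: b_def)
    have "R (- b) \<le> y" "y \<le> R b" using expand[of "- b" 0] expand[of 0 b] b0 by (auto simp: b_def)
    then show ?thesis using IVT'[of R "- b" y b] Rc b0 by auto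
  qed
  then obtain g where g: "\<And>y. R (g y) = y" by metis
  have glip: "\<bar>g y - g y'\<bar> \<le> \<bar>y - y'\<bar>" for y y'
    using expand[of "g y" "g y'"] expand[of "g y'" "g y"] g by (cases "g y \<le> g y'") auto
  have gc: "continuous_on S g" for S by (rule lip1_continuous) (simp add: lip1_def glip)
  have gR: "g (R x) = x" for x
    using expand[of "g (R x)" x] expand[of x "g (R x)"] g[of "R x"] by (cases "x \<le> g (R x)") auto
  have gd: "(g has_real_derivative inverse (r (g y))) (at y)" for y
  proof (rule DERIV_inverse_function[of R _ _ _ "y - 1" "y + 1"])
    show "(R has_real_derivative r (g y)) (at (g y))" by (rule R)
    show "r (g y) \<noteq> 0" using r1[of "g y"] by linarith
    show "isCont g y" using gc[of UNIV] by (simp add: continuous_on_eq_continuous_at)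
  qed (use g in auto)
  define Z where "Z = R t1 - R t0"
  have Z0: "0 < Z" using expand[of t0 t1] t by (simp add: Z_def)
  have Zint: "Z = integral {t0..t1} speed_bound"
  proof -
    have "(r has_integral Z) {t0..t1}"
      unfolding Z_def using t R
      by (intro fundamental_theorem_of_calculus) (auto simp flip: has_real_derivative_iff_has_vector_derivative intro: has_field_derivative_at_within)
    then have "Z = integral {t0..t1} r" by (simp add: integral_unique)
    also have "\<dots> = integral {t0..t1} speed_bound"
      by (rule Henstock_Kurzweil_Integration.integral_cong) (simp add: r_def)
    finally show ?thesis .
  qed
  define \<theta> where "\<theta> s = g (R t0 + Z * s)" for s
  define k where "k s = Z * inverse (r (\<theta> s))" for s
  have \<theta>d: "(\<theta> has_real_derivative k s) (at s)" for s
  proof -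
    have "((\<lambda>s. R t0 + Z * s) has_real_derivative Z) (at s)" by (auto intro!: derivative_eq_intros)
    from DERIV_chain2[OF gd this] show ?thesis unfolding \<theta>_def[abs_def] k_def by (simp add: mult.commute)
  qed
  have \<theta>ge: "t0 \<le> \<theta> s" if "0 \<le> s" for s
  proof (rule ccontr)
    assume "\<not> ?thesis"
    then have "\<theta> s < t0" by simp
    then have "R (\<theta> s) < R t0" using expand[of "\<theta> s" t0] by linarith
    moreover have "R (\<theta> s) = R t0 + Z * s" by (simp add: \<theta>_def g)
    ultimately show False using Z0 that mult_nonneg_nonneg[of Z s] by linarith
  qed
  have \<theta>c: "continuous_on S \<theta>" for S using \<theta>d DERIV_isCont continuous_at_imp_continuous_on by blast
  have kc: "continuous_on S k" for S
  proof -
    have "r (\<theta> s) \<noteq> 0" for s using r1[of "\<theta> s"] by linarith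
    then show ?thesis unfolding k_def
      by (intro continuous_on_mult continuous_on_const continuous_on_inverse continuous_on_compose2[OF cr \<theta>c]) auto
  qed
  have pos: "0 < \<theta> s" if "s \<in> {0..1}" for s using \<theta>ge[of s] that t by simp
  have a: "admissible_time 1 \<theta> k"
    unfolding admissible_time_def using \<theta>c kc \<theta>d pos by (auto intro: less_imp_le)
  have "transport_cost_sq e (law (\<theta> 0)) (law (\<theta> 1)) \<le> ennreal (Z\<^sup>2)"
  proof (rule cost_le_reparametrized[OF a pos])
    fix s :: real assume s: "s \<in> {0..1}"
    have rs: "r (\<theta> s) = sqrt (diss (\<theta> s)) + 1" using \<theta>ge[of s] s by (simp add: r_def speed_bound_def max_def)
    have "diss (\<theta> s) = (sqrt (diss (\<theta> s)))\<^sup>2" using diss_nonneg by simp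
    also have "\<dots> \<le> (r (\<theta> s))\<^sup>2" unfolding rs using diss_nonneg by (intro power_mono) auto
    finally have "(inverse (r (\<theta> s)))\<^sup>2 * diss (\<theta> s) \<le> (inverse (r (\<theta> s)))\<^sup>2 * (r (\<theta> s))\<^sup>2" by (intro mult_left_mono) auto
    also have "\<dots> = 1" using r1[of "\<theta> s"] by (simp add: power_mult_distrib[symmetric])
    finally have "Z\<^sup>2 * ((inverse (r (\<theta> s)))\<^sup>2 * diss (\<theta> s)) \<le> Z\<^sup>2 * 1" by (intro mult_left_mono) auto
    then show "(k s)\<^sup>2 * diss (\<theta> s) \<le> Z\<^sup>2" by (simp add: k_def power_mult_distrib mult.assoc)
  qed
  moreover have "\<theta> 0 = t0" "\<theta> 1 = t1" unfolding \<theta>_def Z_def by (simp_all add: gR)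
  ultimately show ?thesis by (simp add: Zint)
qed

lemma transport_cost_le:
  assumes "transport_cost_sq e a b \<le> ennreal (B\<^sup>2)" "0 \<le> B"
  shows "transport_cost e a b \<le> ennreal B"
proof -
  have fin: "transport_cost_sq e a b \<noteq> \<infinity>" using assms(1) by (auto simp: top_unique)
  have "enn2real (transport_cost_sq e a b) \<le> B\<^sup>2"
    using assms(1) by (metis enn2real_mono enn2real_ennreal ennreal_less_top zero_le_power2)
  then have "sqrt (enn2real (transport_cost_sq e a b)) \<le> B"
    using assms(2) by (metis real_sqrt_le_mono real_sqrt_abs abs_of_nonneg)
  then show ?thesis unfolding transport_cost_def using fin by (simp add: ennreal_leI)
qed

lemma speed_bound_sq_integrable:
  assumes T: "0 < T" shows "integrable (lebesgue_on {0<..<T}) (\<lambda>t. (speed_bound t)\<^sup>2)"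
    "speed_bound \<in> borel_measurable (lebesgue_on {0<..<T})"
proof -
  show m: "speed_bound \<in> borel_measurable (lebesgue_on {0<..<T})"
    by (rule continuous_imp_measurable_on_sets_lebesgue[OF continuous_on_subset[OF speed_bound_cont]]) auto
  have md: "diss \<in> borel_measurable (lebesgue_on {0<..<T})"
    by (rule continuous_imp_measurable_on_sets_lebesgue[OF continuous_on_subset[OF diss_cont]]) auto
  have "(\<integral>\<^sup>+t. ennreal (diss t) \<partial>lebesgue_on {0<..<T}) \<le> (\<integral>\<^sup>+t. dissipation e (law t) \<partial>lebesgue_on {0..T})"
  proof -
    have "(\<integral>\<^sup>+t. ennreal (diss t) \<partial>lebesgue_on {0<..<T}) = (\<integral>\<^sup>+t. ennreal (diss t) * indicator {0<..<T} t \<partial>lebesgue)"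
      by (simp add: nn_integral_restrict_space)
    also have "\<dots> \<le> (\<integral>\<^sup>+t. dissipation e (law t) * indicator {0..T} t \<partial>lebesgue)"
      by (intro nn_integral_mono) (auto simp: indicator_def dissipation_law)
    also have "\<dots> = (\<integral>\<^sup>+t. dissipation e (law t) \<partial>lebesgue_on {0..T})"
      by (simp add: nn_integral_restrict_space)
    finally show ?thesis .
  qed
  also have "\<dots> < \<infinity>" unfolding energy_identity[OF T] by simp
  finally have fin: "(\<integral>\<^sup>+t. ennreal (diss t) \<partial>lebesgue_on {0<..<T}) < \<infinity>" .
  have id: "integrable (lebesgue_on {0<..<T}) diss"
    using md fin diss_nonneg by (intro integrableI_nonneg) auto
  have "finite_measure (lebesgue_on {0<..<T})"
    by (rule finite_measure_lebesgue_on) simp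
  then have i: "integrable (lebesgue_on {0<..<T}) (\<lambda>t. 2 * diss t + 2)"
    using id by (intro Bochner_Integration.integrable_add integrable_mult_right finite_measure.integrable_const)
  show "integrable (lebesgue_on {0<..<T}) (\<lambda>t. (speed_bound t)\<^sup>2)"
  proof (rule Bochner_Integration.integrable_bound[OF i])
    show "(\<lambda>t. (speed_bound t)\<^sup>2) \<in> borel_measurable (lebesgue_on {0<..<T})" using m by simp
    show "AE t in lebesgue_on {0<..<T}. norm ((speed_bound t)\<^sup>2) \<le> norm (2 * diss t + 2)"
    proof (rule AE_I2)
      fix t
      have "(speed_bound t)\<^sup>2 = (sqrt (diss t))\<^sup>2 + 2 * sqrt (diss t) + 1" by (simp add: speed_bound_def power2_eq_square algebra_simps)
      also have "\<dots> \<le> 2 * (sqrt (diss t))\<^sup>2 + 2"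
        using zero_le_power2[of "sqrt (diss t) - 1"] by (simp add: power2_eq_square algebra_simps)
      also have "\<dots> = 2 * diss t + 2" using diss_nonneg by simp
      finally show "norm ((speed_bound t)\<^sup>2) \<le> norm (2 * diss t + 2)" using diss_nonneg[of t] by simp
    qed
  qed
qed

lemma law_AC: "0 < T \<Longrightarrow> law \<in> AC e T P2cm"
  unfolding AC_def
proof (intro CollectI conjI ballI exI[of _ speed_bound] allI impI)
  assume T: "0 < T"
  show "law t \<in> P2cm" if "t \<in> {0..T}" for t using law_P2cm that by simp
  show "speed_bound \<in> borel_measurable (lebesgue_on {0<..<T})" "integrable (lebesgue_on {0<..<T}) (\<lambda>t. (speed_bound t)\<^sup>2)"
    using speed_bound_sq_integrable[OF T] by auto
  fix t0 t1 assume t: "0 < t0 \<and> t0 \<le> t1 \<and> t1 < T"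
  have cs: "continuous_on {t0..t1} speed_bound" by (rule continuous_on_subset[OF speed_bound_cont]) (use t in auto)
  have sb: "0 \<le> speed_bound t" for t unfolding speed_bound_def using diss_nonneg by simp
  let ?I = "integral {t0..t1} speed_bound"
  have I0: "0 \<le> ?I" using sb by (intro Henstock_Kurzweil_Integration.integral_nonneg integrable_continuous_interval cs)
  have "transport_cost_sq e (law t0) (law t1) \<le> ennreal (?I\<^sup>2)"
  proof (cases "t0 = t1")
    case True
    have "transport_cost_sq e (law t0) (law t0) \<le> ennreal ((t0 - t0)\<^sup>2 * diss t0)"
      using t by (intro cost_le_linear) auto
    then show ?thesis using True by simp
  next
    case False
    then show ?thesis using t by (intro cost_le_length) auto
  qed
  then have "transport_cost e (law t0) (law t1) \<le> ennreal ?I" by (rule transport_cost_le[OF _ I0])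
  then have "enn2ereal (transport_cost e (law t0) (law t1)) \<le> enn2ereal (ennreal ?I)" unfolding less_eq_ennreal.rep_eq .
  also have "\<dots> = ereal (\<integral>t. speed_bound t \<partial>lebesgue_on {t0..t1})"
    using I0 by (simp add: integral_lebesgue_on_continuous(2)[OF cs] enn2ereal_ennreal)
  finally show "enn2ereal (transport_cost e (law t0) (law t1)) \<le> ereal (\<integral>t. speed_bound t \<partial>lebesgue_on {t0..t1})" .
qed

section \<open>The metric derivative\<close>

text \<open>
  On the bounded support of the law the test function moves like the energy, so it decreases at the
  rate of the dissipation.
\<close>

lemma law_test_deriv:
  assumes t: "0 < t" and \<phi>: "C1c \<phi>" "\<And>v. \<bar>deriv \<phi> v\<bar> \<le> P" "\<And>v. \<bar>v\<bar> \<le> 1 / (c * t) \<Longrightarrow> deriv \<phi> v = v"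
  shows "((\<lambda>s. \<integral>v. \<phi> v \<partial>law s) has_real_derivative - diss t) (at t)"
proof -
  have d\<phi>: "(\<phi> has_real_derivative deriv \<phi> v) (at v)" for v
    using \<phi>(1) unfolding C1c_def by (auto simp: DERIV_deriv_iff_real_differentiable)
  have c\<phi>: "continuous_on UNIV \<phi>" by (rule C1c_bounded(2)[OF \<phi>(1)])
  obtain B where B: "\<And>v. \<bar>\<phi> v\<bar> \<le> B" using C1c_bounded(1)[OF \<phi>(1)] by (auto simp: bounded_iff)
  have P0: "0 \<le> P" using \<phi>(2)[of 0] by linarith
  have lip: "\<bar>\<phi> x - \<phi> y\<bar> \<le> P * \<bar>x - y\<bar>" for x y
    using field_differentiable_bound[of UNIV \<phi> "deriv \<phi>" P x y] d\<phi> \<phi>(2) by simp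
  have "((\<lambda>s. \<integral>x. \<phi> (X s x) \<partial>\<mu>) has_real_derivative (\<integral>x. X t x * velocity (X t) x \<partial>\<mu>)) (at t)"
  proof (rule DERIV_integral_dominated[of "{0<..}"])
    show "((\<lambda>s. \<phi> (X s x)) has_real_derivative X t x * velocity (X t) x) (at t)" for x
      using DERIV_chain2[OF d\<phi> X_deriv[OF t, of x]] \<phi>(3)[OF X_decay[OF t, of x]] by simp
    show "integrable \<mu> (\<lambda>x. \<phi> (X s x))" if "s \<in> {0<..}" for s
    proof (rule integrable_const_bound[of _ B])
      show "(\<lambda>x. \<phi> (X s x)) \<in> borel_measurable \<mu>"
        using that by (intro meas_cont continuous_on_compose2[OF c\<phi> X_cont]) auto
    qed (use B in auto)
    show "\<bar>\<phi> (X s x) - \<phi> (X t x)\<bar> \<le> (P * (2 * c * spread x)) * \<bar>s - t\<bar>" if s: "s \<in> {0<..}" for s x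
    proof -
      have "\<bar>\<phi> (X s x) - \<phi> (X t x)\<bar> \<le> P * \<bar>X s x - X t x\<bar>" by (rule lip)
      also have "\<dots> \<le> P * (2 * c * \<bar>s - t\<bar> * spread x)" using X_time[of t s x] s t P0 by (intro mult_left_mono) auto
      finally show ?thesis by (simp only: ac_simps)
    qed
    show "integrable \<mu> (\<lambda>x. P * (2 * c * spread x))" using integrable_spread by simp
    show "(\<lambda>x. X t x * velocity (X t) x) \<in> borel_measurable \<mu>" using X_meas[of t] velocity_meas[of t] t by simp
  qed (use t in auto)
  then have "((\<lambda>s. \<integral>x. \<phi> (X s x) \<partial>\<mu>) has_real_derivative - diss t) (at t)" unfolding velocity_work[OF t] .
  then show ?thesis
    by (rule has_field_derivative_transform_within_open[of _ _ _ "{0<..}"])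
      (use t c\<phi> in \<open>auto intro!: integral_law(1)[symmetric] borel_measurable_continuous_onI\<close>)
qed

lemma kinetic_law:
  assumes t: "0 < t" and p: "continuous_on UNIV p" "\<And>v. \<bar>v\<bar> \<le> 1 / (c * t) \<Longrightarrow> p v = v"
  shows "kinetic e p (law t) = diss t"
proof -
  have m: "(\<lambda>z. sigma_e e \<bar>fst z - snd z\<bar> * (p (snd z) - p (fst z))\<^sup>2) \<in> borel_measurable borel"
    unfolding sigma_e_def by (intro cont_borel continuous_intros continuous_on_compose2[OF p(1)]) auto
  have "kinetic e p (law t) = (\<integral>z. sigma_e e \<bar>fst (pair_at t z) - snd (pair_at t z)\<bar> * (p (snd (pair_at t z)) - p (fst (pair_at t z)))\<^sup>2 \<partial>(\<mu> \<Otimes>\<^sub>M \<mu>))"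
    unfolding kinetic_def law_prod[OF less_imp_le[OF t]] using t by (intro integral_distr pair_at_meas m) auto
  also have "\<dots> = diss t"
    unfolding diss_def
  proof (rule Bochner_Integration.integral_cong[OF refl])
    fix z :: "real \<times> real"
    have "p (X t (fst z)) = X t (fst z)" "p (X t (snd z)) = X t (snd z)" by (intro p X_decay t)+
    moreover have "c * \<bar>r\<bar> * r\<^sup>2 = c * \<bar>r\<bar> ^ 3" for r :: real
      by (simp add: power3_eq_cube power2_eq_square)
    from this[of "X t (fst z) - X t (snd z)"]
    have "c * \<bar>X t (fst z) - X t (snd z)\<bar> * (X t (snd z) - X t (fst z))\<^sup>2 = c * \<bar>X t (fst z) - X t (snd z)\<bar> ^ 3"
      by (simp only: power2_commute)
    ultimately show "sigma_e e \<bar>fst (pair_at t z) - snd (pair_at t z)\<bar> * (p (snd (pair_at t z)) - p (fst (pair_at t z)))\<^sup>2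
        = c * \<bar>X t (fst z) - X t (snd z)\<bar> ^ 3"
      unfolding sigma_c by (simp only: pair_at_def fst_conv snd_conv)
  qed
  finally show ?thesis .
qed

lemma cost_locally_finite:
  assumes t: "0 < t" and \<epsilon>: "0 < \<epsilon>"
  shows "\<forall>\<^sub>F h in at 0. transport_cost_sq e (law (t + h)) (law t) \<le> ennreal (h\<^sup>2 * (diss t + \<epsilon>))"
proof -
  have "isCont diss t" using diss_cont t by (simp add: continuous_on_eq_continuous_at)
  then obtain d where d: "d > 0" "\<And>u. \<bar>u - t\<bar> < d \<Longrightarrow> \<bar>diss u - diss t\<bar> < \<epsilon>"
    using \<epsilon> unfolding continuous_at_eps_delta by (auto simp: dist_real_def)
  define r where "r = min d t"
  have r: "0 < r" "r \<le> d" "r \<le> t" using d t by (auto simp: r_def)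
  show ?thesis
    unfolding eventually_at
  proof (intro exI[of _ r] conjI ballI impI)
    fix h :: real assume h: "h \<noteq> 0 \<and> dist h 0 < r"
    then have hr: "\<bar>h\<bar> < r" by (simp add: dist_real_def)
    have "transport_cost_sq e (law (t + h)) (law t) \<le> ennreal ((t - (t + h))\<^sup>2 * (diss t + \<epsilon>))"
    proof (rule cost_le_linear)
      show "0 < t + h" "0 < t" using hr r t by linarith+
      fix u assume "u \<in> closed_segment (t + h) t"
      then have "\<bar>u - t\<bar> \<le> \<bar>h\<bar>" by (auto simp: closed_segment_eq_real_ivl split: if_splits)
      then have "\<bar>diss u - diss t\<bar> < \<epsilon>" using hr r by (intro d(2)) linarith
      then show "diss u \<le> diss t + \<epsilon>" by linarith
    qed
    then show "transport_cost_sq e (law (t + h)) (law t) \<le> ennreal (h\<^sup>2 * (diss t + \<epsilon>))" by simp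
  qed (rule r)
qed

text \<open>
  The straight time change bounds the difference quotients of the cost from above. From below,
  a test function that is quadratic on the bounded support moves at rate minus the dissipation,
  while its kinetic term is the dissipation too, so that both bounds agree in the limit.
\<close>

lemma metric_derivative: "0 < t \<Longrightarrow> has_metric_deriv e law t (ennreal (sqrt (diss t)))"
proof -
  assume t: "0 < t"
  define L where "L = 1 / (c * t)"
  have L: "0 < L" using t c by (simp add: L_def)
  obtain \<phi> where \<phi>: "C1c \<phi>" "lip1 (deriv \<phi>)" "\<And>v. \<bar>deriv \<phi> v\<bar> \<le> L" "\<And>v. \<bar>v\<bar> \<le> L \<Longrightarrow> deriv \<phi> v = v"
    using quadratic_cutoff[OF L] by metis
  define M where "M = (\<integral>v. \<bar>v\<bar> \<partial>law t)"
  have i: "integrable (law t) (\<lambda>v. \<bar>v\<bar>)"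
    using integral_law(2)[of t "\<lambda>v. \<bar>v\<bar>"] integrable_X[of t] t by simp
  obtain C where C: "0 \<le> C" and lower: "\<And>\<mu>0 \<mu>1 q. \<lbrakk>integrable \<mu>1 (\<lambda>v. \<bar>v\<bar>); (\<integral>v. \<bar>v\<bar> \<partial>\<mu>1) \<le> M; 0 \<le> q; q < 1;
      transport_cost_sq e \<mu>0 \<mu>1 = ennreal q\<rbrakk> \<Longrightarrow>
      ((\<integral>v. \<phi> v \<partial>\<mu>0) - (\<integral>v. \<phi> v \<partial>\<mu>1))\<^sup>2 \<le> q * (kinetic e (deriv \<phi>) \<mu>1 + C * sqrt q)"
    using transport_cost_lower_bound[OF e \<phi>(1,2), of M] by metis
  have kin: "kinetic e (deriv \<phi>) (law t) = diss t"
    by (rule kinetic_law[OF t lip1_continuous[OF \<phi>(2)]]) (use \<phi>(4) in \<open>simp add: L_def\<close>)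
  define q where "q h = enn2real (transport_cost_sq e (law (t + h)) (law t))" for h
  define \<Delta> where "\<Delta> h = (\<integral>v. \<phi> v \<partial>law (t + h)) - (\<integral>v. \<phi> v \<partial>law t)" for h
  have q0: "0 \<le> q h" for h by (simp add: q_def)
  have upper: "\<forall>\<^sub>F h in at 0. transport_cost_sq e (law (t + h)) (law t) = ennreal (q h) \<and> q h \<le> h\<^sup>2 * (diss t + \<epsilon>)"
    if \<epsilon>: "0 < \<epsilon>" for \<epsilon>
    using cost_locally_finite[OF t \<epsilon>]
  proof eventually_elim
    case (elim h)
    have nn: "0 \<le> h\<^sup>2 * (diss t + \<epsilon>)" using diss_nonneg[of t] \<epsilon> by simp
    have "transport_cost_sq e (law (t + h)) (law t) < \<infinity>" using elim by (rule order.strict_trans1) simp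
    then have eq: "transport_cost_sq e (law (t + h)) (law t) = ennreal (q h)" unfolding q_def by simp
    then have "ennreal (q h) \<le> ennreal (h\<^sup>2 * (diss t + \<epsilon>))" using elim by simp
    then show ?case using eq nn by (simp add: ennreal_le_iff)
  qed
  have q_lim: "(q \<longlongrightarrow> 0) (at 0)"
  proof (rule Lim_null_comparison)
    show "\<forall>\<^sub>F h in at 0. norm (q h) \<le> h\<^sup>2 * (diss t + 1)"
      using upper[OF zero_less_one] by eventually_elim (simp add: q0)
    have "((\<lambda>h. h\<^sup>2 * (diss t + 1)) \<longlongrightarrow> 0\<^sup>2 * (diss t + 1)) (at 0)" by (intro tendsto_intros)
    then show "((\<lambda>h. h\<^sup>2 * (diss t + 1)) \<longlongrightarrow> 0) (at 0)" by simp
  qed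
  have \<Delta>_lim: "((\<lambda>h. \<Delta> h / h) \<longlongrightarrow> - diss t) (at 0)"
    using law_test_deriv[OF t \<phi>(1,3)] \<phi>(4) unfolding DERIV_def \<Delta>_def by (simp add: L_def)
  have Q_lim: "((\<lambda>h. q h / h\<^sup>2) \<longlongrightarrow> diss t) (at 0)"
  proof (rule order_tendstoI)
    fix a assume a: "diss t < a"
    have "0 < (a - diss t) / 2" using a by simp
    from upper[OF this] have "\<forall>\<^sub>F h in at 0. q h \<le> h\<^sup>2 * (diss t + (a - diss t) / 2) \<and> h \<noteq> (0::real)"
      using eventually_at_filter[of "\<lambda>h. h \<noteq> 0" 0 UNIV] by (auto elim: eventually_elim2)
    then show "\<forall>\<^sub>F h in at 0. q h / h\<^sup>2 < a"
    proof eventually_elim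
      case (elim h)
      then have "q h / h\<^sup>2 \<le> diss t + (a - diss t) / 2" by (simp add: pos_divide_le_eq mult.commute)
      also have "\<dots> < a" using a by (simp add: field_simps)
      finally show ?case .
    qed
  next
    fix a assume a: "a < diss t"
    show "\<forall>\<^sub>F h in at 0. a < q h / h\<^sup>2"
    proof (cases "a < 0")
      case True
      then have "a < q h / h\<^sup>2" for h using q0[of h] by (auto intro: less_le_trans)
      then show ?thesis by simp
    next
      case False
      then have dpos: "0 < diss t" using a by linarith
      have "((\<lambda>h. (\<Delta> h / h)\<^sup>2 / (diss t + C * sqrt (q h))) \<longlongrightarrow> (- diss t)\<^sup>2 / (diss t + C * sqrt 0)) (at 0)"
        using dpos by (intro tendsto_intros \<Delta>_lim q_lim) auto
      moreover have "(- diss t)\<^sup>2 / (diss t + C * sqrt 0) = diss t" using dpos by (simp add: power2_eq_square)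
      ultimately have "((\<lambda>h. (\<Delta> h / h)\<^sup>2 / (diss t + C * sqrt (q h))) \<longlongrightarrow> diss t) (at 0)" by simp
      then have "\<forall>\<^sub>F h in at 0. a < (\<Delta> h / h)\<^sup>2 / (diss t + C * sqrt (q h))" using a by (rule order_tendstoD)
      moreover have "\<forall>\<^sub>F h in at 0. q h < 1" using q_lim by (rule order_tendstoD) simp
      moreover have "\<forall>\<^sub>F h in at 0. h \<noteq> (0::real)" by (simp add: eventually_at_filter)
      ultimately show ?thesis using upper[OF zero_less_one]
      proof eventually_elim
        case (elim h)
        let ?K = "diss t + C * sqrt (q h)"
        have K: "0 < ?K" using dpos C q0[of h] by (simp add: add_pos_nonneg)
        have "(\<Delta> h)\<^sup>2 \<le> q h * ?K"
          unfolding \<Delta>_def kin[symmetric] using elim q0 i by (intro lower) (auto simp: M_def)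
        then have "(\<Delta> h)\<^sup>2 / h\<^sup>2 \<le> q h * ?K / h\<^sup>2" by (rule divide_right_mono) simp
        then have "(\<Delta> h / h)\<^sup>2 \<le> q h / h\<^sup>2 * ?K" by (simp add: power_divide)
        then have "(\<Delta> h / h)\<^sup>2 / ?K \<le> q h / h\<^sup>2" using K by (simp add: pos_divide_le_eq)
        then show ?case using elim(1) by linarith
      qed
    qed
  qed
  have "((\<lambda>h. ennreal (sqrt (q h / h\<^sup>2))) \<longlongrightarrow> ennreal (sqrt (diss t))) (at 0)"
    by (intro tendsto_ennrealI tendsto_real_sqrt Q_lim)
  moreover have "\<forall>\<^sub>F h in at 0. h \<noteq> (0::real)" by (simp add: eventually_at_filter)
  then have "\<forall>\<^sub>F h in at 0. ennreal (sqrt (q h / h\<^sup>2)) = transport_cost e (law (t + h)) (law t) / ennreal \<bar>h\<bar>"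
    using upper[OF zero_less_one]
  proof eventually_elim
    case (elim h)
    have "transport_cost e (law (t + h)) (law t) = ennreal (sqrt (q h))"
      using elim q0[of h] by (simp add: transport_cost_def)
    moreover have "sqrt (q h / h\<^sup>2) = sqrt (q h) / \<bar>h\<bar>" by (simp add: real_sqrt_divide)
    ultimately show ?case using elim q0[of h] by (simp add: divide_ennreal)
  qed
  ultimately show ?thesis unfolding has_metric_deriv_def by (rule Lim_transform_eventually)
qed

section \<open>The curve of maximal slope\<close>

text \<open>
  Time zero, where the metric derivative may be infinite, is a null set.
\<close>

lemma is_flux_law: "0 < T \<Longrightarrow> is_flux e T law (flux 1)"
proof -
  assume T: "0 < T"
  have "admissible_time T (\<lambda>s. s) (\<lambda>_. 1)"
    using T unfolding admissible_time_def by (auto intro!: continuous_intros derivative_eq_intros)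
  from curve_in_CE[OF this] have "(law, flux 1) \<in> CE e T" by simp
  moreover have "AE t in lebesgue_on {0..T}. \<exists>l. has_metric_deriv e law t l \<and> l\<^sup>2 = action e (law t) (flux 1 t)"
  proof -
    have "AE t in lebesgue. t \<noteq> (0::real)" using AE_lborel_singleton[of 0] by (rule AE_completion)
    then have "AE t in lebesgue_on {0..T}. 0 < t"
      by (subst AE_restrict_space_iff) auto
    then show ?thesis
    proof eventually_elim
      case (elim t)
      have "(ennreal (sqrt (diss t)))\<^sup>2 = action e (law t) (flux 1 t)"
        using elim diss_nonneg[of t] by (simp add: action_flux dissipation_law ennreal_power)
      then show ?case using metric_derivative[OF elim] by blast
    qed
  qed
  ultimately show ?thesis by (simp add: is_flux_def)
qed

lemma maximal_slope: "0 < T \<Longrightarrow> curve_of_maximal_slope e T law"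
proof -
  assume T: "0 < T"
  \<comment> \<open>the chosen flux may differ from the explicit one, but both have the square of the metric derivative as action\<close>
  have the: "is_flux e T law (the_flux e T law)"
    unfolding the_flux_def by (rule someI[of _ "flux 1"]) (rule is_flux_law[OF T])
  have "AE t in lebesgue_on {0..T}. action e (law t) (the_flux e T law t) = dissipation e (law t)"
  proof -
    have "AE t in lebesgue_on {0..T}. \<exists>l. has_metric_deriv e law t l \<and> l\<^sup>2 = action e (law t) (the_flux e T law t)"
      "AE t in lebesgue_on {0..T}. \<exists>l. has_metric_deriv e law t l \<and> l\<^sup>2 = action e (law t) (flux 1 t)"
      using the is_flux_law[OF T] by (auto simp: is_flux_def)
    moreover have "AE t in lebesgue_on {0..T}. 0 \<le> t" by (rule AE_I2) (simp add: space_restrict_space)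
    ultimately show ?thesis
    proof eventually_elim
      case (elim t)
      then obtain l l' where l: "has_metric_deriv e law t l" "l\<^sup>2 = action e (law t) (the_flux e T law t)"
        "has_metric_deriv e law t l'" "l'\<^sup>2 = action e (law t) (flux 1 t)" by blast
      have "l = l'" using l(1,3) unfolding has_metric_deriv_def by (rule tendsto_unique[rotated]) simp
      then show ?case using l(2,4) elim by (simp add: action_flux)
    qed
  qed
  then have "(\<integral>\<^sup>+t. action e (law t) (the_flux e T law t) \<partial>lebesgue_on {0..T}) = (\<integral>\<^sup>+t. dissipation e (law t) \<partial>lebesgue_on {0..T})"
    by (rule nn_integral_cong_AE)
  also have "\<dots> = ennreal (En 0 - En T)" by (rule energy_identity[OF T])
  finally have "De_Giorgi e T law = 0"
    unfolding De_Giorgi_def energy_identity(1)[OF T] using energy_identity(2)[OF T] T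
    by (simp add: energy_law enn2ereal_ennreal)
  then show ?thesis
    unfolding curve_of_maximal_slope_def using law_AC[OF T] is_flux_law[OF T] by blast
qed

end

theorem theorem3p9:
  fixes e T :: real and f0 :: "real measure"
  assumes "0 \<le> e" and "e < 1" and "0 < T" and "f0 \<in> P2cm"
  shows "\<exists>f. curve_of_maximal_slope e T f \<and> f 0 = f0"
proof -
  have "f0 \<in> borel_prob" "integrable f0 (\<lambda>x. x\<^sup>2)" "(\<integral>x. x \<partial>f0) = 0"
    using assms(4) by (auto simp: P2cm_def)
  then interpret centred_law f0 "(1 - e) / 4"
    using assms(2) by unfold_locales auto
  obtain X where X: "flow X" using flow_exists by blast
  interpret friction_flow f0 "(1 - e) / 4" X e
    using X assms(1,2) by unfold_locales auto
  show ?thesis using maximal_slope[OF assms(3)] law_0 by blast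
qed

end
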